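(* Let $G$ be a finitely generated group, and let $p$ be a prime. Then the following are equivalent: (i) $G$ has an infinite nested sequence of subnormal subgroups, each with index a power of $p$ in $G$, and with linear growth of mod $p$ homology; (ii) the pro-$p$ completion of $G$ has exponential subgroup growth.
   Context: An infinite nested sequence of subgroups is a sequence $G_1 \geq G_2 \geq \dots$ having infinitely many distinct terms. A subgroup $H$ of $G$ is subnormal if there is a finite chain $G = H_0 \triangleright H_1 \triangleright \dots \triangleright H_k = H$ with each term normal in the preceding one. For a group $H$ and prime $p$, $d_p(H)$ denotes the dimension of $H_1(H;\mathbb{F}_p)$ over the field $\mathbb{F}_p$ of order $p$. A collection $\{G_i\}$ of finite index subgroups of $G$ has linear growth of mod $p$ homology if $\inf_i d_p(G_i)/[G:G_i] > 0$. For a group $\Gamma$, $s_n(\Gamma)$ is the number of subgroups of $\Gamma$ with index at most $n$. $\Gamma$ has (at least) exponential subgroup growth if $\limsup_n (\log s_n(\Gamma))/n > 0$. *)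

theory Defs
  imports
    "HOL-Algebra.Generated_Groups"
    "HOL-Algebra.Product_Groups"
    "HOL-Number_Theory.Residues"
    "HOL-Library.Extended_Real"
    "HOL-Library.Liminf_Limsup"
    "Jordan_Normal_Form.Missing_VectorSpace"
begin

section \<open>Subgroups\<close>

definition finitely_generated_group :: "('a, 'b) monoid_scheme \<Rightarrow> bool" where
  "finitely_generated_group G \<longleftrightarrow>
     group G \<and> (\<exists>S. finite S \<and> S \<subseteq> carrier G \<and> generate G S = carrier G)"

text \<open>Since \<^const>\<open>card\<close> is 0 on infinite sets, this is 0 for subgroups of infinite index.\<close>

definition subgroup_index :: "('a, 'b) monoid_scheme \<Rightarrow> 'a set \<Rightarrow> nat" where
  "subgroup_index G H = card (rcosets\<^bsub>G\<^esub> H)"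

definition subnormal :: "'a set \<Rightarrow> ('a, 'b) monoid_scheme \<Rightarrow> bool" where
  "subnormal H G \<longleftrightarrow>
     (\<exists>k S. S 0 = carrier G \<and> S k = H \<and>
        (\<forall>i<k. S (Suc i) \<lhd> G\<lparr>carrier := S i\<rparr>))"

section \<open>Mod $p$ group homology\<close>

text \<open>
  The quotient of a module by a submodule \<open>B\<close>. The ring multiplication and unit that the
  record type demands play no role, here and in \<open>bar_chains\<close> below. The summand \<open>B\<close> in the
  scalar multiplication is needed for scalars such as 0, for which \<open>a \<odot> C\<close> alone is not a coset.
\<close>

definition quotient_module :: "('r, 'm) module \<Rightarrow> 'm set \<Rightarrow> ('r, 'm set) module" where
  "quotient_module M B =
     \<lparr>carrier = a_rcosets\<^bsub>M\<^esub> B, monoid.mult = (\<lambda>_ _. B), one = B,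
      zero = B, add = set_add M,
      smult = (\<lambda>a C. B <+>\<^bsub>M\<^esub> ((\<lambda>x. a \<odot>\<^bsub>M\<^esub> x) ` C))\<rparr>"

text \<open>
  The inhomogeneous bar complex of \<open>G\<close> with trivial coefficients in \<open>\<int>/p\<close>: an \<open>n\<close>-chain is
  a finite formal combination of symbols \<open>[g\<^sub>1|\<dots>|g\<^sub>n]\<close>, represented by its coefficient function
  on lists.
\<close>

definition bar_chains ::
    "nat \<Rightarrow> ('a, 'b) monoid_scheme \<Rightarrow> nat \<Rightarrow> (int, 'a list \<Rightarrow> int) module" where
  "bar_chains p G n =
     \<lparr>carrier = {c. (\<forall>gs. c gs \<in> carrier (residue_ring (int p))) \<and> finite {gs. c gs \<noteq> 0} \<and>
                   (\<forall>gs. c gs \<noteq> 0 \<longrightarrow> length gs = n \<and> set gs \<subseteq> carrier G)},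
      monoid.mult = (\<lambda>_ _ _. 0), one = (\<lambda>_. 0),
      zero = (\<lambda>_. 0), add = (\<lambda>c d gs. c gs \<oplus>\<^bsub>residue_ring (int p)\<^esub> d gs),
      smult = (\<lambda>a c gs. a \<otimes>\<^bsub>residue_ring (int p)\<^esub> c gs)\<rparr>"

text \<open>
  The \<open>i\<close>-th face (\<open>0 \<le> i \<le> n\<close>) of a symbol of length \<open>n > 0\<close> drops \<open>g\<^sub>1\<close> for \<open>i = 0\<close>,
  drops \<open>g\<^sub>n\<close> for \<open>i = n\<close>, and multiplies the neighbours \<open>g\<^sub>i\<close> and \<open>g\<^sub>i\<^sub>+\<^sub>1\<close> otherwise.
\<close>

definition bar_face :: "('a, 'b) monoid_scheme \<Rightarrow> nat \<Rightarrow> 'a list \<Rightarrow> 'a list" where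
  "bar_face G i gs =
     (if i = 0 then tl gs
      else if i = length gs then butlast gs
      else take (i - 1) gs @ [gs ! (i - 1) \<otimes>\<^bsub>G\<^esub> gs ! i] @ drop (i + 1) gs)"

definition bar_boundary ::
    "nat \<Rightarrow> ('a, 'b) monoid_scheme \<Rightarrow> nat \<Rightarrow> ('a list \<Rightarrow> int) \<Rightarrow> 'a list \<Rightarrow> int" where
  "bar_boundary p G n c =
     (if n = 0 then (\<lambda>_. 0)
      else (\<lambda>hs. (\<Sum>gs | c gs \<noteq> 0. \<Sum>i\<le>n. if bar_face G i gs = hs then (-1) ^ i * c gs else 0)
                 mod int p))"

definition group_homology ::
    "nat \<Rightarrow> ('a, 'b) monoid_scheme \<Rightarrow> nat \<Rightarrow> (int, ('a list \<Rightarrow> int) set) module" where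
  "group_homology p G n =
     quotient_module
       ((bar_chains p G n)\<lparr>carrier :=
          {c \<in> carrier (bar_chains p G n). bar_boundary p G n c = (\<lambda>_. 0)}\<rparr>)
       (bar_boundary p G (Suc n) ` carrier (bar_chains p G (Suc n)))"

text \<open>
  \<^const>\<open>vectorspace.dim\<close> is a natural number and meaningful for finite-dimensional spaces only;
  \<open>H\<^sub>1\<close> is finite-dimensional for every finite index subgroup of a finitely generated group.
\<close>

definition homology_dim :: "nat \<Rightarrow> ('a, 'b) monoid_scheme \<Rightarrow> nat" where
  "homology_dim p G = vectorspace.dim (residue_ring (int p)) (group_homology p G 1)"

definition linear_growth_of_homology ::
    "nat \<Rightarrow> ('a, 'b) monoid_scheme \<Rightarrow> 'a set set \<Rightarrow> bool" where
  "linear_growth_of_homology p G \<H> \<longleftrightarrow>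
     (INF H\<in>\<H>. real (homology_dim p (G\<lparr>carrier := H\<rparr>)) / real (subgroup_index G H)) > 0"

section \<open>Pro-$p$ completion\<close>

definition p_power_normal_subgroups :: "nat \<Rightarrow> ('a, 'b) monoid_scheme \<Rightarrow> 'a set set" where
  "p_power_normal_subgroups p G = {N. N \<lhd> G \<and> (\<exists>k. subgroup_index G N = p ^ k)}"

text \<open>
  The inverse limit of the quotients \<open>G Mod N\<close>. For \<open>M \<subseteq> N\<close> the canonical map
  from \<open>G Mod M\<close> to \<open>G Mod N\<close> sends a coset \<open>X\<close> of \<open>M\<close> to the coset \<open>N <#> X\<close> of \<open>N\<close>.
\<close>

definition pro_p_completion ::
    "nat \<Rightarrow> ('a, 'b) monoid_scheme \<Rightarrow> ('a set \<Rightarrow> 'a set) monoid" where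
  "pro_p_completion p G =
     (let I = p_power_normal_subgroups p G; P = product_group I (\<lambda>N. G Mod N)
      in P\<lparr>carrier := {f \<in> carrier P. \<forall>M\<in>I. \<forall>N\<in>I. M \<subseteq> N \<longrightarrow> f N = N <#>\<^bsub>G\<^esub> f M}\<rparr>)"

section \<open>Subgroup growth\<close>

definition subgroups_of_index_le :: "('a, 'b) monoid_scheme \<Rightarrow> nat \<Rightarrow> 'a set set" where
  "subgroups_of_index_le G n =
     {H. subgroup H G \<and> finite (rcosets\<^bsub>G\<^esub> H) \<and> subgroup_index G H \<le> n}"

text \<open>The logarithm of the number of subgroups of index at most \<open>n\<close>.\<close>

definition log_subgroup_count :: "('a, 'b) monoid_scheme \<Rightarrow> nat \<Rightarrow> ereal" where
  "log_subgroup_count G n =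
     (if finite (subgroups_of_index_le G n)
      then ereal (ln (real (card (subgroups_of_index_le G n)))) else \<infinity>)"

definition exponential_subgroup_growth :: "('a, 'b) monoid_scheme \<Rightarrow> bool" where
  "exponential_subgroup_growth G \<longleftrightarrow>
     limsup (\<lambda>n. log_subgroup_count G n / ereal (real n)) > 0"

end

theory Submission
  imports Defs "HOL-Algebra.Group_Action" "HOL-Algebra.Sylow"
begin

text \<open>
  Call a subgroup open if it contains a normal subgroup of \<open>p\<close>-power index. These are exactly the
  subnormal subgroups of \<open>p\<close>-power index, and each one other than \<open>G\<close> is normal of index \<open>p\<close> in
  another. By Serre's argument every finite index subgroup of the pro-\<open>p\<close> completion is the closure
  of a unique open subgroup of \<open>G\<close>, so both conditions are statements about open subgroups.

  An open subgroup \<open>H\<close> of index \<open>q\<close> has \<open>p\<^sup>d\<close> homomorphisms to \<open>\<int>/p\<close>, where \<open>d = d\<^sub>p(H)\<close>, hence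
  at least \<open>p\<^sup>d\<^sup>-\<^sup>1\<close> open subgroups of index at most \<open>p q\<close> arise as their kernels: linear growth of
  homology gives exponential subgroup growth.

  Conversely, \<open>d\<^sub>p(H') \<le> p d\<^sub>p(H)\<close> if \<open>H'\<close> is normal of index \<open>p\<close> in \<open>H\<close>, so the ratio of \<open>d\<^sub>p\<close> to
  the index does not increase down a chain. If for some \<open>c > 0\<close> every index \<open>p\<^sup>k\<close> has an open
  subgroup with ratio at least \<open>c\<close>, then so do all the subgroups in a chain above it, and Koenig's
  lemma gives a nested sequence. Otherwise, for every \<open>c > 0\<close> the ratio is eventually below \<open>c\<close>, and
  counting kernels level by level shows that the number of open subgroups of index at most \<open>n\<close> is
  at most \<open>O(n) p\<^sup>c\<^sup>n\<close>.
\<close>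

section \<open>Indices and central elements of finite \<open>p\<close>-groups\<close>

text \<open>The obstacle is that subgroups of the completion are counted as abstract subgroups.
  Every element of the completion has \<open>m\<close>-th roots for \<open>m\<close> prime to
  \<open>p\<close>, which forces a normal subgroup of finite index to have \<open>p\<close>-power
  index and permits a descent in steps of index \<open>p\<close>. Each step is the kernel of a
  homomorphism to Z/p that might be discontinuous. It is tractable because an element of the closure
  of H^p[H,H] is a product of boundedly many commutators and one \<open>p\<close>-th power, and
  these are killed by every homomorphism to Z/p.

  Homology enters only through |Hom(H, Z/p)| = p^d, so all growth estimates count homomorphisms and
  their kernels.

  For the bound on d_p(H'), let T be the action on Hom(H', Z/p) of conjugation by an element t
  generating H over H'. Since (T - 1)^p = 0, |Hom(H', Z/p)| is at most the \<open>p\<close>-th power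
  of the number of T-invariant homomorphisms. An invariant one extends to H exactly when it vanishes
  at t^p. This condition costs at most a factor p, regained from the p homomorphisms H -> Z/p that
  kill H', so the invariants number at most |Hom(H, Z/p)|.\<close>

lemma card_image_eqI:
  assumes "\<And>x y. x \<in> A \<Longrightarrow> y \<in> A \<Longrightarrow> f x = f y \<longleftrightarrow> g x = g y"
  shows "card (f ` A) = card (g ` A)"
proof -
  define h where "h c = g (SOME x. x \<in> A \<and> f x = c)" for c
  have h: "h (f x) = g x" if "x \<in> A" for x
  proof -
    have "(SOME y. y \<in> A \<and> f y = f x) \<in> A \<and> f (SOME y. y \<in> A \<and> f y = f x) = f x"
      by (rule someI_ex) (use that in blast)
    then show ?thesis unfolding h_def using assms that by blast
  qed
  have "bij_betw h (f ` A) (g ` A)"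
    unfolding bij_betw_def
  proof
    show "inj_on h (f ` A)" by (rule inj_onI) (use h assms in auto)
    show "h ` f ` A = g ` A" using h by (auto simp: image_image)
  qed
  then show ?thesis by (rule bij_betw_same_card)
qed

text \<open>The index of \<open>K\<close> in \<open>H\<close>, computed inside one ambient group.
  Only the multiplication of \<open>G\<close> enters, so the number survives any restriction of the
  carrier. An infinite index counts as 0.\<close>

definition rel_index :: "('a, 'b) monoid_scheme \<Rightarrow> 'a set \<Rightarrow> 'a set \<Rightarrow> nat" where
  "rel_index G H K = card ((\<lambda>h. K #>\<^bsub>G\<^esub> h) ` H)"

lemma rel_index_carrier: "rel_index (G\<lparr>carrier := M\<rparr>) H K = rel_index G H K"
  by (simp add: rel_index_def)

lemma rcosets_eq_image: "rcosets\<^bsub>G\<^esub> K = (\<lambda>h. K #>\<^bsub>G\<^esub> h) ` carrier G"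
  by (auto simp: RCOSETS_def)

lemma subgroup_index_eq: "subgroup_index G K = rel_index G (carrier G) K"
  by (simp add: subgroup_index_def rel_index_def rcosets_eq_image)

context group
begin

lemma rcos_eq_iff:
  assumes "subgroup K G" "x \<in> carrier G" "y \<in> carrier G"
  shows "K #> x = K #> y \<longleftrightarrow> x \<otimes> inv y \<in> K"
  by (metis assms coset_join1 coset_join2 coset_mult_inv1 coset_mult_inv2 inv_closed m_closed subgroup.subset)

text \<open>Every \<open>K\<close>-coset in \<open>H\<close> is uniquely \<open>D #> r C\<close>
  with \<open>C\<close> an \<open>M\<close>-coset in \<open>H\<close>, \<open>r C\<close> a chosen
  representative of it, and \<open>D\<close> a \<open>K\<close>-coset in \<open>M\<close>. Infinite
  indices are covered, because both sides are then 0.\<close>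

lemma rel_index_mult:
  assumes K: "subgroup K G" and M: "subgroup M G" and H: "subgroup H G"
    and KM: "K \<subseteq> M" and MH: "M \<subseteq> H"
  shows "rel_index G H K = rel_index G H M * rel_index G M K"
proof -
  define A where "A = (\<lambda>h. M #> h) ` H"
  define B where "B = (\<lambda>h. K #> h) ` M"
  define r where "r C = (SOME h. h \<in> H \<and> C = M #> h)" for C
  have r: "r C \<in> H \<and> C = M #> r C" if "C \<in> A" for C
    unfolding r_def by (rule someI_ex) (use that in \<open>unfold A_def, blast\<close>)
  have HG: "H \<subseteq> carrier G" and MG: "M \<subseteq> carrier G" and KG: "K \<subseteq> carrier G"
    using subgroup.subset H M K by auto
  have eq: "K #> m #> x = K #> (m \<otimes> x)" if "m \<in> M" "x \<in> H" for m x
    using that by (meson HG KG MG coset_mult_assoc in_mono)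
  have bij: "bij_betw (\<lambda>(C, D). D #> r C) (A \<times> B) ((\<lambda>h. K #> h) ` H)"
    unfolding bij_betw_def
  proof
    show "inj_on (\<lambda>(C, D). D #> r C) (A \<times> B)"
    proof (rule inj_onI, clarify)
      fix C D C' D'
      assume C: "C \<in> A" "C' \<in> A" and D: "D \<in> B" "D' \<in> B" and e: "D #> r C = D' #> r C'"
      from D obtain m m' where m: "m \<in> M" "m' \<in> M" "D = K #> m" "D' = K #> m'"
        by (auto simp: B_def)
      let ?r = "r C" and ?r' = "r C'"
      have rr: "?r \<in> H" "?r' \<in> H" using r C by auto
      have cl: "m \<in> carrier G" "m' \<in> carrier G" "?r \<in> carrier G" "?r' \<in> carrier G"
        using m rr HG MG by auto
      have "K #> (m \<otimes> ?r) = K #> (m' \<otimes> ?r')" using e m rr eq by simp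
      then have k: "m \<otimes> ?r \<otimes> inv (m' \<otimes> ?r') \<in> K"
        using rcos_eq_iff[OF K] cl by simp
      have "inv m \<otimes> (m \<otimes> ?r \<otimes> inv (m' \<otimes> ?r')) \<otimes> m' \<in> M"
        using k m M KM by (meson subgroup.m_closed subgroup.m_inv_closed subsetD)
      moreover have "inv m \<otimes> (m \<otimes> ?r \<otimes> inv (m' \<otimes> ?r')) \<otimes> m' = ?r \<otimes> inv ?r'"
        using cl by (simp add: inv_mult_group m_assoc[symmetric])
          (simp add: m_assoc)
      ultimately have "M #> ?r = M #> ?r'" using rcos_eq_iff[OF M] cl by simp
      then have CC: "C = C'" using r C by auto
      have "m \<otimes> ?r \<otimes> inv (m' \<otimes> ?r') = m \<otimes> inv m'"
        unfolding CC[symmetric] using cl CC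
        by (simp add: inv_mult_group m_assoc[symmetric]) (simp add: m_assoc)
      then have "D = D'" using k m cl rcos_eq_iff[OF K] by simp
      then show "C = C' \<and> D = D'" using CC by simp
    qed
    show "(\<lambda>(C, D). D #> r C) ` (A \<times> B) = (\<lambda>h. K #> h) ` H"
    proof
      show "(\<lambda>(C, D). D #> r C) ` (A \<times> B) \<subseteq> (\<lambda>h. K #> h) ` H"
      proof clarify
        fix C D assume CD: "C \<in> A" "D \<in> B"
        then obtain m where m: "m \<in> M" "D = K #> m" by (auto simp: B_def)
        have "D #> r C = K #> (m \<otimes> r C)" using m CD r eq by simp
        moreover have "m \<otimes> r C \<in> H" using m CD r MH H by (meson subgroup.m_closed subsetD)
        ultimately show "D #> r C \<in> (\<lambda>h. K #> h) ` H" by blast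
      qed
      show "(\<lambda>h. K #> h) ` H \<subseteq> (\<lambda>(C, D). D #> r C) ` (A \<times> B)"
      proof clarify
        fix h assume h: "h \<in> H"
        let ?C = "M #> h"
        have C: "?C \<in> A" using h by (simp add: A_def)
        let ?r = "r ?C"
        have rr: "?r \<in> H" "?C = M #> ?r" using r[OF C] by auto
        have cl: "h \<in> carrier G" "?r \<in> carrier G" using h rr HG by auto
        have m: "h \<otimes> inv ?r \<in> M" using rr cl rcos_eq_iff[OF M] by simp
        have "K #> (h \<otimes> inv ?r) #> ?r = K #> h"
          using eq[OF m rr(1)] cl by (simp add: m_assoc)
        moreover have "K #> (h \<otimes> inv ?r) \<in> B" using m by (auto simp: B_def)
        ultimately show "K #> h \<in> (\<lambda>(C, D). D #> r C) ` (A \<times> B)" using C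
          by (intro image_eqI[where x = "(?C, K #> (h \<otimes> inv ?r))"]) auto
      qed
    qed
  qed
  then show ?thesis
    unfolding rel_index_def
    using bij_betw_same_card[OF bij] by (simp add: card_cartesian_product A_def B_def)
qed

lemma rel_index_eq_1:
  assumes "subgroup K G" "subgroup H G" "K \<subseteq> H" "rel_index G H K = 1"
  shows "K = H"
proof
  show "H \<subseteq> K"
  proof
    fix h assume h: "h \<in> H"
    have "\<one> \<in> H" using assms(2) by (simp add: subgroup.one_closed)
    from assms(4) obtain C where "(\<lambda>h. K #> h) ` H = {C}"
      unfolding rel_index_def using card_1_singletonE by blast
    then have "K #> h = K #> \<one>" using h \<open>\<one> \<in> H\<close> by (metis imageI singletonD)
    then show "h \<in> K" using rcos_eq_iff[OF assms(1)] h assms(2)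
      by (metis inv_one one_closed r_one subgroup.mem_carrier)
  qed
qed (use assms in auto)

lemma rel_index_self:
  assumes "subgroup H G"
  shows "rel_index G H H = 1"
proof -
  have "(\<lambda>h. H #> h) ` H = {H}"
  proof
    show "(\<lambda>h. H #> h) ` H \<subseteq> {H}" 
    proof clarify
      fix h assume "h \<in> H"
      then show "H #> h = H" using coset_join2[OF subgroup.mem_carrier[OF assms] assms] by simp
    qed
    have "H #> \<one> = H" using assms by (simp add: subgroup.subset)
    then show "{H} \<subseteq> (\<lambda>h. H #> h) ` H" using subgroup.one_closed[OF assms] by blast
  qed
  then show ?thesis by (simp add: rel_index_def)
qed

text \<open>Conjugacy classes have size 1 or a multiple of \<open>p\<close>. If the identity were
  the only central element, the class equation would make \<open>p\<close> divide 1. A suitable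
  power of a nontrivial central element has order \<open>p\<close>.\<close>

lemma finite_p_group_center:
  assumes p: "prime p" and ord: "order G = p ^ Suc k"
  shows "\<exists>z\<in>carrier G. z \<noteq> \<one> \<and> z [^] p = \<one> \<and> (\<forall>g\<in>carrier G. z \<otimes> g = g \<otimes> z)"
proof -
  have fin: "finite (carrier G)"
    using ord p order_gt_0_iff_finite prime_gt_0_nat by simp
  let ?\<phi> = "\<lambda>g. \<lambda>h\<in>carrier G. g \<otimes> h \<otimes> inv g"
  interpret act: group_action G "carrier G" ?\<phi>
    by (rule action_by_conjugation)
  let ?O = "orbits G (carrier G) ?\<phi>"
  define Z where "Z = {z \<in> carrier G. \<forall>g\<in>carrier G. z \<otimes> g = g \<otimes> z}"
  have cardorb: "card orb = 1 \<or> p dvd card orb" if "orb \<in> ?O" for orb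
  proof -
    from that obtain x where x: "x \<in> carrier G" "orb = orbit G ?\<phi> x" by (auto simp: orbits_def)
    have "card orb * card (stabilizer G ?\<phi> x) = p ^ Suc k"
      using act.orbit_stabilizer_theorem[OF x(1)] x ord by simp
    then have "card orb dvd p ^ Suc k" by (rule dvdI[OF sym])
    then obtain i where "card orb = p ^ i" using divides_primepow_nat[OF p] by blast
    then show ?thesis by (cases i) auto
  qed
  have one: "\<one> \<in> Z" by (simp add: Z_def)
  have "Z \<noteq> {\<one>}"
  proof
    assume Z1: "Z = {\<one>}"
    have finO: "finite ?O" using fin by (simp add: orbits_def)
    have orb1: "orbit G ?\<phi> \<one> = {\<one>}"
      by (auto simp: orbit_def intro!: exI[of _ \<one>])
    have O1: "{\<one>} \<in> ?O" using orb1 unfolding orbits_def by force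
    have dv: "p dvd card orb" if "orb \<in> ?O - {{\<one>}}" for orb
    proof (rule ccontr)
      assume n: "\<not> p dvd card orb"
      from that obtain x where x: "x \<in> carrier G" "orb = orbit G ?\<phi> x" by (auto simp: orbits_def)
      have "card orb = 1" using cardorb that n by auto
      moreover have "x \<in> orb" using x act.orbit_refl by simp
      ultimately have ox: "orb = {x}" by (metis card_1_singletonE singletonD)
      have "x \<otimes> g = g \<otimes> x" if g: "g \<in> carrier G" for g
      proof -
        have "g \<otimes> x \<otimes> inv g \<in> orb" using g x unfolding orbit_def by force
        then have "g \<otimes> x \<otimes> inv g = x" using ox by simp
        then show ?thesis using g x by (metis inv_solve_right m_closed)
      qed
      then have "x \<in> Z" using x by (simp add: Z_def)
      then show False using Z1 ox that by simp
    qed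
    have "card (carrier G) = (\<Sum>orb\<in>?O. card orb)"
    proof -
      have part: "partition (carrier G) ?O" by (rule act.orbit_partition)
      have "\<Union>?O = carrier G" using act.orbits_coverture .
      moreover have "pairwise disjnt ?O"
        using act.disjoint_union unfolding pairwise_def disjnt_def by blast
      moreover have "\<And>A. A \<in> ?O \<Longrightarrow> finite A"
        using Union_upper[of _ ?O] finite_subset[OF _ fin] act.orbits_coverture by simp
      ultimately show ?thesis using card_Union_disjoint[of ?O] by simp
    qed
    also have "\<dots> = card {\<one>} + (\<Sum>orb\<in>?O - {{\<one>}}. card orb)"
      using O1 finO by (rule sum.remove[rotated])
    finally have "p ^ Suc k = 1 + (\<Sum>orb\<in>?O - {{\<one>}}. card orb)"
      using ord by (simp add: order_def)
    moreover have "p dvd (\<Sum>orb\<in>?O - {{\<one>}}. card orb)" using dv by (rule dvd_sum)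
    moreover have "p dvd p ^ Suc k" by simp
    ultimately have "p dvd 1"
      using dvd_add_left_iff[of p "\<Sum>orb\<in>?O - {{\<one>}}. card orb" 1] by (simp del: power_Suc)
    then show False using p by simp
  qed
  then obtain z where z: "z \<in> Z" "z \<noteq> \<one>" using one by blast
  then have zG: "z \<in> carrier G" by (simp add: Z_def)
  have "z [^] (p ^ Suc k) = \<one>" using pow_order_eq_1[OF zG] ord by simp
  \<comment> \<open>By minimality of \<open>j\<close>, the power of \<open>z\<close> with exponent
    \<open>p ^ (j - 1)\<close> is nontrivial, while its \<open>p\<close>-th power is
    trivial.\<close>
  define j where "j = (LEAST j. z [^] (p ^ j) = \<one>)"
  have j: "z [^] (p ^ j) = \<one>"
    unfolding j_def by (rule LeastI) (rule \<open>z [^] (p ^ Suc k) = \<one>\<close>)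
  have "j \<noteq> 0" using j z zG by (metis nat_pow_eone power_0)
  then obtain i where i: "j = Suc i" using not0_implies_Suc by blast
  define y where "y = z [^] (p ^ i)"
  have "y \<noteq> \<one>" unfolding y_def using not_less_Least[of i "\<lambda>j. z [^] (p ^ j) = \<one>", folded j_def] i
    by simp
  moreover have "y [^] p = \<one>" unfolding y_def using j i zG by (simp add: nat_pow_pow mult.commute)
  moreover have "y \<otimes> g = g \<otimes> y" if "g \<in> carrier G" for g
    unfolding y_def using z zG that by (simp add: Z_def group_commutes_pow)
  moreover have "y \<in> carrier G" using zG by (simp add: y_def)
  ultimately show ?thesis by blast
qed

text \<open>A central element of order \<open>p\<close> in the finite \<open>p\<close>-group
  \<open>G Mod N\<close>, pulled back to \<open>G\<close>: centrality and order become membership of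
  commutators and of a \<open>p\<close>-th power in \<open>N\<close>.\<close>

lemma central_step:
  assumes p: "prime p" and N: "N \<lhd> G" and ind: "rel_index G (carrier G) N = p ^ Suc k"
  shows "\<exists>z\<in>carrier G. z \<notin> N \<and> z [^] p \<in> N \<and> (\<forall>g\<in>carrier G. z \<otimes> g \<otimes> inv z \<otimes> inv g \<in> N)"
proof -
  interpret N: normal N G by (rule N)
  interpret Q: group "G Mod N" by (rule N.factorgroup_is_group)
  have "order (G Mod N) = p ^ Suc k"
    using ind by (simp add: order_def carrier_FactGroup rel_index_def)
  from Q.finite_p_group_center[OF p this] obtain Z where
    Z: "Z \<in> carrier (G Mod N)" "Z \<noteq> N" "Z [^]\<^bsub>G Mod N\<^esub> p = N"
    and com: "\<And>g. g \<in> carrier (G Mod N) \<Longrightarrow> Z \<otimes>\<^bsub>G Mod N\<^esub> g = g \<otimes>\<^bsub>G Mod N\<^esub> Z"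
    by auto
  from Z(1) obtain z where z: "z \<in> carrier G" "Z = N #> z" by (auto simp: carrier_FactGroup)
  have "z \<notin> N" using Z(2) z N.rcos_const is_group by blast
  moreover have "z [^] p \<in> N"
    using Z(3) z by (metis N.FactGroup_pow coset_join1 nat_pow_closed N.subset N.is_subgroup)
  moreover have "z \<otimes> g \<otimes> inv z \<otimes> inv g \<in> N" if g: "g \<in> carrier G" for g
  proof -
    have "(N #> z) <#> (N #> g) = (N #> g) <#> (N #> z)"
      using com[of "N #> g"] g z by (simp add: carrier_FactGroup)
    then have "N #> (z \<otimes> g) = N #> (g \<otimes> z)" using g z by (simp add: N.rcos_sum)
    then have "(z \<otimes> g) \<otimes> inv (g \<otimes> z) \<in> N" using g z rcos_eq_iff[OF N.is_subgroup] by simp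
    then show ?thesis using g z by (simp add: inv_mult_group m_assoc)
  qed
  ultimately show ?thesis using z by blast
qed

end

section \<open>Homomorphisms to the integers mod \<open>p\<close> and chains of index \<open>p\<close>\<close>

text \<open>This is Hom(G, Z/p), the first cohomology of \<open>G\<close> with coefficients in the
  field of order \<open>p\<close>. Values are the residues \<open>0..p-1\<close> and functions are
  extensional, so that agreement on the carrier is equality and cardinalities are
  meaningful.\<close>

definition mod_homs :: "nat \<Rightarrow> ('a, 'b) monoid_scheme \<Rightarrow> ('a \<Rightarrow> int) set" where
  "mod_homs p G = {\<phi> \<in> carrier G \<rightarrow>\<^sub>E {0..<int p}.
     \<forall>x\<in>carrier G. \<forall>y\<in>carrier G. \<phi> (x \<otimes>\<^bsub>G\<^esub> y) = (\<phi> x + \<phi> y) mod int p}"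

lemma mod_homsI:
  assumes "\<And>x. x \<in> carrier G \<Longrightarrow> \<phi> x \<in> {0..<int p}" "\<And>x. x \<notin> carrier G \<Longrightarrow> \<phi> x = undefined"
    "\<And>x y. x \<in> carrier G \<Longrightarrow> y \<in> carrier G \<Longrightarrow> \<phi> (x \<otimes>\<^bsub>G\<^esub> y) = (\<phi> x + \<phi> y) mod int p"
  shows "\<phi> \<in> mod_homs p G"
  using assms unfolding mod_homs_def by (auto simp: PiE_def extensional_def)

lemma mod_homs_range: "\<phi> \<in> mod_homs p G \<Longrightarrow> x \<in> carrier G \<Longrightarrow> 0 \<le> \<phi> x \<and> \<phi> x < int p"
  unfolding mod_homs_def by (auto simp: PiE_def Pi_def)

lemma mod_homs_mod: "\<phi> \<in> mod_homs p G \<Longrightarrow> x \<in> carrier G \<Longrightarrow> \<phi> x mod int p = \<phi> x"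
  using mod_homs_range[of \<phi> p G x] by (simp add: mod_pos_pos_trivial)

lemma mod_homs_mult:
  "\<phi> \<in> mod_homs p G \<Longrightarrow> x \<in> carrier G \<Longrightarrow> y \<in> carrier G \<Longrightarrow>
     \<phi> (x \<otimes>\<^bsub>G\<^esub> y) = (\<phi> x + \<phi> y) mod int p"
  unfolding mod_homs_def by auto

lemma mod_homs_eqI:
  assumes "\<phi> \<in> mod_homs p G" "\<psi> \<in> mod_homs p G" "\<And>x. x \<in> carrier G \<Longrightarrow> \<phi> x = \<psi> x"
  shows "\<phi> = \<psi>"
  using assms unfolding mod_homs_def by (auto intro: PiE_ext)

lemma mod_homs_restrict:
  assumes "\<phi> \<in> mod_homs p (G\<lparr>carrier := H\<rparr>)" "K \<subseteq> H"
    "\<And>x y. x \<in> K \<Longrightarrow> y \<in> K \<Longrightarrow> x \<otimes>\<^bsub>G\<^esub> y \<in> K"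
  shows "restrict \<phi> K \<in> mod_homs p (G\<lparr>carrier := K\<rparr>)"
proof (rule mod_homsI)
  fix x y assume xy: "x \<in> carrier (G\<lparr>carrier := K\<rparr>)" "y \<in> carrier (G\<lparr>carrier := K\<rparr>)"
  then show "restrict \<phi> K x \<in> {0..<int p}"
    using mod_homs_range[OF assms(1), of x] assms(2) by auto
  show "restrict \<phi> K (x \<otimes>\<^bsub>G\<lparr>carrier := K\<rparr>\<^esub> y) = (restrict \<phi> K x + restrict \<phi> K y) mod int p"
    using mod_homs_mult[OF assms(1), of x y] assms(2,3) xy by auto
qed auto

definition hom_kernel :: "('a, 'b) monoid_scheme \<Rightarrow> ('a \<Rightarrow> int) \<Rightarrow> 'a set" where
  "hom_kernel G \<phi> = {x \<in> carrier G. \<phi> x = 0}"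

context group
begin

lemma subgroup_nat_pow_closed:
  assumes "subgroup H G" "x \<in> H"
  shows "x [^] (n::nat) \<in> H"
  by (induction n) (use assms in \<open>auto simp: subgroup.one_closed subgroup.m_closed\<close>)

lemma rcos_mult_left:
  assumes H: "subgroup H G" and h: "h \<in> H" and x: "x \<in> carrier G"
  shows "H #> (h \<otimes> x) = H #> x"
proof -
  have hG: "h \<in> carrier G" by (rule subgroup.mem_carrier[OF H h])
  then have "h \<otimes> x \<otimes> inv x \<in> H" using h x by (simp add: m_assoc)
  then show ?thesis using rcos_eq_iff[OF H m_closed[OF hG x] x] by blast
qed

lemma mod_homs_one: "\<phi> \<in> mod_homs p G \<Longrightarrow> 0 < p \<Longrightarrow> \<phi> \<one> = 0"
proof -
  assume a: "\<phi> \<in> mod_homs p G" "0 < p"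
  have "\<phi> \<one> = (\<phi> \<one> + \<phi> \<one>) mod int p" using mod_homs_mult[OF a(1), of \<one> \<one>] by simp
  then have "[\<phi> \<one> + \<phi> \<one> = \<phi> \<one> + 0] (mod int p)"
    using mod_homs_mod[OF a(1), of \<one>] by (simp add: cong_def)
  then have "\<phi> \<one> mod int p = 0 mod int p"
    by (simp only: cong_add_lcancel) (simp add: cong_def)
  then show ?thesis using mod_homs_mod[OF a(1), of \<one>] by simp
qed

lemma mod_homs_pow:
  assumes "\<phi> \<in> mod_homs p G" "0 < p" "x \<in> carrier G"
  shows "\<phi> (x [^] (n::nat)) = (int n * \<phi> x) mod int p"
proof (induction n)
  case 0
  then show ?case using mod_homs_one assms by simp
next
  case (Suc n)
  then show ?case using mod_homs_mult[OF assms(1), of "x [^] n" x] assms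
    by (simp add: mod_simps algebra_simps)
qed

lemma mod_homs_inv:
  assumes "\<phi> \<in> mod_homs p G" "0 < p" "x \<in> carrier G"
  shows "\<phi> (inv x) = (- \<phi> x) mod int p"
proof -
  have "(\<phi> (inv x) + \<phi> x) mod int p = 0"
    using mod_homs_mult[OF assms(1), of "inv x" x] mod_homs_one[OF assms(1,2)] assms(3) by simp
  then have "(\<phi> (inv x) + \<phi> x - \<phi> x) mod int p = (0 - \<phi> x) mod int p"
    using mod_diff_left_eq[of "\<phi> (inv x) + \<phi> x" "int p" "\<phi> x"] by simp
  then show ?thesis using mod_homs_mod[OF assms(1), of "inv x"] assms(3) by simp
qed

lemma mod_homs_conj:
  assumes "\<phi> \<in> mod_homs p G" "0 < p" "x \<in> carrier G" "g \<in> carrier G"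
  shows "\<phi> (g \<otimes> x \<otimes> inv g) = \<phi> x"
  using assms mod_homs_mod[OF assms(1,3)]
  by (simp add: mod_homs_mult[OF assms(1)] mod_homs_inv[OF assms(1)] mod_simps)

lemma mod_homs_comm:
  assumes "\<phi> \<in> mod_homs p G" "0 < p" "x \<in> carrier G" "g \<in> carrier G"
  shows "\<phi> (x \<otimes> g \<otimes> inv x \<otimes> inv g) = 0"
  using assms
  by (simp add: mod_homs_mult[OF assms(1)] mod_homs_inv[OF assms(1)] mod_simps)

lemma hom_kernel_normal:
  assumes "\<phi> \<in> mod_homs p G" "0 < p"
  shows "hom_kernel G \<phi> \<lhd> G"
proof -
  have "subgroup (hom_kernel G \<phi>) G"
    using mod_homs_one[OF assms] mod_homs_mult[OF assms(1)] mod_homs_inv[OF assms]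
    by unfold_locales (auto simp: hom_kernel_def)
  then show ?thesis
    unfolding normal_inv_iff using mod_homs_conj[OF assms] by (auto simp: hom_kernel_def)
qed

lemma hom_kernel_rcos_eq:
  assumes "\<phi> \<in> mod_homs p G" "0 < p" "x \<in> carrier G" "y \<in> carrier G"
  shows "hom_kernel G \<phi> #> x = hom_kernel G \<phi> #> y \<longleftrightarrow> \<phi> x = \<phi> y"
proof -
  have "hom_kernel G \<phi> #> x = hom_kernel G \<phi> #> y \<longleftrightarrow> \<phi> (x \<otimes> inv y) = 0"
    using rcos_eq_iff[OF normal_imp_subgroup[OF hom_kernel_normal[OF assms(1,2)]] assms(3,4)] assms(3,4)
    by (simp add: hom_kernel_def)
  also have "\<phi> (x \<otimes> inv y) = (\<phi> x - \<phi> y) mod int p"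
    using mod_homs_mult[OF assms(1), of x "inv y"] mod_homs_inv[OF assms(1,2), of y] assms
    by (simp add: mod_simps)
  also have "(\<phi> x - \<phi> y) mod int p = 0 \<longleftrightarrow> \<phi> x mod int p = \<phi> y mod int p"
    by (metis cong_def cong_iff_dvd_diff dvd_eq_mod_eq_0)
  finally show ?thesis using mod_homs_mod[OF assms(1)] assms by simp
qed

text \<open>A nonzero residue is invertible modulo the prime \<open>p\<close>, so the powers of one
  element with nonzero value realise all residues. Cosets of the kernel correspond to
  values.\<close>

lemma hom_kernel_index:
  assumes "\<phi> \<in> mod_homs p G" "prime p"
  shows "(hom_kernel G \<phi> = carrier G \<or> rel_index G (carrier G) (hom_kernel G \<phi>) = p)"
proof (cases "hom_kernel G \<phi> = carrier G")
  case False
  have p0: "0 < p" using assms(2) prime_gt_0_nat by blast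
  from False obtain x where x: "x \<in> carrier G" "\<phi> x \<noteq> 0" by (auto simp: hom_kernel_def)
  define a where "a = nat (\<phi> x)"
  have a: "\<phi> x = int a" "a < p" using mod_homs_range[OF assms(1) x(1)] by (auto simp: a_def)
  have "\<not> p dvd a" using a x(2) by (auto dest: nat_dvd_not_less)
  then obtain u v where uv: "a * u = Suc (p * v)" using bezout_prime[OF assms(2)] by blast
  have "\<phi> ` carrier G = {0..<int p}"
  proof
    show "\<phi> ` carrier G \<subseteq> {0..<int p}" using mod_homs_range[OF assms(1)] by auto
    show "{0..<int p} \<subseteq> \<phi> ` carrier G"
    proof
      fix i assume i: "i \<in> {0..<int p}"
      \<comment> \<open>\<open>u\<close> is an inverse of \<open>a\<close> modulo \<open>p\<close>,
        so the exponent \<open>u * i\<close> produces the residue \<open>i\<close>.\<close>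
      have "\<phi> (x [^] (u * nat i)) = (int (a * u) * i) mod int p"
        using mod_homs_pow[OF assms(1) p0 x(1), of "u * nat i"] i a by (simp add: algebra_simps)
      also have "\<dots> = (i + int p * (int v * i)) mod int p" unfolding uv by (simp add: algebra_simps)
      also have "\<dots> = i" using i by simp
      finally show "i \<in> \<phi> ` carrier G" using x(1) by (metis image_eqI nat_pow_closed)
    qed
  qed
  moreover have "card (\<phi> ` carrier G) = card ((\<lambda>h. hom_kernel G \<phi> #> h) ` carrier G)"
    by (rule card_image_eqI) (simp add: hom_kernel_rcos_eq[OF assms(1) p0])
  ultimately show ?thesis by (simp add: rel_index_def)
qed simp

section \<open>Adjoining an element that is central of order \<open>p\<close> modulo a
  subgroup\<close>

lemma pow_coset_mod:
  assumes H: "subgroup H G" and z: "z \<in> carrier G" "z [^] p \<in> H"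
  shows "H #> z [^] (i::nat) = H #> z [^] (i mod p)"
proof -
  have "z [^] i = z [^] (p * (i div p)) \<otimes> z [^] (i mod p)"
    using z by (simp add: nat_pow_mult)
  moreover have "z [^] (p * (i div p)) \<in> H"
    using z H by (simp add: nat_pow_pow[symmetric] subgroup_nat_pow_closed)
  ultimately show ?thesis using rcos_mult_left[OF H] z by simp
qed

text \<open>A coincidence between two of the cosets puts a power of \<open>z\<close> with exponent
  strictly between 0 and \<open>p\<close> into \<open>H\<close>. Bezout with the exponent
  \<open>p\<close> then puts \<open>z\<close> itself into \<open>H\<close>.\<close>

lemma inj_on_pow_coset:
  assumes H: "subgroup H G" and z: "z \<in> carrier G" "z [^] p \<in> H" "z \<notin> H" and p: "prime p"
  shows "inj_on (\<lambda>i::nat. H #> z [^] i) {..<p}"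
proof (rule linorder_inj_onI')
  fix i j :: nat assume ij: "i \<in> {..<p}" "j \<in> {..<p}" "i < j"
  show "H #> z [^] i \<noteq> H #> z [^] j"
  proof
    assume "H #> z [^] i = H #> z [^] j"
    then have "z [^] j \<otimes> inv (z [^] i) \<in> H"
      using rcos_eq_iff[OF H nat_pow_closed[OF z(1)] nat_pow_closed[OF z(1)], of j i] by simp
    moreover have "z [^] j = z [^] (j - i) \<otimes> z [^] i" using z ij by (simp add: nat_pow_mult)
    ultimately have a: "z [^] (j - i) \<in> H" using z by (simp add: m_assoc)
    have "\<not> p dvd (j - i)" using ij by (auto dest: dvd_imp_le)
    then obtain u v where uv: "(j - i) * u = Suc (p * v)" using bezout_prime[OF p] by blast
    have "z [^] ((j - i) * u) \<in> H" "z [^] (p * v) \<in> H"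
      using a z H by (simp_all add: nat_pow_pow[symmetric] subgroup_nat_pow_closed)
    then have "inv (z [^] (p * v)) \<otimes> (z [^] (p * v) \<otimes> z) \<in> H"
      using uv H by (simp add: subgroup.m_closed subgroup.m_inv_closed)
    then have "z \<in> H" using z by (simp add: m_assoc[symmetric])
    then show False using z by simp
  qed
qed

text \<open>\<open>M\<close> is the product of \<open>H\<close> and the powers of \<open>z\<close>.
  The element \<open>z\<close> normalises \<open>H\<close> because z h z^-1 = [z,h] h. If
  \<open>H\<close> is normal in \<open>G\<close>, so is \<open>M\<close>, because g z g^-1 =
  [z,g]^-1 z. Here \<open>H\<close> may be any subgroup containing the commutators with
  \<open>z\<close> and the \<open>p\<close>-th power of \<open>z\<close>; \<open>ascend\<close> uses
  both the normal and the general case.\<close>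

lemma cyclic_extension:
  assumes H: "subgroup H G" and z: "z \<in> carrier G" "z [^] p \<in> H" "z \<notin> H" and p: "prime p"
    and com: "\<And>g. g \<in> carrier G \<Longrightarrow> z \<otimes> g \<otimes> inv z \<otimes> inv g \<in> H"
  defines "M \<equiv> {h \<otimes> z [^] (i::nat) |h i. h \<in> H}"
  shows "subgroup M G" "H \<subseteq> M" "z \<in> M" "H \<lhd> G\<lparr>carrier := M\<rparr>" "rel_index G M H = p"
    "H \<lhd> G \<Longrightarrow> M \<lhd> G"
proof -
  have HG: "h \<in> carrier G" if "h \<in> H" for h by (rule subgroup.mem_carrier[OF H that])
  note Hm = subgroup.m_closed[OF H] and Hi = subgroup.m_inv_closed[OF H] and H1 = subgroup.one_closed[OF H]
  have conj1: "z \<otimes> h \<otimes> inv z \<in> H" if "h \<in> H" for h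
  proof -
    have "z \<otimes> h \<otimes> inv z = (z \<otimes> h \<otimes> inv z \<otimes> inv h) \<otimes> h" using z HG that by (simp add: m_assoc)
    then show ?thesis using Hm com HG that by metis
  qed
  have conj: "z [^] i \<otimes> h \<otimes> inv (z [^] i) \<in> H" if "h \<in> H" for h and i :: nat
  proof (induction i)
    case 0
    then show ?case using that HG by simp
  next
    case (Suc i)
    have "z [^] Suc i = z \<otimes> z [^] i" using z by (metis nat_pow_Suc2)
    then have "z [^] Suc i \<otimes> h \<otimes> inv (z [^] Suc i) = z \<otimes> (z [^] i \<otimes> h \<otimes> inv (z [^] i)) \<otimes> inv z"
      using z HG[OF that] by (simp add: inv_mult_group m_assoc)
    then show ?case using conj1 Suc by metis
  qed
  have swap: "\<exists>h'\<in>H. z [^] i \<otimes> h = h' \<otimes> z [^] i" if "h \<in> H" for h and i :: nat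
    using conj[OF that, of i] z HG[OF that]
    by (intro bexI[of _ "z [^] i \<otimes> h \<otimes> inv (z [^] i)"]) (simp_all add: m_assoc)
  have MI: "h \<otimes> z [^] (i::nat) \<in> M" if "h \<in> H" for h i using that by (auto simp: M_def)
  have Mm: "x \<otimes> y \<in> M" if "x \<in> M" "y \<in> M" for x y
  proof -
    from that obtain h i h' j where x: "x = h \<otimes> z [^] (i::nat)" "h \<in> H" and y: "y = h' \<otimes> z [^] (j::nat)" "h' \<in> H"
      by (auto simp: M_def)
    from swap[OF y(2)] obtain k where k: "k \<in> H" "z [^] i \<otimes> h' = k \<otimes> z [^] i" by blast
    have "x \<otimes> y = h \<otimes> (z [^] i \<otimes> h') \<otimes> z [^] j" using x y z HG by (simp add: m_assoc)
    also have "\<dots> = (h \<otimes> k) \<otimes> z [^] (i + j)"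
      unfolding k using x k z HG by (simp add: m_assoc nat_pow_mult)
    finally show ?thesis using MI Hm x k by simp
  qed
  show HM: "H \<subseteq> M" using MI[of _ 0] HG by fastforce
  show zM: "z \<in> M" using MI[OF H1, of 1] z by simp
  have MG: "M \<subseteq> carrier G" using z HG by (auto simp: M_def)
  have pwM: "z [^] (i::nat) \<in> M" for i using MI[OF H1, of i] z by simp
  have p0: "0 < p" using p prime_gt_0_nat by blast
  show sM: "subgroup M G"
  proof (rule subgroupI)
    fix x assume "x \<in> M"
    then obtain h i where x: "x = h \<otimes> z [^] (i::nat)" "h \<in> H" by (auto simp: M_def)
    \<comment> \<open>Exponents in \<open>M\<close> are natural numbers, so the inverse of
      \<open>z [^] i\<close> is rewritten as the inverse of \<open>z [^] (p * i)\<close>, which lies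
      in \<open>H\<close>, times the power with exponent \<open>(p - 1) * i\<close>.\<close>
    have "z [^] (p * i) \<in> H" using z H by (simp add: nat_pow_pow[symmetric] subgroup_nat_pow_closed)
    then have e: "inv (z [^] (p * i)) \<in> M" using Hi HM by blast
    have "p * i = (p - 1) * i + i" using p0 by (metis Suc_diff_1 add.commute mult_Suc)
    then have "z [^] (p * i) = z [^] ((p - 1) * i) \<otimes> z [^] i" using z by (metis nat_pow_mult)
    then have "inv (z [^] i) = inv (z [^] (p * i)) \<otimes> z [^] ((p - 1) * i)"
      using z by (simp add: inv_mult_group m_assoc)
    then have "inv (z [^] i) \<in> M" using Mm e pwM by simp
    then show "inv x \<in> M" using x z HG Mm Hi HM by (simp add: inv_mult_group subset_iff)
  qed (use MG HM H1 Mm in auto)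
  show "H \<lhd> G\<lparr>carrier := M\<rparr>"
  proof -
    interpret M: group "G\<lparr>carrier := M\<rparr>" using sM by (rule subgroup_imp_group)
    have "subgroup H (G\<lparr>carrier := M\<rparr>)" using H sM HM by (simp add: subgroup_incl)
    moreover have "x \<otimes> h \<otimes> inv x \<in> H" if xh: "x \<in> M" "h \<in> H" for x h
    proof -
      from xh obtain a i where x: "x = a \<otimes> z [^] (i::nat)" "a \<in> H" by (auto simp: M_def)
      have "x \<otimes> h \<otimes> inv x = a \<otimes> (z [^] i \<otimes> h \<otimes> inv (z [^] i)) \<otimes> inv a"
        using x z HG xh by (simp add: m_assoc inv_mult_group)
      then show ?thesis using conj[OF xh(2)] Hm Hi x by simp
    qed
    ultimately show ?thesis unfolding M.normal_inv_iff
      using m_inv_consistent[OF sM] by auto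
  qed
  show "rel_index G M H = p"
  proof -
    have "(\<lambda>h. H #> h) ` M = (\<lambda>i::nat. H #> z [^] i) ` {..<p}"
    proof
      show "(\<lambda>h. H #> h) ` M \<subseteq> (\<lambda>i::nat. H #> z [^] i) ` {..<p}"
      proof clarify
        fix x assume "x \<in> M"
        then obtain h i where x: "x = h \<otimes> z [^] (i::nat)" "h \<in> H" by (auto simp: M_def)
        have "H #> x = H #> z [^] i"
          using x z rcos_mult_left[OF H] by simp
        also have "\<dots> = H #> z [^] (i mod p)" using pow_coset_mod[OF H z(1,2)] .
        finally show "H #> x \<in> (\<lambda>i::nat. H #> z [^] i) ` {..<p}" using p0 by simp
      qed
      show "(\<lambda>i::nat. H #> z [^] i) ` {..<p} \<subseteq> (\<lambda>h. H #> h) ` M" using pwM by auto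
    qed
    then show ?thesis using card_image[OF inj_on_pow_coset[OF H z p]] by (simp add: rel_index_def)
  qed
  show "M \<lhd> G" if N: "H \<lhd> G"
    unfolding normal_inv_iff
  proof (intro conjI ballI sM)
    fix g x assume g: "g \<in> carrier G" and "x \<in> M"
    then obtain h i where x: "x = h \<otimes> z [^] (i::nat)" "h \<in> H" by (auto simp: M_def)
    have gz: "g \<otimes> z \<otimes> inv g \<in> M"
    proof -
      let ?c = "z \<otimes> g \<otimes> inv z \<otimes> inv g"
      have "g \<otimes> z \<otimes> inv g = inv ?c \<otimes> z" using g z by (simp add: inv_mult_group m_assoc)
      moreover have "inv ?c \<in> M" using com[OF g] Hi HM by blast
      ultimately show ?thesis using Mm zM by simp
    qed
    have gzi: "g \<otimes> z [^] i \<otimes> inv g \<in> M"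
    proof (induction i)
      case 0
      then show ?case using g H1 HM by auto
    next
      case (Suc i)
      have "g \<otimes> z [^] Suc i \<otimes> inv g = (g \<otimes> z [^] i \<otimes> inv g) \<otimes> (g \<otimes> z \<otimes> inv g)"
        using g z by (simp add: m_assoc inv_solve_left)
      then show ?case using Mm gz Suc by simp
    qed
    have "g \<otimes> x \<otimes> inv g = (g \<otimes> h \<otimes> inv g) \<otimes> (g \<otimes> z [^] i \<otimes> inv g)"
      using g z x HG by (simp add: m_assoc inv_solve_left)
    moreover have "g \<otimes> h \<otimes> inv g \<in> M" using N g x HM unfolding normal_inv_iff by blast
    ultimately show "g \<otimes> x \<otimes> inv g \<in> M" using Mm gzi by simp
  qed
qed

text \<open>The quotient has order \<open>p\<close>, so any \<open>t\<close> outside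
  \<open>N\<close> generates it: the cosets of the first \<open>p\<close> powers of \<open>t\<close>
  are distinct and hence exhaust all cosets. The homomorphism reads off the exponent of
  \<open>t\<close>. The element with value 1 is exported because it later serves as a generator of
  \<open>G\<close> over \<open>N\<close>.\<close>

lemma index_prime_hom:
  assumes N: "N \<lhd> G" and ind: "rel_index G (carrier G) N = p" and p: "prime p"
  shows "\<exists>\<tau>\<in>mod_homs p G. \<exists>t\<in>carrier G. \<tau> t = 1 \<and> N = hom_kernel G \<tau>"
proof -
  interpret N: normal N G by (rule N)
  interpret Q: group "G Mod N" by (rule N.factorgroup_is_group)
  have p1: "1 < p" using p prime_gt_1_nat by blast
  have "carrier G \<noteq> N" using rel_index_self[OF N.is_subgroup] ind p1 by auto
  then obtain t where t: "t \<in> carrier G" "t \<notin> N" using N.subset by blast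
  have "order (G Mod N) = p"
    using ind by (simp add: order_def carrier_FactGroup rel_index_def)
  then have "(N #> t) [^]\<^bsub>G Mod N\<^esub> p = N"
    using Q.pow_order_eq_1[of "N #> t"] t by (simp add: carrier_FactGroup)
  then have tp: "t [^] p \<in> N"
    using t by (metis N.FactGroup_pow coset_join1 nat_pow_closed N.subset N.is_subgroup)
  have inj: "inj_on (\<lambda>i::nat. N #> t [^] i) {..<p}"
    by (rule inj_on_pow_coset[OF N.is_subgroup t(1) tp t(2) p])
  have im: "(\<lambda>i::nat. N #> t [^] i) ` {..<p} = (\<lambda>h. N #> h) ` carrier G"
  proof (rule card_subset_eq)
    show "finite ((\<lambda>h. N #> h) ` carrier G)"
      using ind p1 by (metis card.infinite not_one_less_zero rel_index_def)
    show "(\<lambda>i::nat. N #> t [^] i) ` {..<p} \<subseteq> (\<lambda>h. N #> h) ` carrier G" using t by auto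
    show "card ((\<lambda>i::nat. N #> t [^] i) ` {..<p}) = card ((\<lambda>h. N #> h) ` carrier G)"
      using card_image[OF inj] ind by (simp add: rel_index_def)
  qed
  define f where "f x = (SOME i. i < p \<and> N #> x = N #> t [^] i)" for x
  have f: "f x < p \<and> N #> x = N #> t [^] f x" if "x \<in> carrier G" for x
    unfolding f_def by (rule someI_ex) (use im that in blast)
  have f_unique: "f x = i mod p" if "x \<in> carrier G" "N #> x = N #> t [^] i" for x i
  proof -
    have "N #> t [^] f x = N #> t [^] (i mod p)"
      using f that pow_coset_mod[OF N.is_subgroup t(1) tp, of i] by simp
    then show ?thesis using inj f[OF that(1)] p1 by (auto simp: inj_on_def)
  qed
  define \<tau> where "\<tau> = (\<lambda>x\<in>carrier G. int (f x))"
  have "\<tau> \<in> mod_homs p G"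
  proof (rule mod_homsI)
    fix x y assume xy: "x \<in> carrier G" "y \<in> carrier G"
    have "N #> (x \<otimes> y) = (N #> x) <#> (N #> y)" using xy by (simp add: N.rcos_sum)
    also have "\<dots> = (N #> t [^] f x) <#> (N #> t [^] f y)" using f xy by metis
    also have "\<dots> = N #> t [^] (f x + f y)" using t by (simp add: N.rcos_sum nat_pow_mult)
    finally have "f (x \<otimes> y) = (f x + f y) mod p" using f_unique xy by blast
    then show "\<tau> (x \<otimes> y) = (\<tau> x + \<tau> y) mod int p"
      using xy by (simp add: \<tau>_def zmod_int)
  qed (use f in \<open>auto simp: \<tau>_def\<close>)
  moreover have "\<tau> t = 1" using f_unique[OF t(1), of 1] t p1 by (simp add: \<tau>_def)
  moreover have "N = hom_kernel G \<tau>"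
  proof -
    have "x \<in> N \<longleftrightarrow> f x = 0" if x: "x \<in> carrier G" for x
    proof
      assume "x \<in> N"
      then have "N #> x = N #> t [^] (0::nat)" using N.rcos_const[OF is_group] N.subset by simp
      then show "f x = 0" using f_unique[OF x, of 0] by simp
    next
      assume "f x = 0"
      then have "N #> x = N" using f[OF x] N.subset by simp
      then show "x \<in> N" using x by (metis coset_join1 N.subset N.is_subgroup)
    qed
    then show ?thesis using N.subset by (auto simp: hom_kernel_def \<tau>_def)
  qed
  ultimately show ?thesis using t by blast
qed

text \<open>Normalisers grow in finite \<open>p\<close>-groups. Take \<open>z\<close> central of
  order \<open>p\<close> modulo \<open>N\<close>. If \<open>z\<close> lies in \<open>H\<close>, it
  can be absorbed into \<open>N\<close>, which lowers the index \<open>p ^ k\<close> and keeps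
  \<open>N\<close> inside \<open>H\<close>. Otherwise adjoining \<open>z\<close> to \<open>H\<close>
  gives \<open>M\<close>.\<close>

lemma ascend:
  assumes p: "prime p" and "N \<lhd> G" "rel_index G (carrier G) N = p ^ k"
    and H: "subgroup H G" and "N \<subseteq> H" and HG: "H \<noteq> carrier G"
  shows "\<exists>M. subgroup M G \<and> H \<subseteq> M \<and> H \<lhd> G\<lparr>carrier := M\<rparr> \<and> rel_index G M H = p"
  using assms(2,3,5)
proof (induction k arbitrary: N)
  case 0
  then have "N = carrier G"
    using rel_index_eq_1[OF normal_imp_subgroup[OF 0(1)] subgroup_self]
      subgroup.subset[OF normal_imp_subgroup[OF 0(1)]] by simp
  then show ?case using 0 HG subgroup.subset[OF H] by blast
next
  case (Suc k)
  obtain z where z: "z \<in> carrier G" "z \<notin> N" "z [^] p \<in> N"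
    and com: "\<And>g. g \<in> carrier G \<Longrightarrow> z \<otimes> g \<otimes> inv z \<otimes> inv g \<in> N"
    using central_step[OF p Suc.prems(1,2)] by blast
  note N = normal_imp_subgroup[OF Suc.prems(1)]
  show ?case
  proof (cases "z \<in> H")
    case True
    define N' where "N' = {h \<otimes> z [^] (i::nat) |h i. h \<in> N}"
    note ext = cyclic_extension[OF N z(1,3,2) p com, folded N'_def]
    have "rel_index G (carrier G) N = rel_index G (carrier G) N' * rel_index G N' N"
      by (rule rel_index_mult[OF N ext(1) subgroup_self ext(2) subgroup.subset[OF ext(1)]])
    then have "rel_index G (carrier G) N' = p ^ k" using Suc.prems(2) ext(5) p by simp
    moreover have "N' \<subseteq> H"
      unfolding N'_def using True Suc.prems(3) H
      by (auto intro!: subgroup.m_closed[OF H] subgroup_nat_pow_closed)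
    ultimately show ?thesis using Suc.IH ext(6) Suc.prems(1) by blast
  next
    case False
    have "z [^] p \<in> H" "\<And>g. g \<in> carrier G \<Longrightarrow> z \<otimes> g \<otimes> inv z \<otimes> inv g \<in> H"
      using z(3) com Suc.prems(3) by auto
    note ext = cyclic_extension[OF H z(1) this(1) False p this(2)]
    show ?thesis
      by (rule exI[where x = "{h \<otimes> z [^] (i::nat) |h i. h \<in> H}"]) (intro conjI ext)
  qed
qed

text \<open>Descends from \<open>G\<close> to \<open>H\<close> through subgroups each normal of
  index \<open>p\<close> in the one above, all containing \<open>N\<close>. The measure is the index
  in \<open>G\<close>, which drops by the factor \<open>p\<close> on passing to the overgroup given
  by \<open>ascend\<close>.\<close>

lemma p_chain_induct [consumes 5, case_names top step]:
  assumes p: "prime p" and N: "N \<lhd> G" "rel_index G (carrier G) N = p ^ k"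
    and "subgroup H G" "N \<subseteq> H"
    and top: "Q (carrier G)"
    and step: "\<And>M H. subgroup M G \<Longrightarrow> subgroup H G \<Longrightarrow> N \<subseteq> H \<Longrightarrow> H \<subseteq> M \<Longrightarrow> H \<lhd> G\<lparr>carrier := M\<rparr> \<Longrightarrow>
       rel_index G M H = p \<Longrightarrow> Q M \<Longrightarrow> Q H"
  shows "Q H"
  using assms(4,5)
proof (induction "rel_index G (carrier G) H" arbitrary: H rule: less_induct)
  case less
  show ?case
  proof (cases "H = carrier G")
    case True
    then show ?thesis using top by simp
  next
    case False
    obtain M where M: "subgroup M G" "H \<subseteq> M" "H \<lhd> G\<lparr>carrier := M\<rparr>" "rel_index G M H = p"
      using ascend[OF p N less.prems False] by blast
    have MG: "M \<subseteq> carrier G" by (rule subgroup.subset[OF M(1)])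
    have e: "rel_index G (carrier G) H = rel_index G (carrier G) M * p"
      using rel_index_mult[OF less.prems(1) M(1) subgroup_self M(2) MG] M by simp
    \<comment> \<open>Excludes the value 0, which would stand for infinite index and spoil the
      strict descent of the measure.\<close>
    have "p ^ k = rel_index G (carrier G) H * rel_index G H N"
      using rel_index_mult[OF normal_imp_subgroup[OF N(1)] less.prems(1) subgroup_self less.prems(2)]
        subgroup.subset[OF less.prems(1)] N by simp
    moreover have "p ^ k > 0" using p prime_gt_0_nat by simp
    ultimately have "rel_index G (carrier G) H > 0" by (cases "rel_index G (carrier G) H") auto
    then have "rel_index G (carrier G) M < rel_index G (carrier G) H"
      unfolding e using prime_gt_1_nat[OF p] by simp
    then have "Q M" using less.hyps M less.prems by blast
    then show ?thesis using step M less.prems by blast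
  qed
qed

end

section \<open>Subgroups that are open in the pro-\<open>p\<close> topology\<close>

definition popen :: "nat \<Rightarrow> ('a, 'b) monoid_scheme \<Rightarrow> 'a set set" where
  "popen p G = {H. subgroup H G \<and> (\<exists>N\<in>p_power_normal_subgroups p G. N \<subseteq> H)}"

text \<open>Mathematically this is G^p[G,G]. Described as a common kernel, it is killed by every
  homomorphism to Z/p by definition; the description by commutators and \<open>p\<close>-th powers
  is \<open>power_derived\<close>.\<close>

definition phi_subgroup :: "nat \<Rightarrow> ('a, 'b) monoid_scheme \<Rightarrow> 'a set" where
  "phi_subgroup p G = {x \<in> carrier G. \<forall>\<phi>\<in>mod_homs p G. \<phi> x = 0}"

text \<open>A homomorphism is determined by its values on a finite generating set, and each value is
  one of \<open>p\<close> residues.\<close>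

lemma finite_mod_homs:
  assumes "finitely_generated_group G" "0 < p"
  shows "finite (mod_homs p G)"
proof -
  obtain S where S: "group G" "finite S" "S \<subseteq> carrier G" "generate G S = carrier G"
    using assms(1) unfolding finitely_generated_group_def by blast
  interpret group G by (rule S(1))
  have "inj_on (\<lambda>\<phi>. restrict \<phi> S) (mod_homs p G)"
  proof (rule inj_onI)
    fix \<phi> \<psi> assume h: "\<phi> \<in> mod_homs p G" "\<psi> \<in> mod_homs p G" and e: "restrict \<phi> S = restrict \<psi> S"
    have es: "\<phi> s = \<psi> s" if "s \<in> S" for s using e that by (metis restrict_apply')
    have "\<phi> x = \<psi> x" if "x \<in> generate G S" for x
      using that
    proof (induction rule: generate.induct)
      case one
      then show ?case using mod_homs_one[OF h(1) assms(2)] mod_homs_one[OF h(2) assms(2)] by simp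
    next
      case (incl s)
      then show ?case using es by simp
    next
      case (inv s)
      then show ?case using es S(3) mod_homs_inv[OF h(1) assms(2)] mod_homs_inv[OF h(2) assms(2)] by (simp add: subset_iff)
    next
      case (eng x y)
      then have "x \<in> carrier G" "y \<in> carrier G" using S(4) by auto
      then show ?case using mod_homs_mult[OF h(1)] mod_homs_mult[OF h(2)] eng by simp
    qed
    then show "\<phi> = \<psi>" using mod_homs_eqI[OF h] S(4) by simp
  qed
  moreover have "(\<lambda>\<phi>. restrict \<phi> S) ` mod_homs p G \<subseteq> S \<rightarrow>\<^sub>E {0..<int p}"
  proof (intro image_subsetI PiE_I)
    fix \<phi> s assume "\<phi> \<in> mod_homs p G" "s \<in> S"
    then show "restrict \<phi> S s \<in> {0..<int p}" using mod_homs_range[of \<phi> p G s] S(3) by auto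
  qed auto
  moreover have "finite (S \<rightarrow>\<^sub>E {0..<int p})" using S(2) by (simp add: finite_PiE)
  ultimately show ?thesis by (meson finite_imageD finite_subset)
qed

section \<open>Finite generation, and normal subgroups of \<open>p\<close>-power index cut out by
  homomorphisms\<close>

context group
begin

lemma normal_subset: "N \<lhd> G \<Longrightarrow> N \<subseteq> carrier G"
  by (rule subgroup.subset[OF normal_imp_subgroup])

lemma subgroup_restrict_trans:
  assumes "subgroup H G" "K \<lhd> G\<lparr>carrier := H\<rparr>"
  shows "subgroup K G" "K \<subseteq> H"
proof -
  show "subgroup K G" using incl_subgroup[OF assms(1) normal_imp_subgroup[OF assms(2)]] .
  show "K \<subseteq> H" using subgroup.subset[OF normal_imp_subgroup[OF assms(2)]] by simp
qed

text \<open>Schreier's lemma: with \<open>R\<close> a transversal, pushing a word in the generators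
  letter by letter through \<open>R\<close> leaves behind elements r s r'^-1 of
  \<open>H\<close>.\<close>

lemma finitely_generated_subgroup:
  assumes fg: "finitely_generated_group G" and H: "subgroup H G"
    and ind: "rel_index G (carrier G) H > 0"
  shows "finitely_generated_group (G\<lparr>carrier := H\<rparr>)"
proof -
  obtain S where S: "finite S" "S \<subseteq> carrier G" "generate G S = carrier G"
    using fg unfolding finitely_generated_group_def by blast
  define rp where "rp C = (SOME y. y \<in> carrier G \<and> C = H #> y)" for C
  define C where "C = (\<lambda>x. H #> x) ` carrier G"
  have rp: "rp (H #> x) \<in> carrier G \<and> H #> x = H #> rp (H #> x)" if "x \<in> carrier G" for x
    unfolding rp_def by (rule someI_ex) (use that in auto)
  define R where "R = rp ` C"
  have finR: "finite R" using ind unfolding R_def C_def rel_index_def by (simp add: card_gt_0_iff)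
  have RG: "R \<subseteq> carrier G" using rp by (auto simp: R_def C_def)
  \<comment> \<open>Inverses are included so that an inverted generator is handled by the same
    single step.\<close>
  define S' where "S' = S \<union> m_inv G ` S"
  have S'G: "S' \<subseteq> carrier G" and finS': "finite S'" using S by (auto simp: S'_def)
  \<comment> \<open>The chosen representative of the coset \<open>H\<close> itself need not be the
    identity. The part of \<open>R\<close> inside \<open>H\<close> therefore joins the generators,
    to strip it off at both ends of a word.\<close>
  define T where "T = (R \<union> (\<lambda>(r, s, r'). r \<otimes> s \<otimes> inv r') ` (R \<times> S' \<times> R)) \<inter> H"
  have TH: "T \<subseteq> H" and finT: "finite T" using finR finS' by (auto simp: T_def)
  have TG: "T \<subseteq> carrier G" using TH subgroup.subset[OF H] by blast
  have gT: "generate G T \<subseteq> carrier G" by (rule generate_incl[OF TG])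
  have base: "\<exists>t\<in>generate G T. \<exists>r'\<in>R. r \<otimes> s = t \<otimes> r'" if "r \<in> R" "s \<in> S'" for r s
  proof -
    define r' where "r' = rp (H #> (r \<otimes> s))"
    have cl: "r \<in> carrier G" "s \<in> carrier G" using that RG S'G by auto
    have r': "r' \<in> carrier G" "H #> (r \<otimes> s) = H #> r'" using rp cl by (auto simp: r'_def)
    have "r \<otimes> s \<otimes> inv r' \<in> H" using rcos_eq_iff[OF H] r' cl by simp
    moreover have r'R: "r' \<in> R" using cl by (auto simp: R_def C_def r'_def)
    ultimately have "r \<otimes> s \<otimes> inv r' \<in> T" using that unfolding T_def by force
    then have "r \<otimes> s \<otimes> inv r' \<in> generate G T" by (rule generate.incl)
    moreover have "r \<otimes> s = r \<otimes> s \<otimes> inv r' \<otimes> r'" using cl r' by (simp add: m_assoc)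
    ultimately show ?thesis using r'R by blast
  qed
  have main: "\<forall>r\<in>R. \<exists>t\<in>generate G T. \<exists>r'\<in>R. r \<otimes> g = t \<otimes> r'" if "g \<in> generate G S" for g
    using that
  proof (induction rule: generate.induct)
    case one
    show ?case
    proof
      fix r assume r: "r \<in> R"
      then have "r \<otimes> \<one> = \<one> \<otimes> r" using RG by auto
      then show "\<exists>t\<in>generate G T. \<exists>r'\<in>R. r \<otimes> \<one> = t \<otimes> r'" using r generate.one by blast
    qed
  next
    case (incl s)
    then show ?case using base by (auto simp: S'_def)
  next
    case (inv s)
    then show ?case using base by (auto simp: S'_def)
  next
    case (eng x y)
    have xy: "x \<in> carrier G" "y \<in> carrier G" using eng S(3) by auto
    show ?case
    proof
      fix r assume r: "r \<in> R"
      obtain t r' where 1: "t \<in> generate G T" "r' \<in> R" "r \<otimes> x = t \<otimes> r'" using eng.IH(1) r by blast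
      obtain t' r'' where 2: "t' \<in> generate G T" "r'' \<in> R" "r' \<otimes> y = t' \<otimes> r''" using eng.IH(2) 1(2) by blast
      have cl: "r \<in> carrier G" "r' \<in> carrier G" "r'' \<in> carrier G" "t \<in> carrier G" "t' \<in> carrier G"
        using r 1 2 RG gT by auto
      have "r \<otimes> (x \<otimes> y) = (r \<otimes> x) \<otimes> y" using cl xy by (simp add: m_assoc)
      also have "\<dots> = t \<otimes> (r' \<otimes> y)" unfolding 1(3) using cl xy by (simp add: m_assoc)
      also have "\<dots> = (t \<otimes> t') \<otimes> r''" unfolding 2(3) using cl xy by (simp add: m_assoc)
      finally show "\<exists>t\<in>generate G T. \<exists>r'\<in>R. r \<otimes> (x \<otimes> y) = t \<otimes> r'"
        using generate.eng[OF 1(1) 2(1)] 2(2) by blast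
    qed
  qed
  have "generate G T = H"
  proof
    show GTH: "generate G T \<subseteq> H" by (rule generate_subgroup_incl[OF TH H])
    show "H \<subseteq> generate G T"
    proof
      fix h assume h: "h \<in> H"
      have hG: "h \<in> carrier G" by (rule subgroup.mem_carrier[OF H h])
      define r0 where "r0 = rp (H #> \<one>)"
      have r0: "r0 \<in> carrier G" "H #> \<one> = H #> r0" using rp[of \<one>] by (auto simp: r0_def)
      have "r0 \<otimes> inv \<one> \<in> H" using rcos_eq_iff[OF H r0(1) one_closed] r0(2) by simp
      then have r0H: "r0 \<in> H" using r0 by simp
      have r0R: "r0 \<in> R" by (auto simp: R_def C_def r0_def)
      then obtain t r' where t: "t \<in> generate G T" "r' \<in> R" "r0 \<otimes> h = t \<otimes> r'"
        using main[of h] S(3) hG by blast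
      have cl: "t \<in> carrier G" "r' \<in> carrier G" using t gT RG by auto
      have "r' = inv t \<otimes> (r0 \<otimes> h)" unfolding t(3) using cl by (simp add: m_assoc[symmetric])
      also have "\<dots> \<in> H" using t(1) GTH r0H h
        by (intro subgroup.m_closed[OF H] subgroup.m_inv_closed[OF H]) auto
      finally have "r' \<in> T" using t(2) by (simp add: T_def)
      then have 1: "r' \<in> generate G T" by (rule generate.incl)
      have 2: "r0 \<in> generate G T" using r0R r0H by (intro generate.incl) (simp add: T_def)
      have "h = inv r0 \<otimes> (t \<otimes> r')" unfolding t(3)[symmetric] using r0 hG by (simp add: m_assoc[symmetric])
      also have "\<dots> \<in> generate G T"
        using generate.eng[OF generate_m_inv_closed[OF TG 2] generate.eng[OF t(1) 1]] .
      finally show "h \<in> generate G T" .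
    qed
  qed
  moreover have "generate (G\<lparr>carrier := H\<rparr>) T = generate G T"
    by (rule generate_consistent[OF TH H])
  ultimately show ?thesis
    unfolding finitely_generated_group_def using subgroup_imp_group[OF H] finT TH by auto
qed

text \<open>The kernels are intersected one at a time. The next homomorphism, restricted to the
  intersection so far, has kernel of index 1 or \<open>p\<close> there, so the index stays a power
  of \<open>p\<close>.\<close>

lemma phi_subgroup_normal_index:
  assumes fin: "finite (mod_homs p G)" and p: "prime p"
  shows "phi_subgroup p G \<lhd> G" "\<exists>k. rel_index G (carrier G) (phi_subgroup p G) = p ^ k"
proof -
  have p0: "0 < p" using p prime_gt_0_nat by blast
  define K where "K A = {x \<in> carrier G. \<forall>\<phi>\<in>A. \<phi> x = 0}" for A :: "('a \<Rightarrow> int) set"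
  have "K A \<lhd> G \<and> (\<exists>k. rel_index G (carrier G) (K A) = p ^ k)" if "finite A" "A \<subseteq> mod_homs p G" for A
    using that
  proof (induction rule: finite_induct)
    case empty
    have "K {} = carrier G" by (simp add: K_def)
    then show ?case using rel_index_self[OF subgroup_self] normal_self by (metis power_0)
  next
    case (insert \<phi> A)
    then obtain k where k: "K A \<lhd> G" "rel_index G (carrier G) (K A) = p ^ k" by blast
    have \<phi>: "\<phi> \<in> mod_homs p G" using insert by simp
    have eq: "K (insert \<phi> A) = hom_kernel G \<phi> \<inter> K A" by (auto simp: K_def hom_kernel_def)
    have N: "K (insert \<phi> A) \<lhd> G"
      unfolding eq by (rule normal_subgroup_intersect[OF hom_kernel_normal[OF \<phi> p0] k(1)])
    note sub = normal_imp_subgroup[OF k(1)]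
    let ?\<psi> = "restrict \<phi> (K A)"
    interpret A: group "G\<lparr>carrier := K A\<rparr>" by (rule subgroup_imp_group[OF sub])
    have "?\<psi> \<in> mod_homs p (G\<lparr>carrier := K A\<rparr>)"
      by (rule mod_homs_restrict[where H = "carrier G"])
        (use \<phi> normal_subset[OF k(1)] subgroup.m_closed[OF sub] in auto)
    from A.hom_kernel_index[OF this p] have "hom_kernel (G\<lparr>carrier := K A\<rparr>) ?\<psi> = K A \<or>
      rel_index G (K A) (hom_kernel (G\<lparr>carrier := K A\<rparr>) ?\<psi>) = p"
      by (simp add: rel_index_carrier)
    moreover have "hom_kernel (G\<lparr>carrier := K A\<rparr>) ?\<psi> = K (insert \<phi> A)"
      by (auto simp: K_def hom_kernel_def)
    ultimately have "rel_index G (K A) (K (insert \<phi> A)) = 1 \<or> rel_index G (K A) (K (insert \<phi> A)) = p"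
      using rel_index_self[OF sub] by auto
    moreover have "rel_index G (carrier G) (K (insert \<phi> A)) =
        rel_index G (carrier G) (K A) * rel_index G (K A) (K (insert \<phi> A))"
      by (rule rel_index_mult[OF normal_imp_subgroup[OF N] sub subgroup_self _ normal_subset[OF k(1)]])
        (use eq in auto)
    ultimately have "rel_index G (carrier G) (K (insert \<phi> A)) = p ^ k \<or>
        rel_index G (carrier G) (K (insert \<phi> A)) = p ^ Suc k"
      using k(2) by auto
    then show ?case using N by blast
  qed
  from this[OF fin subset_refl] show "phi_subgroup p G \<lhd> G" "\<exists>k. rel_index G (carrier G) (phi_subgroup p G) = p ^ k"
    unfolding K_def phi_subgroup_def by auto
qed

lemma mod_homs_conjugate:
  assumes N: "N \<lhd> G" and \<phi>: "\<phi> \<in> mod_homs p (G\<lparr>carrier := N\<rparr>)" and g: "g \<in> carrier G"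
  shows "(\<lambda>x\<in>N. \<phi> (g \<otimes> x \<otimes> inv g)) \<in> mod_homs p (G\<lparr>carrier := N\<rparr>)"
proof (rule mod_homsI)
  have conj: "g \<otimes> x \<otimes> inv g \<in> N" if "x \<in> N" for x
    using N that g unfolding normal_inv_iff by blast
  fix x y assume xy: "x \<in> carrier (G\<lparr>carrier := N\<rparr>)" "y \<in> carrier (G\<lparr>carrier := N\<rparr>)"
  have cl: "x \<in> carrier G" "y \<in> carrier G" using xy normal_subset[OF N] by auto
  show "(\<lambda>x\<in>N. \<phi> (g \<otimes> x \<otimes> inv g)) x \<in> {0..<int p}"
    using mod_homs_range[OF \<phi>, of "g \<otimes> x \<otimes> inv g"] conj xy by simp
  have e: "g \<otimes> (x \<otimes> y) \<otimes> inv g = (g \<otimes> x \<otimes> inv g) \<otimes> (g \<otimes> y \<otimes> inv g)"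
    using g cl by (simp add: m_assoc inv_solve_left)
  show "(\<lambda>x\<in>N. \<phi> (g \<otimes> x \<otimes> inv g)) (x \<otimes>\<^bsub>G\<lparr>carrier := N\<rparr>\<^esub> y) =
    ((\<lambda>x\<in>N. \<phi> (g \<otimes> x \<otimes> inv g)) x + (\<lambda>x\<in>N. \<phi> (g \<otimes> x \<otimes> inv g)) y) mod int p"
    using xy subgroup.m_closed[OF normal_imp_subgroup[OF N]] conj e
      mod_homs_mult[OF \<phi>, of "g \<otimes> x \<otimes> inv g" "g \<otimes> y \<otimes> inv g"] by simp
qed auto

text \<open>Conjugation by an element of \<open>G\<close> carries homomorphisms on \<open>N\<close>
  to homomorphisms on \<open>N\<close>, so their common kernel is stable under all of
  \<open>G\<close>, beyond being normal in \<open>N\<close>.\<close>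

lemma phi_subgroup_of_normal:
  assumes N: "N \<lhd> G" and fin: "finite (mod_homs p (G\<lparr>carrier := N\<rparr>))" and p: "prime p"
  shows "phi_subgroup p (G\<lparr>carrier := N\<rparr>) \<lhd> G"
proof -
  note sN = normal_imp_subgroup[OF N]
  interpret N: group "G\<lparr>carrier := N\<rparr>" by (rule subgroup_imp_group[OF sN])
  let ?F = "phi_subgroup p (G\<lparr>carrier := N\<rparr>)"
  have F: "subgroup ?F G" using incl_subgroup[OF sN normal_imp_subgroup[OF N.phi_subgroup_normal_index(1)[OF fin p]]] .
  have "g \<otimes> x \<otimes> inv g \<in> ?F" if g: "g \<in> carrier G" and x: "x \<in> ?F" for g x
  proof -
    have xN: "x \<in> N" using x by (simp add: phi_subgroup_def)
    have "\<phi> (g \<otimes> x \<otimes> inv g) = 0" if \<phi>: "\<phi> \<in> mod_homs p (G\<lparr>carrier := N\<rparr>)" for \<phi>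
    proof -
      have "\<forall>\<psi>\<in>mod_homs p (G\<lparr>carrier := N\<rparr>). \<psi> x = 0" using x by (simp add: phi_subgroup_def)
      then have "(\<lambda>x\<in>N. \<phi> (g \<otimes> x \<otimes> inv g)) x = 0"
        using mod_homs_conjugate[OF N \<phi> g] by (rule bspec)
      then show ?thesis using xN by simp
    qed
    moreover have "g \<otimes> x \<otimes> inv g \<in> N" using N g xN unfolding normal_inv_iff by blast
    ultimately show ?thesis by (simp add: phi_subgroup_def)
  qed
  then show ?thesis unfolding normal_inv_iff using F by blast
qed

section \<open>Open subgroups: indices, kernels and subnormal chains\<close>

lemma p_power_normal_subgroups_iff:
  "N \<in> p_power_normal_subgroups p G \<longleftrightarrow> N \<lhd> G \<and> (\<exists>k. rel_index G (carrier G) N = p ^ k)"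
  by (simp add: p_power_normal_subgroups_def subgroup_index_eq)

lemma popen_subgroup: "H \<in> popen p G \<Longrightarrow> subgroup H G"
  by (simp add: popen_def)

lemma popen_carrier: "carrier G \<in> popen p G"
proof -
  have "carrier G \<in> p_power_normal_subgroups p G"
    using rel_index_self[OF subgroup_self] normal_self
    by (auto simp: p_power_normal_subgroups_iff intro: exI[of _ 0])
  then show ?thesis using subgroup_self by (auto simp: popen_def)
qed

lemma p_power_normal_popen: "N \<in> p_power_normal_subgroups p G \<Longrightarrow> N \<in> popen p G"
  unfolding popen_def using p_power_normal_subgroups_iff normal_imp_subgroup by blast

lemma popen_superset: "H \<in> popen p G \<Longrightarrow> subgroup K G \<Longrightarrow> H \<subseteq> K \<Longrightarrow> K \<in> popen p G"
  unfolding popen_def by blast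

lemma popen_index:
  assumes p: "prime p" and H: "H \<in> popen p G"
  shows "\<exists>k. rel_index G (carrier G) H = p ^ k"
proof -
  from H obtain N k where N: "N \<lhd> G" "rel_index G (carrier G) N = p ^ k" "N \<subseteq> H" and sH: "subgroup H G"
    by (auto simp: popen_def p_power_normal_subgroups_iff)
  have "p ^ k = rel_index G (carrier G) H * rel_index G H N"
    using rel_index_mult[OF normal_imp_subgroup[OF N(1)] sH subgroup_self N(3) subgroup.subset[OF sH]] N by simp
  then have "rel_index G (carrier G) H dvd p ^ k" by (rule dvdI)
  then show ?thesis using divides_primepow_nat[OF p] by blast
qed

lemma popen_index_pos:
  assumes p: "prime p" and H: "H \<in> popen p G"
  shows "rel_index G (carrier G) H > 0"
  using popen_index[OF assms] p prime_gt_0_nat by auto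

lemma popen_finitely_generated:
  assumes "finitely_generated_group G" "prime p" "H \<in> popen p G"
  shows "finitely_generated_group (G\<lparr>carrier := H\<rparr>)"
  using finitely_generated_subgroup[OF assms(1) popen_subgroup[OF assms(3)]] popen_index_pos[OF assms(2,3)] .

lemma popen_finite_mod_homs:
  assumes "finitely_generated_group G" "prime p" "H \<in> popen p G"
  shows "finite (mod_homs p (G\<lparr>carrier := H\<rparr>))"
  using finite_mod_homs[OF popen_finitely_generated[OF assms] prime_gt_0_nat[OF assms(2)]] .

lemma phi_subgroup_p_power_normal:
  assumes fg: "finitely_generated_group G" and p: "prime p" and N: "N \<in> p_power_normal_subgroups p G"
  shows "phi_subgroup p (G\<lparr>carrier := N\<rparr>) \<in> p_power_normal_subgroups p G"
    and "phi_subgroup p (G\<lparr>carrier := N\<rparr>) \<subseteq> N"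
proof -
  let ?F = "phi_subgroup p (G\<lparr>carrier := N\<rparr>)"
  have nN: "N \<lhd> G" using N by (simp add: p_power_normal_subgroups_iff)
  note sN = normal_imp_subgroup[OF nN]
  interpret N: group "G\<lparr>carrier := N\<rparr>" by (rule subgroup_imp_group[OF sN])
  have fin: "finite (mod_homs p (G\<lparr>carrier := N\<rparr>))"
    by (rule popen_finite_mod_homs[OF fg p p_power_normal_popen[OF N]])
  have nF: "?F \<lhd> G" by (rule phi_subgroup_of_normal[OF nN fin p])
  show FN: "?F \<subseteq> N" by (auto simp: phi_subgroup_def)
  obtain k l where "rel_index G (carrier G) N = p ^ k" "rel_index G N ?F = p ^ l"
    using N N.phi_subgroup_normal_index(2)[OF fin p] by (auto simp: p_power_normal_subgroups_iff rel_index_carrier)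
  then have "rel_index G (carrier G) ?F = p ^ (k + l)"
    using rel_index_mult[OF normal_imp_subgroup[OF nF] sN subgroup_self FN normal_subset[OF nN]]
    by (simp add: power_add)
  then show "?F \<in> p_power_normal_subgroups p G" using nF by (auto simp: p_power_normal_subgroups_iff)
qed

text \<open>Let \<open>N\<close> be normal of \<open>p\<close>-power index in \<open>G\<close> and
  contained in \<open>H\<close>. The restriction of \<open>\<phi>\<close> to \<open>N\<close>
  vanishes on \<open>phi_subgroup\<close> of \<open>N\<close>, and that subgroup is again normal of
  \<open>p\<close>-power index in \<open>G\<close>, so it witnesses openness of the kernel.\<close>

lemma popen_hom_kernel:
  assumes fg: "finitely_generated_group G" and p: "prime p" and H: "H \<in> popen p G"
    and \<phi>: "\<phi> \<in> mod_homs p (G\<lparr>carrier := H\<rparr>)"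
  shows "hom_kernel (G\<lparr>carrier := H\<rparr>) \<phi> \<in> popen p G"
proof -
  from H obtain N where N: "N \<in> p_power_normal_subgroups p G" "N \<subseteq> H" by (auto simp: popen_def)
  have sN: "subgroup N G" using N by (simp add: p_power_normal_subgroups_iff normal_imp_subgroup)
  note sH = popen_subgroup[OF H]
  interpret H: group "G\<lparr>carrier := H\<rparr>" by (rule subgroup_imp_group[OF sH])
  have r: "restrict \<phi> N \<in> mod_homs p (G\<lparr>carrier := N\<rparr>)"
    by (rule mod_homs_restrict[OF \<phi> N(2)]) (rule subgroup.m_closed[OF sN])
  have "phi_subgroup p (G\<lparr>carrier := N\<rparr>) \<subseteq> hom_kernel (G\<lparr>carrier := H\<rparr>) \<phi>"
  proof
    fix x assume "x \<in> phi_subgroup p (G\<lparr>carrier := N\<rparr>)"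
    then have "x \<in> N" "restrict \<phi> N x = 0" using r by (auto simp: phi_subgroup_def)
    then show "x \<in> hom_kernel (G\<lparr>carrier := H\<rparr>) \<phi>" using N by (auto simp: hom_kernel_def)
  qed
  moreover have "subgroup (hom_kernel (G\<lparr>carrier := H\<rparr>) \<phi>) G"
    using subgroup_restrict_trans(1)[OF sH H.hom_kernel_normal[OF \<phi> prime_gt_0_nat[OF p]]] .
  ultimately show ?thesis
    using phi_subgroup_p_power_normal(1)[OF fg p N(1)] by (auto simp: popen_def)
qed

lemma popen_index_prime:
  assumes fg: "finitely_generated_group G" and p: "prime p" and H: "H \<in> popen p G"
    and K: "K \<lhd> G\<lparr>carrier := H\<rparr>" "rel_index G H K = p"
  shows "K \<in> popen p G"
proof -
  interpret H: group "G\<lparr>carrier := H\<rparr>" by (rule subgroup_imp_group[OF popen_subgroup[OF H]])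
  obtain \<tau> where "\<tau> \<in> mod_homs p (G\<lparr>carrier := H\<rparr>)" "K = hom_kernel (G\<lparr>carrier := H\<rparr>) \<tau>"
    using H.index_prime_hom[OF K(1) _ p] K(2) by (auto simp: rel_index_carrier)
  then show ?thesis using popen_hom_kernel[OF fg p H] by blast
qed

lemma popen_induct [consumes 2, case_names top step]:
  assumes p: "prime p" and H: "H \<in> popen p G"
    and top: "Q (carrier G)"
    and step: "\<And>M H. M \<in> popen p G \<Longrightarrow> H \<in> popen p G \<Longrightarrow> H \<subseteq> M \<Longrightarrow> H \<lhd> G\<lparr>carrier := M\<rparr> \<Longrightarrow>
       rel_index G M H = p \<Longrightarrow> Q M \<Longrightarrow> Q H"
  shows "Q H"
proof -
  from H obtain N k where N: "N \<lhd> G" "rel_index G (carrier G) N = p ^ k" "N \<subseteq> H" and sH: "subgroup H G"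
    by (auto simp: popen_def p_power_normal_subgroups_iff)
  then have NI: "N \<in> p_power_normal_subgroups p G" by (auto simp: p_power_normal_subgroups_iff)
  show ?thesis
  proof (rule p_chain_induct[OF p N(1,2) sH N(3), of Q])
    fix M H assume "subgroup M G" "subgroup H G" "N \<subseteq> H" "H \<subseteq> M" "H \<lhd> G\<lparr>carrier := M\<rparr>"
       "rel_index G M H = p" "Q M"
    moreover from this have "M \<in> popen p G" "H \<in> popen p G" using NI by (auto simp: popen_def)
    ultimately show "Q H" using step by metis
  qed (rule top)
qed

lemma popen_parent:
  assumes p: "prime p" and H: "H \<in> popen p G" "H \<noteq> carrier G"
  shows "\<exists>M\<in>popen p G. H \<subseteq> M \<and> H \<lhd> G\<lparr>carrier := M\<rparr> \<and> rel_index G M H = p"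
proof -
  from H(1) obtain N k where N: "N \<lhd> G" "rel_index G (carrier G) N = p ^ k" "N \<subseteq> H" and sH: "subgroup H G"
    by (auto simp: popen_def p_power_normal_subgroups_iff)
  from ascend[OF p N(1,2) sH N(3) H(2)] show ?thesis using popen_superset[OF H(1)] by blast
qed

text \<open>A witness for openness of \<open>K\<close> in \<open>H\<close> is normal in
  \<open>H\<close> but perhaps not in \<open>G\<close>. The proof instead follows a chain of index
  \<open>p\<close> steps from \<open>H\<close> down to \<open>K\<close>, each of which preserves
  openness in \<open>G\<close>.\<close>

lemma popen_trans:
  assumes fg: "finitely_generated_group G" and p: "prime p" and H: "H \<in> popen p G"
    and K: "K \<in> popen p (G\<lparr>carrier := H\<rparr>)"
  shows "K \<in> popen p G"
proof -
  interpret H: group "G\<lparr>carrier := H\<rparr>" by (rule subgroup_imp_group[OF popen_subgroup[OF H]])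
  show ?thesis
    using p K
  proof (induction rule: H.popen_induct)
    case top
    then show ?case using H by simp
  next
    case (step M L)
    then show ?case using popen_index_prime[OF fg p, of M L] by (simp add: rel_index_carrier)
  qed
qed

text \<open>Each term of the subnormal chain is normal of \<open>p\<close>-power index in its
  predecessor, hence open in it, and openness is transitive.\<close>

lemma subnormal_popen:
  assumes fg: "finitely_generated_group G" and p: "prime p"
    and K: "subnormal K G" "rel_index G (carrier G) K = p ^ m"
  shows "K \<in> popen p G"
proof -
  from K obtain n S where S: "S 0 = carrier G" "S n = K" and SS: "\<And>i. i < n \<Longrightarrow> S (Suc i) \<lhd> G\<lparr>carrier := S i\<rparr>"
    unfolding subnormal_def by blast
  have sub: "subgroup (S i) G" if "i \<le> n" for i
    using that
  proof (induction i)
    case 0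
    then show ?case using S subgroup_self by simp
  next
    case (Suc i)
    then show ?case using subgroup_restrict_trans(1)[OF _ SS] by simp
  qed
  have dec: "S (Suc i) \<subseteq> S i" if "i < n" for i
    using subgroup_restrict_trans(2)[OF sub SS] that by simp
  have decn: "K \<subseteq> S i" if "i \<le> n" for i
    using that
  proof (induction rule: inc_induct)
    case base
    then show ?case using S by simp
  next
    case (step i)
    then show ?case using dec by blast
  qed
  \<comment> \<open>Only the last term is known to have \<open>p\<close>-power index; the
    intermediate indices divide it.\<close>
  have div: "rel_index G (carrier G) (S i) dvd p ^ m" if "i \<le> n" for i
    using rel_index_mult[OF sub[OF order_refl, unfolded S(2)] sub[OF that] subgroup_self decn[OF that] subgroup.subset[OF sub[OF that]]] K(2)
    by (metis dvd_triv_left)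
  have "S i \<in> popen p G" if "i \<le> n" for i
    using that
  proof (induction i)
    case 0
    then show ?case using S popen_carrier by simp
  next
    case (Suc i)
    then have i: "i \<le> n" "i < n" by auto
    have "rel_index G (carrier G) (S (Suc i)) = rel_index G (carrier G) (S i) * rel_index G (S i) (S (Suc i))"
      by (rule rel_index_mult[OF sub[OF Suc.prems] sub[OF i(1)] subgroup_self dec[OF i(2)] subgroup.subset[OF sub[OF i(1)]]])
    then have "rel_index G (S i) (S (Suc i)) dvd p ^ m"
      using div[OF Suc.prems] by (metis dvd_mult_right)
    then obtain l where l: "rel_index G (S i) (S (Suc i)) = p ^ l"
      using divides_primepow_nat[OF p] by blast
    interpret Si: group "G\<lparr>carrier := S i\<rparr>" by (rule subgroup_imp_group[OF sub[OF i(1)]])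
    have "S (Suc i) \<in> popen p (G\<lparr>carrier := S i\<rparr>)"
      using Si.p_power_normal_popen[of "S (Suc i)" p] SS[OF i(2)] l
      by (auto simp: Si.p_power_normal_subgroups_iff rel_index_carrier)
    then show ?case using popen_trans[OF fg p] Suc i by blast
  qed
  then show ?thesis using S by blast
qed

lemma popen_subnormal:
  assumes p: "prime p" and H: "H \<in> popen p G"
  shows "subnormal H G"
  using assms
proof (induction rule: popen_induct)
  case top
  then show ?case unfolding subnormal_def by (intro exI[of _ 0] exI[of _ "\<lambda>_. carrier G"]) simp
next
  case (step M H)
  then obtain n S where S: "S 0 = carrier G" "S n = M" and SS: "\<And>i. i < n \<Longrightarrow> S (Suc i) \<lhd> G\<lparr>carrier := S i\<rparr>"
    unfolding subnormal_def by blast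
  show ?case unfolding subnormal_def
    by (intro exI[of _ "Suc n"] exI[of _ "S(Suc n := H)"]) (use S SS step in \<open>auto simp: less_Suc_eq\<close>)
qed

text \<open>An open subgroup of index \<open>p ^ Suc k\<close> is the kernel of a homomorphism to
  Z/p on an open subgroup of index \<open>p ^ k\<close>, and each of the latter carries finitely
  many homomorphisms.\<close>

lemma finite_index_levels:
  assumes fg: "finitely_generated_group G" and p: "prime p"
  shows "finite {H \<in> popen p G. rel_index G (carrier G) H = p ^ k}"
proof (induction k)
  case 0
  have "{H \<in> popen p G. rel_index G (carrier G) H = p ^ 0} \<subseteq> {carrier G}"
    using rel_index_eq_1[OF popen_subgroup subgroup_self] subgroup.subset[OF popen_subgroup] by auto
  then show ?case by (rule finite_subset) simp
next
  case (Suc k)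
  let ?L = "{H \<in> popen p G. rel_index G (carrier G) H = p ^ k}"
  have "{H \<in> popen p G. rel_index G (carrier G) H = p ^ Suc k} \<subseteq>
     (\<Union>M\<in>?L. hom_kernel (G\<lparr>carrier := M\<rparr>) ` mod_homs p (G\<lparr>carrier := M\<rparr>))"
  proof
    fix H assume "H \<in> {H \<in> popen p G. rel_index G (carrier G) H = p ^ Suc k}"
    then have H: "H \<in> popen p G" "rel_index G (carrier G) H = p ^ Suc k" by auto
    have "H \<noteq> carrier G" using H(2) rel_index_self[OF subgroup_self] prime_gt_1_nat[OF p]
      by (metis nat_less_le one_less_power zero_less_Suc)
    then obtain M where M: "M \<in> popen p G" "H \<subseteq> M" "H \<lhd> G\<lparr>carrier := M\<rparr>" "rel_index G M H = p"
      using popen_parent[OF p H(1)] by blast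
    interpret M: group "G\<lparr>carrier := M\<rparr>" by (rule subgroup_imp_group[OF popen_subgroup[OF M(1)]])
    have "rel_index G (carrier G) M = p ^ k"
      using rel_index_mult[OF popen_subgroup[OF H(1)] popen_subgroup[OF M(1)] subgroup_self M(2) subgroup.subset[OF popen_subgroup[OF M(1)]]]
        M(4) H(2) prime_gt_0_nat[OF p] by simp
    moreover obtain \<tau> where "\<tau> \<in> mod_homs p (G\<lparr>carrier := M\<rparr>)" "H = hom_kernel (G\<lparr>carrier := M\<rparr>) \<tau>"
      using M.index_prime_hom[OF M(3) _ p] M(4) by (auto simp: rel_index_carrier)
    ultimately show "H \<in> (\<Union>M\<in>?L. hom_kernel (G\<lparr>carrier := M\<rparr>) ` mod_homs p (G\<lparr>carrier := M\<rparr>))"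
      using M(1) by blast
  qed
  moreover have "finite (\<Union>M\<in>?L. hom_kernel (G\<lparr>carrier := M\<rparr>) ` mod_homs p (G\<lparr>carrier := M\<rparr>))"
    using Suc popen_finite_mod_homs[OF fg p] by auto
  ultimately show ?case by (rule finite_subset)
qed

end

section \<open>Homomorphisms on a normal subgroup of index \<open>p\<close>\<close>

lemma card_le_image_mult:
  assumes "finite A" "\<And>y. y \<in> f ` A \<Longrightarrow> card {x \<in> A. f x = y} \<le> c"
  shows "card A \<le> card (f ` A) * c"
proof -
  have "A = (\<Union>y\<in>f ` A. {x \<in> A. f x = y})" by auto
  then have "card A \<le> (\<Sum>y\<in>f ` A. card {x \<in> A. f x = y})"
    using card_UN_le[of "f ` A" "\<lambda>y. {x \<in> A. f x = y}"] assms(1) by simp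
  also have "\<dots> \<le> card (f ` A) * c" using sum_bounded_above[of "f ` A" _ c] assms(2) by simp
  finally show ?thesis .
qed

text \<open>The \<open>k\<close>-th forward difference, that is, (T - 1)^k for the shift T. It moves
  the binomial computation to integer sequences, where it precedes the reduction modulo
  \<open>p\<close>.\<close>

fun iter_diff :: "nat \<Rightarrow> (nat \<Rightarrow> int) \<Rightarrow> nat \<Rightarrow> int" where
  "iter_diff 0 a j = a j"
| "iter_diff (Suc k) a j = iter_diff k a (Suc j) - iter_diff k a j"

lemma iter_diff_eq_sum:
  "iter_diff k a j = (\<Sum>i\<le>k. (-1) ^ (k + i) * int (k choose i) * a (j + i))"
proof (induction k arbitrary: j)
  case 0
  then show ?case by simp
next
  case (Suc k)
  have a: "(\<Sum>i\<le>k. (-1) ^ (k + i) * int (k choose i) * a (j + i)) =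
    (-1) ^ k * a j + (\<Sum>i\<le>k. (-1) ^ (k + Suc i) * int (k choose Suc i) * a (j + Suc i))"
  proof -
    have "(\<Sum>i\<le>k. (-1) ^ (k + i) * int (k choose i) * a (j + i)) =
      (\<Sum>i\<le>Suc k. (-1) ^ (k + i) * int (k choose i) * a (j + i))" by simp
    also have "\<dots> = (-1) ^ k * a j + (\<Sum>i\<le>k. (-1) ^ (k + Suc i) * int (k choose Suc i) * a (j + Suc i))"
      unfolding sum.atMost_Suc_shift by simp
    finally show ?thesis .
  qed
  have "iter_diff (Suc k) a j = (\<Sum>i\<le>k. (-1) ^ (k + i) * int (k choose i) * a (Suc j + i))
     - (\<Sum>i\<le>k. (-1) ^ (k + i) * int (k choose i) * a (j + i))"
    by (simp only: iter_diff.simps Suc.IH)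
  also have "\<dots> = (\<Sum>i\<le>k. (-1) ^ (k + i) * int (k choose i) * a (j + Suc i))
     - (-1) ^ k * a j + (\<Sum>i\<le>k. (-1) ^ (k + i) * int (k choose Suc i) * a (j + Suc i))"
    unfolding a by (simp add: sum_negf[symmetric])
  also have "\<dots> = (-1) ^ Suc k * a j +
      (\<Sum>i\<le>k. (-1) ^ (Suc k + Suc i) * int (Suc k choose Suc i) * a (j + Suc i))"
    by (simp add: sum.distrib[symmetric] algebra_simps)
  also have "\<dots> = (\<Sum>i\<le>Suc k. (-1) ^ (Suc k + i) * int (Suc k choose i) * a (j + i))"
    unfolding sum.atMost_Suc_shift[of _ k] by simp
  finally show ?case .
qed

text \<open>The identity (T - 1)^p = T^p - 1 modulo \<open>p\<close>: all binomial coefficients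
  except the two outer ones are divisible by \<open>p\<close>.\<close>

lemma iter_diff_prime:
  assumes p: "prime p"
  shows "[iter_diff p a j = a (j + p) - a j] (mod int p)"
proof -
  let ?f = "\<lambda>i. (-1) ^ (p + i) * int (p choose i) * a (j + i)"
  obtain q where q: "p = Suc q" using p by (cases p) auto
  have q0: "q > 0" using p q by (cases q) auto
  have "int p dvd ?f i" if "i \<in> {1..q}" for i
  proof -
    have "p dvd (p choose i)" by (rule dvd_choose_prime) (use that q p in auto)
    then show ?thesis by simp
  qed
  then have d: "int p dvd (\<Sum>i\<in>{1..q}. ?f i)" by (rule dvd_sum)
  have "{..p} = insert 0 (insert p {1..q})" using q by auto
  then have "iter_diff p a j = ?f 0 + (?f p + (\<Sum>i\<in>{1..q}. ?f i))"
    unfolding iter_diff_eq_sum using q by simp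
  also have "[\<dots> = ?f 0 + (?f p + 0)] (mod int p)"
    using d by (intro cong_add cong_refl) (simp add: cong_0_iff)
  also have "?f 0 + (?f p + 0) = (-1) ^ p * a j + a (j + p)" by (simp add: power_add[symmetric])
  \<comment> \<open>The sign is -1 for odd \<open>p\<close>. For \<open>p = 2\<close> it is +1,
    which is the same residue.\<close>
  also have "[(-1) ^ p * a j + a (j + p) = a (j + p) - a j] (mod int p)"
  proof (cases "odd p")
    case True
    then show ?thesis by simp
  next
    case False
    then have "p = 2" using p by (metis primes_dvd_imp_eq two_is_prime_nat)
    then show ?thesis by (simp add: cong_iff_dvd_diff)
  qed
  finally show ?thesis .
qed

lemma mod_homs_lin:
  assumes "\<phi> \<in> mod_homs p G" "\<psi> \<in> mod_homs p G" "0 < p" "group G"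
  shows "(\<lambda>x\<in>carrier G. (a * \<phi> x + b * \<psi> x) mod int p) \<in> mod_homs p G"
proof (rule mod_homsI)
  interpret group G by fact
  fix x y assume "x \<in> carrier G" "y \<in> carrier G"
  note xy = this
  have "(a * ((\<phi> x + \<phi> y) mod int p) + b * ((\<psi> x + \<psi> y) mod int p)) mod int p
      = (a * (\<phi> x + \<phi> y) + b * (\<psi> x + \<psi> y)) mod int p"
    unfolding cong_def[symmetric] by (intro cong_add cong_mult cong_refl) (simp_all add: cong_def)
  also have "a * (\<phi> x + \<phi> y) + b * (\<psi> x + \<psi> y) = (a * \<phi> x + b * \<psi> x) + (a * \<phi> y + b * \<psi> y)"
    by (simp add: algebra_simps)
  also have "\<dots> mod int p = ((a * \<phi> x + b * \<psi> x) mod int p + (a * \<phi> y + b * \<psi> y) mod int p) mod int p"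
    by (simp only: mod_simps)
  finally show "(\<lambda>x\<in>carrier G. (a * \<phi> x + b * \<psi> x) mod int p) (x \<otimes>\<^bsub>G\<^esub> y) =
     ((\<lambda>x\<in>carrier G. (a * \<phi> x + b * \<psi> x) mod int p) x + (\<lambda>x\<in>carrier G. (a * \<phi> x + b * \<psi> x) mod int p) y) mod int p"
    using mod_homs_mult[OF assms(1)] mod_homs_mult[OF assms(2)] xy by simp
qed (use assms in auto)

lemma mod_homs_diff_eq_0:
  assumes "\<phi> \<in> mod_homs p G" "\<psi> \<in> mod_homs p G" "x \<in> carrier G" "(\<phi> x - \<psi> x) mod int p = 0"
  shows "\<phi> x = \<psi> x"
proof -
  have "[\<phi> x = \<psi> x] (mod int p)" using assms(4) by (simp add: cong_iff_dvd_diff dvd_eq_mod_eq_0)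
  then show ?thesis using mod_homs_mod[OF assms(1,3)] mod_homs_mod[OF assms(2,3)] by (simp add: cong_def)
qed

text \<open>The group Hom(K, Z/p) is filtered by the kernels \<open>V i\<close> of the powers of
  \<open>D\<close>, which is T - 1 for the action T of conjugation by \<open>t\<close>. Each layer
  is no larger than \<open>V 1\<close>, the T-invariant homomorphisms, and \<open>V p\<close> is
  everything. It remains to compare \<open>V 1\<close> with Hom(G, Z/p). All sizes are cardinalities
  of finite sets, so no vector space structure is needed on them.\<close>

locale index_p_hom = group G for G (structure) +
  fixes p :: nat and \<tau> :: "'a \<Rightarrow> int" and t :: 'a
  assumes p: "prime p" and \<tau>: "\<tau> \<in> mod_homs p G" and t: "t \<in> carrier G" "\<tau> t = 1"
    and fin: "finite (mod_homs p G)" "finite (mod_homs p (G\<lparr>carrier := hom_kernel G \<tau>\<rparr>))"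
begin

abbreviation "K \<equiv> hom_kernel G \<tau>"
abbreviation "M \<equiv> mod_homs p (G\<lparr>carrier := K\<rparr>)"

lemma p0: "0 < p" using p prime_gt_0_nat by blast

lemma K: "K \<lhd> G" using hom_kernel_normal[OF \<tau> p0] .

lemma sK: "subgroup K G" using normal_imp_subgroup[OF K] .

lemma gK: "group (G\<lparr>carrier := K\<rparr>)" by (rule subgroup_imp_group[OF sK])

lemma KG: "x \<in> K \<Longrightarrow> x \<in> carrier G" by (simp add: hom_kernel_def)

lemma tp: "t [^] p \<in> K"
  using mod_homs_pow[OF \<tau> p0 t(1), of p] t by (simp add: hom_kernel_def)

lemma conj_K: "g \<in> carrier G \<Longrightarrow> x \<in> K \<Longrightarrow> g \<otimes> x \<otimes> inv g \<in> K"
  using K unfolding normal_inv_iff by blast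

text \<open>The coset of \<open>x\<close> modulo \<open>K\<close> is that of \<open>t\<close> to the
  power \<open>\<tau> x\<close>, so \<open>x\<close> is an element of \<open>K\<close> times one of
  the powers of \<open>t\<close> with exponents \<open>0..p-1\<close>.\<close>

lemma K_part: "x \<in> carrier G \<Longrightarrow> x \<otimes> inv (t [^] nat (\<tau> x)) \<in> K"
proof -
  assume x: "x \<in> carrier G"
  have r: "0 \<le> \<tau> x" "\<tau> x mod int p = \<tau> x" using mod_homs_range[OF \<tau> x] mod_homs_mod[OF \<tau> x] by auto
  have "\<tau> (inv (t [^] nat (\<tau> x))) = (- \<tau> x) mod int p"
    using mod_homs_inv[OF \<tau> p0, of "t [^] nat (\<tau> x)"] mod_homs_pow[OF \<tau> p0 t(1)] t r
    by (simp add: mod_simps del: pow_nat)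
  then have "\<tau> (x \<otimes> inv (t [^] nat (\<tau> x))) = 0"
    using mod_homs_mult[OF \<tau> x, of "inv (t [^] nat (\<tau> x))"] t by (simp add: mod_simps del: pow_nat)
  then show ?thesis using x t by (simp add: hom_kernel_def)
qed

text \<open>This is T - 1 on Hom(K, Z/p), with T the precomposition with conjugation by
  \<open>t\<close>.\<close>

definition D :: "('a \<Rightarrow> int) \<Rightarrow> 'a \<Rightarrow> int" where
  "D \<phi> = (\<lambda>x\<in>K. (\<phi> (t \<otimes> x \<otimes> inv t) - \<phi> x) mod int p)"

lemma D_mem: assumes \<phi>: "\<phi> \<in> M" shows "D \<phi> \<in> M"
proof -
  have "D \<phi> = (\<lambda>x\<in>carrier (G\<lparr>carrier := K\<rparr>). (1 * (\<lambda>x\<in>K. \<phi> (t \<otimes> x \<otimes> inv t)) x + (-1) * \<phi> x) mod int p)"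
    by (auto simp: D_def)
  then show ?thesis
    using mod_homs_lin[OF mod_homs_conjugate[OF K \<phi> t(1)] \<phi> p0 gK, of 1 "-1"] by simp
qed

lemma D_iter: "\<phi> \<in> M \<Longrightarrow> (D ^^ k) \<phi> \<in> M"
  by (induction k) (auto simp: D_mem)

definition zero_hom :: "'a \<Rightarrow> int" where "zero_hom = (\<lambda>x\<in>K. 0)"

text \<open>Along the orbit of \<open>x\<close> under conjugation by powers of \<open>t\<close>,
  applying \<open>D\<close> is taking the forward difference of the sequence of values, up to
  reduction modulo \<open>p\<close>.\<close>

lemma D_iter_cong:
  assumes \<phi>: "\<phi> \<in> M" and x: "x \<in> K"
  shows "[(D ^^ k) \<phi> (t [^] j \<otimes> x \<otimes> inv (t [^] j)) =
    iter_diff k (\<lambda>j. \<phi> (t [^] j \<otimes> x \<otimes> inv (t [^] j))) j] (mod int p)"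
proof (induction k arbitrary: j)
  case 0
  then show ?case by simp
next
  case (Suc k)
  let ?y = "t [^] j \<otimes> x \<otimes> inv (t [^] j)"
  have y: "?y \<in> K" using conj_K x t by simp
  have "t \<otimes> ?y \<otimes> inv t = t [^] Suc j \<otimes> x \<otimes> inv (t [^] Suc j)"
    using t KG[OF x] nat_pow_Suc2[OF t(1), of j] by (simp add: inv_mult_group m_assoc del: nat_pow_Suc)
  then have "(D ^^ Suc k) \<phi> ?y =
     ((D ^^ k) \<phi> (t [^] Suc j \<otimes> x \<otimes> inv (t [^] Suc j)) - (D ^^ k) \<phi> ?y) mod int p"
    using y by (simp add: D_def)
  then have "[(D ^^ Suc k) \<phi> ?y =
     (D ^^ k) \<phi> (t [^] Suc j \<otimes> x \<otimes> inv (t [^] Suc j)) - (D ^^ k) \<phi> ?y] (mod int p)"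
    by (simp add: cong_def)
  also have "[(D ^^ k) \<phi> (t [^] Suc j \<otimes> x \<otimes> inv (t [^] Suc j)) - (D ^^ k) \<phi> ?y =
     iter_diff (Suc k) (\<lambda>j. \<phi> (t [^] j \<otimes> x \<otimes> inv (t [^] j))) j] (mod int p)"
    unfolding iter_diff.simps by (intro cong_diff Suc.IH)
  finally show ?case .
qed

lemma zero_hom_mem: "zero_hom \<in> M"
  by (rule mod_homsI) (use p0 subgroup.m_closed[OF sK] in \<open>auto simp: zero_hom_def\<close>)

text \<open>In characteristic \<open>p\<close> one has \<open>(T - 1)\<^sup>p = T\<^sup>p - 1\<close>, and \<open>T\<^sup>p\<close> is conjugation by an element of \<open>K\<close>.\<close>

lemma D_iter_p:
  assumes \<phi>: "\<phi> \<in> M" shows "(D ^^ p) \<phi> = zero_hom"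
proof (rule mod_homs_eqI[OF D_iter[OF \<phi>] zero_hom_mem])
  fix x assume "x \<in> carrier (G\<lparr>carrier := K\<rparr>)"
  then have x: "x \<in> K" by simp
  interpret K: group "G\<lparr>carrier := K\<rparr>" by (rule gK)
  have "\<phi> (t [^] p \<otimes> x \<otimes> inv (t [^] p)) = \<phi> x"
    using K.mod_homs_conj[OF \<phi> p0, of x "t [^] p"] x tp m_inv_consistent[OF sK tp] by simp
  then have "[(D ^^ p) \<phi> x = 0] (mod int p)"
    using D_iter_cong[OF \<phi> x, of p 0] iter_diff_prime[OF p, of "\<lambda>j. \<phi> (t [^] j \<otimes> x \<otimes> inv (t [^] j))" 0] KG[OF x]
    by (auto intro: cong_trans)
  then show "(D ^^ p) \<phi> x = zero_hom x"
    using mod_homs_mod[OF D_iter[OF \<phi>, of p], of x] x by (simp add: cong_def zero_hom_def)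
qed

definition V :: "nat \<Rightarrow> ('a \<Rightarrow> int) set" where "V i = {\<phi> \<in> M. (D ^^ i) \<phi> = zero_hom}"

lemma finV: "finite (V i)" using fin(2) by (simp add: V_def)

definition sub :: "('a \<Rightarrow> int) \<Rightarrow> ('a \<Rightarrow> int) \<Rightarrow> 'a \<Rightarrow> int" where
  "sub \<phi> \<psi> = (\<lambda>x\<in>K. (\<phi> x - \<psi> x) mod int p)"

lemma sub_mem: "\<phi> \<in> M \<Longrightarrow> \<psi> \<in> M \<Longrightarrow> sub \<phi> \<psi> \<in> M"
  using mod_homs_lin[OF _ _ p0 gK, of \<phi> \<psi> 1 "-1"] by (simp add: sub_def)

lemma sub_inj: "\<chi> \<in> M \<Longrightarrow> inj_on (\<lambda>\<phi>. sub \<phi> \<chi>) M"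
proof (rule inj_onI)
  fix \<phi> \<psi> assume h: "\<chi> \<in> M" "\<phi> \<in> M" "\<psi> \<in> M" "sub \<phi> \<chi> = sub \<psi> \<chi>"
  show "\<phi> = \<psi>"
  proof (rule mod_homs_eqI[OF h(2,3)])
    fix x assume x: "x \<in> carrier (G\<lparr>carrier := K\<rparr>)"
    then have "(\<phi> x - \<chi> x) mod int p = (\<psi> x - \<chi> x) mod int p" using fun_cong[OF h(4), of x] by (simp add: sub_def)
    then have "[\<phi> x - \<chi> x + \<chi> x = \<psi> x - \<chi> x + \<chi> x] (mod int p)" by (intro cong_add) (auto simp: cong_def)
    then have "(\<phi> x - \<psi> x) mod int p = 0" by (simp add: cong_iff_dvd_diff)
    then show "\<phi> x = \<psi> x" using mod_homs_diff_eq_0[OF h(2,3) x] by simp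
  qed
qed

text \<open>\<open>D\<close> maps \<open>V (Suc i)\<close> into \<open>V i\<close>. Subtracting one
  element of a fibre embeds that fibre in the kernel of \<open>D\<close>, which is
  \<open>V 1\<close>.\<close>

lemma card_V_Suc: "card (V (Suc i)) \<le> card (V i) * card (V 1)"
proof -
  have "card (V (Suc i)) \<le> card (D ` V (Suc i)) * card (V 1)"
  proof (rule card_le_image_mult[OF finV])
    fix y assume "y \<in> D ` V (Suc i)"
    then obtain \<chi> where \<chi>: "\<chi> \<in> V (Suc i)" "y = D \<chi>" by blast
    then have \<chi>M: "\<chi> \<in> M" by (simp add: V_def)
    have "(\<lambda>\<phi>. sub \<phi> \<chi>) ` {\<phi> \<in> V (Suc i). D \<phi> = y} \<subseteq> V 1"
    proof clarify
      fix \<phi> assume \<phi>: "\<phi> \<in> V (Suc i)" "y = D \<phi>"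
      then have \<phi>M: "\<phi> \<in> M" by (simp add: V_def)
      have "D (sub \<phi> \<chi>) = zero_hom"
      proof
        fix x
        show "D (sub \<phi> \<chi>) x = zero_hom x"
        proof (cases "x \<in> K")
          case True
          then have c: "t \<otimes> x \<otimes> inv t \<in> K" using conj_K t by simp
          have "D \<phi> x = D \<chi> x" using \<phi> \<chi> by simp
          then have e: "[\<phi> (t \<otimes> x \<otimes> inv t) - \<phi> x = \<chi> (t \<otimes> x \<otimes> inv t) - \<chi> x] (mod int p)"
            using True by (simp add: D_def cong_def)
          have "D (sub \<phi> \<chi>) x = ((\<phi> (t \<otimes> x \<otimes> inv t) - \<chi> (t \<otimes> x \<otimes> inv t)) - (\<phi> x - \<chi> x)) mod int p"
            using True c by (simp add: D_def sub_def mod_simps)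
          also have "\<dots> = ((\<phi> (t \<otimes> x \<otimes> inv t) - \<phi> x) - (\<chi> (t \<otimes> x \<otimes> inv t) - \<chi> x)) mod int p"
            by (simp add: algebra_simps)
          also have "\<dots> = 0" using e by (simp add: cong_iff_dvd_diff)
          finally show ?thesis using True by (simp add: zero_hom_def)
        qed (simp add: D_def zero_hom_def)
      qed
      then show "sub \<phi> \<chi> \<in> V 1" using sub_mem[OF \<phi>M \<chi>M] by (simp add: V_def)
    qed
    moreover have "inj_on (\<lambda>\<phi>. sub \<phi> \<chi>) {\<phi> \<in> V (Suc i). D \<phi> = y}"
      by (rule inj_on_subset[OF sub_inj[OF \<chi>M]]) (auto simp: V_def)
    ultimately show "card {\<phi> \<in> V (Suc i). D \<phi> = y} \<le> card (V 1)"
      by (intro card_inj_on_le[OF _ _ finV])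
  qed
  moreover have "D ` V (Suc i) \<subseteq> V i"
    by (auto simp: V_def D_mem funpow_Suc_right simp del: funpow.simps)
  then have "card (D ` V (Suc i)) \<le> card (V i)" by (rule card_mono[OF finV])
  then have "card (D ` V (Suc i)) * card (V 1) \<le> card (V i) * card (V 1)" by (rule mult_le_mono1)
  ultimately show ?thesis by (rule le_trans)
qed

lemma card_V: "card (V i) \<le> card (V 1) ^ i"
proof (induction i)
  case 0
  have "V 0 \<subseteq> {zero_hom}" by (auto simp: V_def)
  then show ?case using card_mono[of "{zero_hom}" "V 0"] by simp
next
  case (Suc i)
  have "card (V (Suc i)) \<le> card (V i) * card (V 1)" by (rule card_V_Suc)
  also have "\<dots> \<le> card (V 1) ^ i * card (V 1)" using Suc by (rule mult_le_mono1)
  finally show ?case by (simp add: mult.commute)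
qed

lemma V1_invariant: assumes "\<phi> \<in> V 1" "x \<in> K" shows "\<phi> (t \<otimes> x \<otimes> inv t) = \<phi> x"
proof -
  have \<phi>: "\<phi> \<in> M" "D \<phi> = zero_hom" using assms by (auto simp: V_def)
  have "(\<phi> (t \<otimes> x \<otimes> inv t) - \<phi> x) mod int p = 0"
    using fun_cong[OF \<phi>(2), of x] assms(2) by (simp add: D_def zero_hom_def)
  then have "[\<phi> (t \<otimes> x \<otimes> inv t) = \<phi> x] (mod int p)" by (simp add: cong_iff_dvd_diff dvd_eq_mod_eq_0)
  then show ?thesis
    using mod_homs_mod[OF \<phi>(1)] conj_K[OF t(1) assms(2)] assms(2) by (simp add: cong_def)
qed

lemma V1_invariant_pow:
  assumes "\<phi> \<in> V 1" "x \<in> K"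
  shows "\<phi> (t [^] (j::nat) \<otimes> x \<otimes> inv (t [^] j)) = \<phi> x"
proof (induction j)
  case 0
  then show ?case using KG[OF assms(2)] by simp
next
  case (Suc j)
  let ?y = "t [^] j \<otimes> x \<otimes> inv (t [^] j)"
  have y: "?y \<in> K" using conj_K assms t by simp
  have "t \<otimes> ?y \<otimes> inv t = t [^] Suc j \<otimes> x \<otimes> inv (t [^] Suc j)"
    using t KG[OF assms(2)] nat_pow_Suc2[OF t(1), of j] by (simp add: inv_mult_group m_assoc del: nat_pow_Suc)
  then show ?case using V1_invariant[OF assms(1) y] Suc by simp
qed

text \<open>These are the homomorphisms on \<open>K\<close> that extend to \<open>G\<close>. An
  extension is conjugation invariant, and its value at the \<open>p\<close>-th power of
  \<open>t\<close> is \<open>p\<close> times its value at \<open>t\<close>, which is 0 modulo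
  \<open>p\<close>. Conversely, \<open>hom_ext\<close> constructs an extension.\<close>

definition W :: "('a \<Rightarrow> int) set" where "W = {\<phi> \<in> V 1. \<phi> (t [^] p) = 0}"

text \<open>The extension that sends \<open>t\<close> to 0: the power of \<open>t\<close> in the
  decomposition of \<open>x\<close> is discarded.\<close>

definition hom_ext :: "('a \<Rightarrow> int) \<Rightarrow> 'a \<Rightarrow> int" where
  "hom_ext \<phi> = (\<lambda>x\<in>carrier G. \<phi> (x \<otimes> inv (t [^] nat (\<tau> x))))"

lemma hom_ext_mem:
  assumes \<phi>: "\<phi> \<in> W"
  shows "hom_ext \<phi> \<in> mod_homs p G"
proof (rule mod_homsI)
  have \<phi>M: "\<phi> \<in> M" and \<phi>V: "\<phi> \<in> V 1" and \<phi>t: "\<phi> (t [^] p) = 0" using \<phi> by (auto simp: W_def V_def)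
  interpret K: group "G\<lparr>carrier := K\<rparr>" by (rule gK)
  show "hom_ext \<phi> x \<in> {0..<int p}" if "x \<in> carrier G" for x
    using mod_homs_range[OF \<phi>M, of "x \<otimes> inv (t [^] nat (\<tau> x))"] K_part[OF that] that by (simp add: hom_ext_def)
  fix x y assume x: "x \<in> carrier G" and y: "y \<in> carrier G"
  define i where "i = nat (\<tau> x)"
  define j where "j = nat (\<tau> y)"
  define k where "k = nat (\<tau> (x \<otimes> y))"
  define h where "h = x \<otimes> inv (t [^] i)"
  define h' where "h' = y \<otimes> inv (t [^] j)"
  have h: "h \<in> K" "h' \<in> K" using K_part x y by (auto simp: h_def h'_def i_def j_def)
  have hG: "h \<in> carrier G" "h' \<in> carrier G" using h KG by auto
  have xy: "x = h \<otimes> t [^] i" "y = h' \<otimes> t [^] j" using x y t by (auto simp: h_def h'_def m_assoc)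
  have ij: "\<tau> x = int i" "\<tau> y = int j" using mod_homs_range[OF \<tau>] x y by (auto simp: i_def j_def)
  have "k = (i + j) mod p"
    unfolding k_def mod_homs_mult[OF \<tau> x y] ij by (simp add: nat_mod_distrib flip: of_nat_add zmod_int)
  \<comment> \<open>\<open>q\<close> is the carry in adding exponents modulo \<open>p\<close>. It
    contributes \<open>q\<close> times the value of \<open>\<phi>\<close> at the \<open>p\<close>-th
    power of \<open>t\<close>, which vanishes on \<open>W\<close>.\<close>
  then obtain q where q: "i + j = p * q + k" by (metis mult_div_mod_eq)
  have "t [^] (i + j) \<otimes> inv (t [^] k) = (t [^] p) [^] q"
    unfolding q using t by (simp add: nat_pow_mult[symmetric] nat_pow_pow m_assoc)
  then have tq: "t [^] (i + j) \<otimes> inv (t [^] k) = (t [^] p) [^] q" .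
  have "(x \<otimes> y) \<otimes> inv (t [^] k) = h \<otimes> (t [^] i \<otimes> h' \<otimes> inv (t [^] i)) \<otimes> (t [^] (i + j) \<otimes> inv (t [^] k))"
    using xy hG t by (simp add: m_assoc nat_pow_mult[symmetric] inv_solve_left)
  then have e: "(x \<otimes> y) \<otimes> inv (t [^] k) = h \<otimes> (t [^] i \<otimes> h' \<otimes> inv (t [^] i)) \<otimes> (t [^] p) [^] q"
    unfolding tq .
  have c: "t [^] i \<otimes> h' \<otimes> inv (t [^] i) \<in> K" using conj_K t h by simp
  have tq: "(t [^] p) [^] q \<in> K" using subgroup_nat_pow_closed[OF sK tp] .
  have pw: "\<phi> ((t [^] p) [^] q) = 0"
  proof (induction q)
    case 0
    then show ?case using K.mod_homs_one[OF \<phi>M p0] by simp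
  next
    case (Suc q)
    then show ?case
      using mod_homs_mult[OF \<phi>M, of "(t [^] p) [^] q" "t [^] p"] tp subgroup_nat_pow_closed[OF sK tp] \<phi>t by simp
  qed
  have "hom_ext \<phi> (x \<otimes> y) = \<phi> (h \<otimes> (t [^] i \<otimes> h' \<otimes> inv (t [^] i)) \<otimes> (t [^] p) [^] q)"
    using x y e by (simp add: hom_ext_def k_def)
  also have "\<dots> = (\<phi> h + \<phi> h') mod int p"
    using mod_homs_mult[OF \<phi>M, of "h \<otimes> (t [^] i \<otimes> h' \<otimes> inv (t [^] i))" "(t [^] p) [^] q"]
      mod_homs_mult[OF \<phi>M, of h "t [^] i \<otimes> h' \<otimes> inv (t [^] i)"] pw V1_invariant_pow[OF \<phi>V h(2), of i]
      c tq h subgroup.m_closed[OF sK h(1) c] by simp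
  also have "\<dots> = (hom_ext \<phi> x + hom_ext \<phi> y) mod int p"
    using x y by (simp add: hom_ext_def h_def h'_def i_def j_def)
  finally show "hom_ext \<phi> (x \<otimes> y) = (hom_ext \<phi> x + hom_ext \<phi> y) mod int p" .
qed (simp add: hom_ext_def)

text \<open>Evaluation at the \<open>p\<close>-th power of \<open>t\<close> takes at most
  \<open>p\<close> values, and each fibre is carried into \<open>W\<close> by subtracting one of its
  elements.\<close>

lemma card_V1: "card (V 1) \<le> p * card W"
proof -
  have "card (V 1) \<le> card ((\<lambda>\<phi>. \<phi> (t [^] p)) ` V 1) * card W"
  proof (rule card_le_image_mult[OF finV])
    fix y assume "y \<in> (\<lambda>\<phi>. \<phi> (t [^] p)) ` V 1"
    then obtain \<chi> where \<chi>: "\<chi> \<in> V 1" "y = \<chi> (t [^] p)" by blast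
    then have \<chi>M: "\<chi> \<in> M" by (simp add: V_def)
    have "(\<lambda>\<phi>. sub \<phi> \<chi>) ` {\<phi> \<in> V 1. \<phi> (t [^] p) = y} \<subseteq> W"
    proof clarify
      fix \<phi> assume \<phi>: "\<phi> \<in> V 1" "y = \<phi> (t [^] p)"
      then have \<phi>M: "\<phi> \<in> M" by (simp add: V_def)
      have "D (sub \<phi> \<chi>) x = zero_hom x" for x
        using V1_invariant[OF \<phi>(1), of x] V1_invariant[OF \<chi>(1), of x] conj_K[OF t(1), of x]
        by (cases "x \<in> K") (auto simp: D_def sub_def zero_hom_def)
      then have "D (sub \<phi> \<chi>) = zero_hom" ..
      then have "sub \<phi> \<chi> \<in> V 1" using sub_mem[OF \<phi>M \<chi>M] by (simp add: V_def)
      moreover have "sub \<phi> \<chi> (t [^] p) = 0" using \<phi> \<chi> tp by (simp add: sub_def)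
      ultimately show "sub \<phi> \<chi> \<in> W" by (simp add: W_def)
    qed
    moreover have finW: "finite W" using finV by (simp add: W_def)
    moreover have "inj_on (\<lambda>\<phi>. sub \<phi> \<chi>) {\<phi> \<in> V 1. \<phi> (t [^] p) = y}"
      by (rule inj_on_subset[OF sub_inj[OF \<chi>M]]) (auto simp: V_def)
    ultimately show "card {\<phi> \<in> V 1. \<phi> (t [^] p) = y} \<le> card W"
      by (intro card_inj_on_le[OF _ _ finW])
  qed
  also have "\<dots> \<le> p * card W"
  proof (rule mult_le_mono1)
    have "(\<lambda>\<phi>. \<phi> (t [^] p)) ` V 1 \<subseteq> {0..<int p}"
    proof clarify
      fix \<phi> assume "\<phi> \<in> V 1"
      then have "\<phi> \<in> M" by (simp add: V_def)
      then show "\<phi> (t [^] p) \<in> {0..<int p}" using mod_homs_range[of \<phi> p _ "t [^] p"] tp by fastforce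
    qed
    then show "card ((\<lambda>\<phi>. \<phi> (t [^] p)) ` V 1) \<le> p" using card_mono[of "{0..<int p}"] by fastforce
  qed
  finally show ?thesis .
qed

text \<open>The map sends (\<phi>, c) to the extension of \<phi> plus \<open>c\<close> times
  \<open>\<tau>\<close>. Its value at \<open>t\<close> returns \<open>c\<close>, and its restriction
  to \<open>K\<close> returns \<phi>. This gain of a factor \<open>p\<close> cancels the loss in
  \<open>card_V1\<close>, so no extra factor remains in the final bound.\<close>

lemma card_W: "p * card W \<le> card (mod_homs p G)"
proof -
  define f where "f = (\<lambda>(\<phi>, c). \<lambda>x\<in>carrier G. (1 * hom_ext \<phi> x + c * \<tau> x) mod int p)"
  have finW: "finite W" using finV by (simp add: W_def)
  have "inj_on f (W \<times> {0..<int p})"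
  proof (rule inj_onI, clarify)
    fix \<phi> c \<psi> d assume h: "\<phi> \<in> W" "\<psi> \<in> W" and cd: "c \<in> {0..<int p}" "d \<in> {0..<int p}" and e: "f (\<phi>, c) = f (\<psi>, d)"
    interpret K: group "G\<lparr>carrier := K\<rparr>" by (rule gK)
    have M: "\<phi> \<in> M" "\<psi> \<in> M" using h by (auto simp: W_def V_def)
    have "hom_ext \<phi> t = 0" "hom_ext \<psi> t = 0"
      using K.mod_homs_one[OF M(1) p0] K.mod_homs_one[OF M(2) p0] t by (auto simp: hom_ext_def)
    then have "c mod int p = d mod int p" using fun_cong[OF e, of t] t by (simp add: f_def)
    then have cd: "c = d" using cd by simp
    have "\<phi> = \<psi>"
    proof (rule mod_homs_eqI[OF M])
      fix x assume xK: "x \<in> carrier (G\<lparr>carrier := K\<rparr>)"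
      then have x: "x \<in> carrier G" "\<tau> x = 0" by (auto simp: hom_kernel_def)
      have "hom_ext \<phi> x mod int p = hom_ext \<psi> x mod int p" using fun_cong[OF e, of x] x by (simp add: f_def)
      moreover have "hom_ext \<phi> x = \<phi> x" "hom_ext \<psi> x = \<psi> x" using x by (simp_all add: hom_ext_def)
      ultimately show "\<phi> x = \<psi> x" using mod_homs_mod[OF M(1) xK] mod_homs_mod[OF M(2) xK] by simp
    qed
    then show "\<phi> = \<psi> \<and> c = d" using cd by simp
  qed
  moreover have "f ` (W \<times> {0..<int p}) \<subseteq> mod_homs p G"
    unfolding f_def by (auto intro: mod_homs_lin[OF hom_ext_mem \<tau> p0 is_group] simp del: mult_1)
  ultimately have "card (W \<times> {0..<int p}) \<le> card (mod_homs p G)" using fin(1) by (rule card_inj_on_le)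
  then show ?thesis by (simp add: card_cartesian_product mult.commute)
qed

lemma card_mod_homs_kernel: "card M \<le> card (mod_homs p G) ^ p"
proof -
  have "V p = M" using D_iter_p by (auto simp: V_def)
  then have "card M \<le> card (V 1) ^ p" using card_V[of p] by simp
  also have "\<dots> \<le> card (mod_homs p G) ^ p" using card_V1 card_W by (intro power_mono) auto
  finally show ?thesis .
qed

end

section \<open>Numbers of homomorphisms and numbers of kernels\<close>

context group
begin

lemma card_mod_homs_index_p:
  assumes "prime p" "N \<lhd> G" "rel_index G (carrier G) N = p"
    "finite (mod_homs p G)" "finite (mod_homs p (G\<lparr>carrier := N\<rparr>))"
  shows "card (mod_homs p (G\<lparr>carrier := N\<rparr>)) \<le> card (mod_homs p G) ^ p"
proof -
  obtain \<tau> t where "\<tau> \<in> mod_homs p G" "t \<in> carrier G" "\<tau> t = 1" "N = hom_kernel G \<tau>"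
    using index_prime_hom[OF assms(2,3,1)] by blast
  then interpret index_p_hom G p \<tau> t using assms by unfold_locales auto
  show ?thesis using card_mod_homs_kernel \<open>N = hom_kernel G \<tau>\<close> by simp
qed

text \<open>At most \<open>p\<close> homomorphisms share a kernel. For a proper kernel they are
  determined by their value at an element generating the quotient; for the kernel \<open>G\<close>
  there is only the zero homomorphism.\<close>

lemma card_mod_homs_le_kernels:
  assumes p: "prime p" and fin: "finite (mod_homs p G)"
  shows "card (mod_homs p G) \<le> card (hom_kernel G ` mod_homs p G) * p"
proof (rule card_le_image_mult[OF fin])
  have p0: "0 < p" using p prime_gt_0_nat by blast
  fix N assume "N \<in> hom_kernel G ` mod_homs p G"
  then obtain \<chi> where \<chi>: "\<chi> \<in> mod_homs p G" "N = hom_kernel G \<chi>" by blast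
  have "\<exists>t\<in>carrier G. inj_on (\<lambda>\<phi>. \<phi> t) {\<phi> \<in> mod_homs p G. hom_kernel G \<phi> = N}"
  proof (cases "N = carrier G")
    case True
    have "\<phi> = \<chi>" if "\<phi> \<in> mod_homs p G" "hom_kernel G \<phi> = N" for \<phi>
    proof (rule mod_homs_eqI[OF that(1) \<chi>(1)])
      fix x assume "x \<in> carrier G"
      then have "x \<in> hom_kernel G \<phi>" "x \<in> hom_kernel G \<chi>" using True that(2) \<chi>(2) by auto
      then show "\<phi> x = \<chi> x" by (simp add: hom_kernel_def)
    qed
    then have "inj_on (\<lambda>\<phi>. \<phi> \<one>) {\<phi> \<in> mod_homs p G. hom_kernel G \<phi> = N}" by (auto simp: inj_on_def)
    then show ?thesis by blast
  next
    case False
    then have "rel_index G (carrier G) N = p" using hom_kernel_index[OF \<chi>(1) p] \<chi>(2) by simp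
    then obtain \<tau> t where \<tau>: "\<tau> \<in> mod_homs p G" "t \<in> carrier G" "\<tau> t = 1" "N = hom_kernel G \<tau>"
      using index_prime_hom[OF _ _ p] hom_kernel_normal[OF \<chi>(1) p0] \<chi>(2) by blast
    have val: "\<phi> x = (\<tau> x * \<phi> t) mod int p" if \<phi>: "\<phi> \<in> mod_homs p G" "hom_kernel G \<phi> = N" and x: "x \<in> carrier G" for \<phi> x
    proof -
      let ?s = "t [^] nat (\<tau> x)"
      have s: "?s \<in> carrier G" using \<tau> by simp
      have r: "0 \<le> \<tau> x" "\<tau> x mod int p = \<tau> x" using mod_homs_range[OF \<tau>(1) x] mod_homs_mod[OF \<tau>(1) x] by auto
      have "\<tau> ?s = \<tau> x" using mod_homs_pow[OF \<tau>(1) p0 \<tau>(2)] \<tau>(3) r by (simp del: pow_nat)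
      then have "N #> x = N #> ?s" using hom_kernel_rcos_eq[OF \<tau>(1) p0 x s] \<tau>(4) by simp
      then have "\<phi> x = \<phi> ?s" using hom_kernel_rcos_eq[OF \<phi>(1) p0 x s] \<phi>(2) by simp
      also have "\<dots> = (\<tau> x * \<phi> t) mod int p" using mod_homs_pow[OF \<phi>(1) p0 \<tau>(2)] r by (simp del: pow_nat)
      finally show ?thesis .
    qed
    have "inj_on (\<lambda>\<phi>. \<phi> t) {\<phi> \<in> mod_homs p G. hom_kernel G \<phi> = N}"
    proof (rule inj_onI)
      fix \<phi> \<psi> assume h: "\<phi> \<in> {\<phi> \<in> mod_homs p G. hom_kernel G \<phi> = N}" "\<psi> \<in> {\<phi> \<in> mod_homs p G. hom_kernel G \<phi> = N}"
        and e: "\<phi> t = \<psi> t"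
      have m: "\<phi> \<in> mod_homs p G" "\<psi> \<in> mod_homs p G" "hom_kernel G \<phi> = N" "hom_kernel G \<psi> = N" using h by auto
      show "\<phi> = \<psi>"
        by (rule mod_homs_eqI[OF m(1,2)]) (simp add: val[OF m(1,3)] val[OF m(2,4)] e)
    qed
    then show ?thesis using \<tau>(2) by blast
  qed
  then obtain t where t: "t \<in> carrier G" and inj: "inj_on (\<lambda>\<phi>. \<phi> t) {\<phi> \<in> mod_homs p G. hom_kernel G \<phi> = N}"
    by blast
  have "(\<lambda>\<phi>. \<phi> t) ` {\<phi> \<in> mod_homs p G. hom_kernel G \<phi> = N} \<subseteq> {0..<int p}"
    using mod_homs_range[OF _ t] by auto
  then show "card {\<phi> \<in> mod_homs p G. hom_kernel G \<phi> = N} \<le> p"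
    using card_inj_on_le[OF inj, of "{0..<int p}"] by simp
qed

end

section \<open>The first homology group\<close>

lemma residue_ring_simps [simp]:
  "carrier (residue_ring m) = {0..m - 1}"
  "x \<oplus>\<^bsub>residue_ring m\<^esub> y = (x + y) mod m"
  "x \<otimes>\<^bsub>residue_ring m\<^esub> y = (x * y) mod m"
  "\<zero>\<^bsub>residue_ring m\<^esub> = 0" "\<one>\<^bsub>residue_ring m\<^esub> = 1"
  by (simp_all add: residue_ring_def)

lemma field_residue_ring: "prime p \<Longrightarrow> field (residue_ring (int p))"
  by (intro residues_prime.is_field residues_prime.intro) simp_all

section \<open>Quotient modules and the bar complex in low degrees\<close>

lemma quotient_module_carrier:
  "carrier (quotient_module M B) = (\<lambda>x. B +>\<^bsub>M\<^esub> x) ` carrier M"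
  by (auto simp: quotient_module_def A_RCOSETS_def')

lemma quotient_module:
  assumes M: "module R M" and B: "LinearCombinations.submodule R B M"
  shows "module R (quotient_module M B)"
    and "\<And>x y. x \<in> carrier M \<Longrightarrow> y \<in> carrier M \<Longrightarrow>
      (B +>\<^bsub>M\<^esub> x) \<oplus>\<^bsub>quotient_module M B\<^esub> (B +>\<^bsub>M\<^esub> y) = B +>\<^bsub>M\<^esub> (x \<oplus>\<^bsub>M\<^esub> y)"
    and "\<And>a x. a \<in> carrier R \<Longrightarrow> x \<in> carrier M \<Longrightarrow>
      a \<odot>\<^bsub>quotient_module M B\<^esub> (B +>\<^bsub>M\<^esub> x) = B +>\<^bsub>M\<^esub> (a \<odot>\<^bsub>M\<^esub> x)"
    and "\<And>x y. x \<in> carrier M \<Longrightarrow> y \<in> carrier M \<Longrightarrow>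
      B +>\<^bsub>M\<^esub> x = B +>\<^bsub>M\<^esub> y \<longleftrightarrow> (\<exists>b\<in>B. x = b \<oplus>\<^bsub>M\<^esub> y)"
proof -
  interpret M: module R M by (rule M)
  let ?Q = "quotient_module M B"
  have BM: "B \<subseteq> carrier M" using B by (rule LinearCombinations.submodule.subset)
  have B0: "\<zero>\<^bsub>M\<^esub> \<in> B" using B by (rule LinearCombinations.submodule.zero_closed)
  have Badd: "x \<oplus>\<^bsub>M\<^esub> y \<in> B" if "x \<in> B" "y \<in> B" for x y
    using LinearCombinations.submodule.m_closed[OF B that] .
  have Bsmult: "a \<odot>\<^bsub>M\<^esub> x \<in> B" if "a \<in> carrier R" "x \<in> B" for a x
    using LinearCombinations.submodule.smult_closed[OF B that] .
  \<comment> \<open>The submodule predicate supplies sums and scalar multiples; negatives arise as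
    multiples by -1.\<close>
  have Bneg: "\<ominus>\<^bsub>M\<^esub> x \<in> B" if "x \<in> B" for x
    using Bsmult[of "\<ominus>\<^bsub>R\<^esub> \<one>\<^bsub>R\<^esub>" x] that BM M.smult_minus_1[of x] by auto
  have coset: "B +>\<^bsub>M\<^esub> x = {b \<oplus>\<^bsub>M\<^esub> x |b. b \<in> B}" for x
    by (auto simp: a_r_coset_def')
  have cosetI: "b \<oplus>\<^bsub>M\<^esub> x \<in> B +>\<^bsub>M\<^esub> x" if "b \<in> B" for b x
    using that by (auto simp: coset)
  have Bc: "b \<in> carrier M" if "b \<in> B" for b using that BM by blast
  show eq_iff: "B +>\<^bsub>M\<^esub> x = B +>\<^bsub>M\<^esub> y \<longleftrightarrow> (\<exists>b\<in>B. x = b \<oplus>\<^bsub>M\<^esub> y)"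
    if xy: "x \<in> carrier M" "y \<in> carrier M" for x y
  proof
    assume "B +>\<^bsub>M\<^esub> x = B +>\<^bsub>M\<^esub> y"
    then have "x \<in> B +>\<^bsub>M\<^esub> y" using cosetI[OF B0, of x] xy by simp
    then show "\<exists>b\<in>B. x = b \<oplus>\<^bsub>M\<^esub> y" by (auto simp: coset)
  next
    assume "\<exists>b\<in>B. x = b \<oplus>\<^bsub>M\<^esub> y"
    then obtain b where b: "b \<in> B" "x = b \<oplus>\<^bsub>M\<^esub> y" by blast
    show "B +>\<^bsub>M\<^esub> x = B +>\<^bsub>M\<^esub> y"
    proof
      show "B +>\<^bsub>M\<^esub> x \<subseteq> B +>\<^bsub>M\<^esub> y"
      proof
        fix u assume "u \<in> B +>\<^bsub>M\<^esub> x"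
        then obtain c where c: "c \<in> B" "u = c \<oplus>\<^bsub>M\<^esub> x" by (auto simp: coset)
        have "u = (c \<oplus>\<^bsub>M\<^esub> b) \<oplus>\<^bsub>M\<^esub> y" using b c Bc xy by (simp add: M.a_assoc)
        then show "u \<in> B +>\<^bsub>M\<^esub> y" using cosetI Badd b c by simp
      qed
      show "B +>\<^bsub>M\<^esub> y \<subseteq> B +>\<^bsub>M\<^esub> x"
      proof
        fix u assume "u \<in> B +>\<^bsub>M\<^esub> y"
        then obtain c where c: "c \<in> B" "u = c \<oplus>\<^bsub>M\<^esub> y" by (auto simp: coset)
        have "y = (\<ominus>\<^bsub>M\<^esub> b) \<oplus>\<^bsub>M\<^esub> x" using b Bc xy by (simp add: M.a_assoc[symmetric] M.l_neg)
        then have "u = c \<oplus>\<^bsub>M\<^esub> ((\<ominus>\<^bsub>M\<^esub> b) \<oplus>\<^bsub>M\<^esub> x)" using c by simp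
        also have "\<dots> = (c \<oplus>\<^bsub>M\<^esub> (\<ominus>\<^bsub>M\<^esub> b)) \<oplus>\<^bsub>M\<^esub> x" using b c Bc xy by (simp add: M.a_assoc)
        finally show "u \<in> B +>\<^bsub>M\<^esub> x" using cosetI Badd Bneg b c by simp
      qed
    qed
  qed
  show add: "(B +>\<^bsub>M\<^esub> x) \<oplus>\<^bsub>?Q\<^esub> (B +>\<^bsub>M\<^esub> y) = B +>\<^bsub>M\<^esub> (x \<oplus>\<^bsub>M\<^esub> y)"
    if xy: "x \<in> carrier M" "y \<in> carrier M" for x y
  proof -
    have "(B +>\<^bsub>M\<^esub> x) <+>\<^bsub>M\<^esub> (B +>\<^bsub>M\<^esub> y) = B +>\<^bsub>M\<^esub> (x \<oplus>\<^bsub>M\<^esub> y)"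
    proof
      show "(B +>\<^bsub>M\<^esub> x) <+>\<^bsub>M\<^esub> (B +>\<^bsub>M\<^esub> y) \<subseteq> B +>\<^bsub>M\<^esub> (x \<oplus>\<^bsub>M\<^esub> y)"
      proof
        fix u assume "u \<in> (B +>\<^bsub>M\<^esub> x) <+>\<^bsub>M\<^esub> (B +>\<^bsub>M\<^esub> y)"
        then obtain b c where bc: "b \<in> B" "c \<in> B" "u = (b \<oplus>\<^bsub>M\<^esub> x) \<oplus>\<^bsub>M\<^esub> (c \<oplus>\<^bsub>M\<^esub> y)"
          unfolding set_add_def' coset by auto
        have "u = (b \<oplus>\<^bsub>M\<^esub> c) \<oplus>\<^bsub>M\<^esub> (x \<oplus>\<^bsub>M\<^esub> y)" using bc Bc xy by (simp add: M.a_ac)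
        then show "u \<in> B +>\<^bsub>M\<^esub> (x \<oplus>\<^bsub>M\<^esub> y)" using cosetI Badd bc by simp
      qed
      show "B +>\<^bsub>M\<^esub> (x \<oplus>\<^bsub>M\<^esub> y) \<subseteq> (B +>\<^bsub>M\<^esub> x) <+>\<^bsub>M\<^esub> (B +>\<^bsub>M\<^esub> y)"
      proof
        fix u assume "u \<in> B +>\<^bsub>M\<^esub> (x \<oplus>\<^bsub>M\<^esub> y)"
        then obtain b where b: "b \<in> B" "u = b \<oplus>\<^bsub>M\<^esub> (x \<oplus>\<^bsub>M\<^esub> y)" by (auto simp: coset)
        have "u = (b \<oplus>\<^bsub>M\<^esub> x) \<oplus>\<^bsub>M\<^esub> (\<zero>\<^bsub>M\<^esub> \<oplus>\<^bsub>M\<^esub> y)" using b Bc xy by (simp add: M.a_assoc)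
        then show "u \<in> (B +>\<^bsub>M\<^esub> x) <+>\<^bsub>M\<^esub> (B +>\<^bsub>M\<^esub> y)"
          unfolding set_add_def' using cosetI[OF b(1), of x] cosetI[OF B0, of y] by blast
      qed
    qed
    then show ?thesis by (simp add: quotient_module_def)
  qed
  show smult: "a \<odot>\<^bsub>?Q\<^esub> (B +>\<^bsub>M\<^esub> x) = B +>\<^bsub>M\<^esub> (a \<odot>\<^bsub>M\<^esub> x)"
    if a: "a \<in> carrier R" and x: "x \<in> carrier M" for a x
  proof -
    have "B <+>\<^bsub>M\<^esub> ((\<lambda>x. a \<odot>\<^bsub>M\<^esub> x) ` (B +>\<^bsub>M\<^esub> x)) = B +>\<^bsub>M\<^esub> (a \<odot>\<^bsub>M\<^esub> x)"
    proof
      show "B <+>\<^bsub>M\<^esub> ((\<lambda>x. a \<odot>\<^bsub>M\<^esub> x) ` (B +>\<^bsub>M\<^esub> x)) \<subseteq> B +>\<^bsub>M\<^esub> (a \<odot>\<^bsub>M\<^esub> x)"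
      proof
        fix u assume "u \<in> B <+>\<^bsub>M\<^esub> ((\<lambda>x. a \<odot>\<^bsub>M\<^esub> x) ` (B +>\<^bsub>M\<^esub> x))"
        then obtain b c where bc: "b \<in> B" "c \<in> B" "u = b \<oplus>\<^bsub>M\<^esub> (a \<odot>\<^bsub>M\<^esub> (c \<oplus>\<^bsub>M\<^esub> x))"
          unfolding set_add_def' coset by auto
        have "u = (b \<oplus>\<^bsub>M\<^esub> a \<odot>\<^bsub>M\<^esub> c) \<oplus>\<^bsub>M\<^esub> a \<odot>\<^bsub>M\<^esub> x" using bc Bc x a
          by (simp add: M.smult_r_distr M.a_assoc)
        then show "u \<in> B +>\<^bsub>M\<^esub> (a \<odot>\<^bsub>M\<^esub> x)" using cosetI Badd Bsmult a bc by simp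
      qed
      show "B +>\<^bsub>M\<^esub> (a \<odot>\<^bsub>M\<^esub> x) \<subseteq> B <+>\<^bsub>M\<^esub> ((\<lambda>x. a \<odot>\<^bsub>M\<^esub> x) ` (B +>\<^bsub>M\<^esub> x))"
      proof
        fix u assume "u \<in> B +>\<^bsub>M\<^esub> (a \<odot>\<^bsub>M\<^esub> x)"
        then obtain b where b: "b \<in> B" "u = b \<oplus>\<^bsub>M\<^esub> (a \<odot>\<^bsub>M\<^esub> x)" by (auto simp: coset)
        have "x \<in> B +>\<^bsub>M\<^esub> x" using cosetI[OF B0, of x] x by simp
        then show "u \<in> B <+>\<^bsub>M\<^esub> ((\<lambda>x. a \<odot>\<^bsub>M\<^esub> x) ` (B +>\<^bsub>M\<^esub> x))"
          unfolding set_add_def' using b by blast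
      qed
    qed
    then show ?thesis by (simp add: quotient_module_def)
  qed
  have zero: "\<zero>\<^bsub>?Q\<^esub> = B +>\<^bsub>M\<^esub> \<zero>\<^bsub>M\<^esub>"
  proof -
    have "B +>\<^bsub>M\<^esub> \<zero>\<^bsub>M\<^esub> = B"
    proof -
      have "B +>\<^bsub>M\<^esub> \<zero>\<^bsub>M\<^esub> = (\<lambda>b. b \<oplus>\<^bsub>M\<^esub> \<zero>\<^bsub>M\<^esub>) ` B" by (auto simp: coset)
      also have "\<dots> = (\<lambda>b. b) ` B" using Bc by (intro image_cong) simp_all
      finally show ?thesis by simp
    qed
    then show ?thesis by (simp add: quotient_module_def)
  qed
  show "module R ?Q"
  proof (rule module_criteria)
    show "cring R" by (rule module.axioms(1)[OF M])
    show "\<forall>v\<in>carrier ?Q. \<exists>neg_v\<in>carrier ?Q. v \<oplus>\<^bsub>?Q\<^esub> neg_v = \<zero>\<^bsub>?Q\<^esub>"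
      unfolding quotient_module_carrier zero
    proof clarify
      fix x assume x: "x \<in> carrier M"
      show "\<exists>neg_v\<in>(\<lambda>x. B +>\<^bsub>M\<^esub> x) ` carrier M. (B +>\<^bsub>M\<^esub> x) \<oplus>\<^bsub>?Q\<^esub> neg_v = B +>\<^bsub>M\<^esub> \<zero>\<^bsub>M\<^esub>"
        by (rule bexI[of _ "B +>\<^bsub>M\<^esub> (\<ominus>\<^bsub>M\<^esub> x)"]) (use x in \<open>auto simp: add M.r_neg\<close>)
    qed
  qed (auto simp: quotient_module_carrier zero add smult M.a_ac M.smult_assoc1 M.smult_l_distr M.smult_r_distr)
qed

lemma module_bar_chains:
  assumes p: "prime p"
  shows "module (residue_ring (int p)) (bar_chains p G n)"
proof -
  have p1: "int p > 1" using prime_gt_1_nat[OF p] by simp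
  interpret F: field "residue_ring (int p)" by (rule field_residue_ring[OF p])
  have add: "(\<lambda>gs. (c gs + d gs) mod int p) \<in> carrier (bar_chains p G n)"
    if c: "c \<in> carrier (bar_chains p G n)" and d: "d \<in> carrier (bar_chains p G n)" for c d
  proof -
    have z: "c gs \<noteq> 0 \<or> d gs \<noteq> 0" if "(c gs + d gs) mod int p \<noteq> 0" for gs using that by auto
    have "finite {gs. (c gs + d gs) mod int p \<noteq> 0}"
      by (rule finite_subset[of _ "{gs. c gs \<noteq> 0} \<union> {gs. d gs \<noteq> 0}"]) (use c d in \<open>auto simp: bar_chains_def\<close>)
    then show ?thesis using c d z p1 by (auto simp: bar_chains_def) blast+
  qed
  have sm: "(\<lambda>gs. (a * c gs) mod int p) \<in> carrier (bar_chains p G n)"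
    if c: "c \<in> carrier (bar_chains p G n)" for a c
  proof -
    have z: "c gs \<noteq> 0" if "(a * c gs) mod int p \<noteq> 0" for gs using that by auto
    have "finite {gs. (a * c gs) mod int p \<noteq> 0}"
      by (rule finite_subset[of _ "{gs. c gs \<noteq> 0}"]) (use c in \<open>auto simp: bar_chains_def\<close>)
    then show ?thesis using c z p1 by (auto simp: bar_chains_def)
  qed
  have rng: "c gs mod int p = c gs" if "c \<in> carrier (bar_chains p G n)" for c gs
  proof -
    have "0 \<le> c gs \<and> c gs \<le> int p - 1" using that by (simp add: bar_chains_def)
    then show ?thesis by simp
  qed
  have simps: "c \<oplus>\<^bsub>bar_chains p G n\<^esub> d = (\<lambda>gs. (c gs + d gs) mod int p)"
    "a \<odot>\<^bsub>bar_chains p G n\<^esub> c = (\<lambda>gs. (a * c gs) mod int p)"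
    "\<zero>\<^bsub>bar_chains p G n\<^esub> = (\<lambda>_. 0)" for c d a
    by (auto simp: bar_chains_def)
  show ?thesis
  proof (rule module_criteria)
    show "cring (residue_ring (int p))" by (rule F.is_cring)
    show "\<forall>v\<in>carrier (bar_chains p G n). \<exists>w\<in>carrier (bar_chains p G n).
       v \<oplus>\<^bsub>bar_chains p G n\<^esub> w = \<zero>\<^bsub>bar_chains p G n\<^esub>"
    proof
      fix v assume v: "v \<in> carrier (bar_chains p G n)"
      show "\<exists>w\<in>carrier (bar_chains p G n). v \<oplus>\<^bsub>bar_chains p G n\<^esub> w = \<zero>\<^bsub>bar_chains p G n\<^esub>"
        by (rule bexI[OF _ sm[OF v, of "-1"]]) (auto simp: simps mod_simps)
    qed
    show "\<zero>\<^bsub>bar_chains p G n\<^esub> \<in> carrier (bar_chains p G n)"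
      using p1 by (simp add: bar_chains_def)
  qed (auto simp: simps add sm rng mod_simps algebra_simps)
qed

text \<open>Replaces the support of the chain by any finite set containing it. Two chains can then
  be expanded over a common index set even when their coefficients cancel.\<close>

lemma bar_boundary_eq_sum:
  assumes "finite S" "{gs. c gs \<noteq> 0} \<subseteq> S" "0 < n"
  shows "bar_boundary p G n c hs =
    (\<Sum>gs\<in>S. c gs * (\<Sum>i\<le>n. if bar_face G i gs = hs then (-1) ^ i else 0)) mod int p"
proof -
  have "(\<Sum>gs | c gs \<noteq> 0. \<Sum>i\<le>n. if bar_face G i gs = hs then (-1) ^ i * c gs else 0) =
    (\<Sum>gs | c gs \<noteq> 0. c gs * (\<Sum>i\<le>n. if bar_face G i gs = hs then (-1) ^ i else 0))"
    by (intro sum.cong refl) (auto simp: sum_distrib_left intro!: sum.cong)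
  also have "\<dots> = (\<Sum>gs\<in>S. c gs * (\<Sum>i\<le>n. if bar_face G i gs = hs then (-1) ^ i else 0))"
    by (rule sum.mono_neutral_left) (use assms in auto)
  finally show ?thesis using assms(3) by (simp add: bar_boundary_def)
qed

lemma two_chain_faces:
  "bar_face G 0 [g, h] = [h]" "bar_face G 1 [g, h] = [g \<otimes>\<^bsub>G\<^esub> h]" "bar_face G 2 [g, h] = [g]"
  by (simp_all add: bar_face_def)

lemma sum_upto_2: "(\<Sum>i\<le>2. f i) = f 0 + f 1 + f (2::nat)" for f :: "nat \<Rightarrow> int"
  by (simp add: numeral_2_eq_2)

context group
begin

text \<open>The two faces of a symbol of length 1 are both the empty symbol and occur with opposite
  signs. Hence every 1-chain is a cycle.\<close>

lemma bar_boundary_1: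
  assumes "c \<in> carrier (bar_chains p G 1)"
  shows "bar_boundary p G 1 c = (\<lambda>_. 0)"
proof
  fix hs
  have "(\<Sum>i\<le>1. if bar_face G i gs = hs then (-1) ^ i * c gs else 0) = 0" if "c gs \<noteq> 0" for gs
  proof -
    have "length gs = 1" using assms that by (simp add: bar_chains_def)
    then obtain g where "gs = [g]" by (cases gs) auto
    then show ?thesis by (simp add: bar_face_def)
  qed
  then show "bar_boundary p G 1 c hs = 0" unfolding bar_boundary_def by simp
qed

lemma two_chainE:
  assumes "c \<in> carrier (bar_chains p G 2)" "c gs \<noteq> 0"
  obtains g h where "g \<in> carrier G" "h \<in> carrier G" "gs = [g, h]"
proof -
  have l: "length gs = 2" "set gs \<subseteq> carrier G" using assms by (auto simp: bar_chains_def)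
  then obtain g h where "gs = [g, h]" by (auto simp: numeral_2_eq_2 length_Suc_conv)
  then show ?thesis using that[of g h] l by simp
qed

lemma bar_boundary_2_closed:
  assumes p: "prime p" and c: "c \<in> carrier (bar_chains p G 2)"
  shows "bar_boundary p G 2 c \<in> carrier (bar_chains p G 1)"
proof -
  have p0: "0 < p" using prime_gt_0_nat[OF p] .
  have fin: "finite {gs. c gs \<noteq> 0}" using c by (simp add: bar_chains_def)
  have ex: "\<exists>gs i. c gs \<noteq> 0 \<and> i \<le> 2 \<and> bar_face G i gs = hs" if "bar_boundary p G 2 c hs \<noteq> 0" for hs
  proof (rule ccontr)
    assume "\<not> ?thesis"
    then have "(\<Sum>gs | c gs \<noteq> 0. \<Sum>i\<le>2. if bar_face G i gs = hs then (-1) ^ i * c gs else 0) = 0"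
      by (intro sum.neutral) auto
    then show False using that unfolding bar_boundary_def by simp
  qed
  have "{hs. bar_boundary p G 2 c hs \<noteq> 0} \<subseteq> (\<lambda>(gs, i). bar_face G i gs) ` ({gs. c gs \<noteq> 0} \<times> {..2})"
    using ex by force
  then have f: "finite {hs. bar_boundary p G 2 c hs \<noteq> 0}"
    by (rule finite_subset) (use fin in simp)
  have s: "length hs = 1 \<and> set hs \<subseteq> carrier G" if h: "bar_boundary p G 2 c hs \<noteq> 0" for hs
  proof -
    obtain gs i where gi: "c gs \<noteq> 0" "i \<le> 2" "bar_face G i gs = hs" using ex[OF h] by blast
    obtain g k where gk: "g \<in> carrier G" "k \<in> carrier G" "gs = [g, k]" by (rule two_chainE[OF c gi(1)])
    have "i = 0 \<or> i = 1 \<or> i = 2" using gi(2) by auto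
    then show ?thesis using gi(3) gk two_chain_faces[of G g k] by auto
  qed
  have "0 \<le> bar_boundary p G 2 c hs \<and> bar_boundary p G 2 c hs \<le> int p - 1" for hs
    using p0 pos_mod_bound[of "int p"] by (simp add: bar_boundary_def)
  then show ?thesis using f s by (auto simp: bar_chains_def)
qed

definition boundaries :: "nat \<Rightarrow> ('a list \<Rightarrow> int) set" where
  "boundaries p = bar_boundary p G 2 ` carrier (bar_chains p G 2)"

text \<open>The boundary map is linear modulo \<open>p\<close>. Its coefficients depend only on the
  symbols, so linearity is that of a finite sum over the union of the supports.\<close>

lemma submodule_boundaries:
  assumes p: "prime p"
  shows "LinearCombinations.submodule (residue_ring (int p)) (boundaries p) (bar_chains p G 1)"
proof (rule LinearCombinations.submodule.intro)
  interpret C2: module "residue_ring (int p)" "bar_chains p G 2" by (rule module_bar_chains[OF p])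
  show "module (residue_ring (int p)) (bar_chains p G 1)" by (rule module_bar_chains[OF p])
  show "boundaries p \<subseteq> carrier (bar_chains p G 1)"
    unfolding boundaries_def using bar_boundary_2_closed[OF p] by blast
  have "bar_boundary p G 2 (\<lambda>_. 0) = (\<lambda>_. 0)" by (simp add: bar_boundary_def)
  then show "\<zero>\<^bsub>bar_chains p G 1\<^esub> \<in> boundaries p"
    unfolding boundaries_def using C2.M.zero_closed by (auto simp: bar_chains_def intro!: image_eqI[of _ _ "\<lambda>_. 0"])
  show "v \<oplus>\<^bsub>bar_chains p G 1\<^esub> w \<in> boundaries p" if "v \<in> boundaries p" "w \<in> boundaries p" for v w
  proof -
    from that obtain c d where c: "c \<in> carrier (bar_chains p G 2)" "v = bar_boundary p G 2 c"
      and d: "d \<in> carrier (bar_chains p G 2)" "w = bar_boundary p G 2 d" by (auto simp: boundaries_def)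
    let ?e = "c \<oplus>\<^bsub>bar_chains p G 2\<^esub> d"
    have e: "?e = (\<lambda>gs. (c gs + d gs) mod int p)" by (simp add: bar_chains_def)
    let ?S = "{gs. c gs \<noteq> 0} \<union> {gs. d gs \<noteq> 0}"
    have S: "finite ?S" using c d by (auto simp: bar_chains_def)
    have "bar_boundary p G 2 ?e hs = (v hs + w hs) mod int p" for hs
    proof -
      let ?w = "\<lambda>gs. \<Sum>i\<le>2. if bar_face G i gs = hs then (-1) ^ i else (0::int)"
      have "bar_boundary p G 2 ?e hs = (\<Sum>gs\<in>?S. ((c gs + d gs) mod int p) * ?w gs) mod int p"
        unfolding e by (rule bar_boundary_eq_sum[OF S]) auto
      also have "\<dots> = (\<Sum>gs\<in>?S. (c gs + d gs) * ?w gs) mod int p"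
        unfolding cong_def[symmetric] by (intro cong_sum cong_mult cong_refl) (simp add: cong_def)
      also have "\<dots> = ((\<Sum>gs\<in>?S. c gs * ?w gs) mod int p + (\<Sum>gs\<in>?S. d gs * ?w gs) mod int p) mod int p"
        by (simp add: mod_simps sum.distrib distrib_right)
      also have "(\<Sum>gs\<in>?S. c gs * ?w gs) mod int p = v hs"
        unfolding c by (rule bar_boundary_eq_sum[OF S, symmetric]) auto
      also have "(\<Sum>gs\<in>?S. d gs * ?w gs) mod int p = w hs"
        unfolding d by (rule bar_boundary_eq_sum[OF S, symmetric]) auto
      finally show ?thesis .
    qed
    then have "v \<oplus>\<^bsub>bar_chains p G 1\<^esub> w = bar_boundary p G 2 ?e"
      by (auto simp: bar_chains_def)
    then show ?thesis unfolding boundaries_def using C2.M.a_closed[OF c(1) d(1)] by blast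
  qed
  show "a \<odot>\<^bsub>bar_chains p G 1\<^esub> v \<in> boundaries p"
    if a: "a \<in> carrier (residue_ring (int p))" and "v \<in> boundaries p" for a v
  proof -
    from that obtain c where c: "c \<in> carrier (bar_chains p G 2)" "v = bar_boundary p G 2 c"
      by (auto simp: boundaries_def)
    let ?e = "a \<odot>\<^bsub>bar_chains p G 2\<^esub> c"
    have e: "?e = (\<lambda>gs. (a * c gs) mod int p)" by (simp add: bar_chains_def)
    let ?S = "{gs. c gs \<noteq> 0}"
    have S: "finite ?S" using c by (auto simp: bar_chains_def)
    have "bar_boundary p G 2 ?e hs = (a * v hs) mod int p" for hs
    proof -
      let ?w = "\<lambda>gs. \<Sum>i\<le>2. if bar_face G i gs = hs then (-1) ^ i else (0::int)"
      have "bar_boundary p G 2 ?e hs = (\<Sum>gs\<in>?S. ((a * c gs) mod int p) * ?w gs) mod int p"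
        unfolding e by (rule bar_boundary_eq_sum[OF S]) auto
      also have "\<dots> = (\<Sum>gs\<in>?S. (a * c gs) * ?w gs) mod int p"
        unfolding cong_def[symmetric] by (intro cong_sum cong_mult cong_refl) (simp add: cong_def)
      also have "\<dots> = (a * ((\<Sum>gs\<in>?S. c gs * ?w gs) mod int p)) mod int p"
        by (simp add: mod_simps sum_distrib_left mult.assoc)
      also have "(\<Sum>gs\<in>?S. c gs * ?w gs) mod int p = v hs"
        unfolding c by (rule bar_boundary_eq_sum[OF S, symmetric]) auto
      finally show ?thesis .
    qed
    then have "a \<odot>\<^bsub>bar_chains p G 1\<^esub> v = bar_boundary p G 2 ?e"
      by (auto simp: bar_chains_def)
    then show ?thesis unfolding boundaries_def using C2.smult_closed[OF a c(1)] by blast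
  qed
qed

lemma group_homology_eq: "group_homology p G 1 = quotient_module (bar_chains p G 1) (boundaries p)"
proof -
  have "{c \<in> carrier (bar_chains p G 1). bar_boundary p G 1 c = (\<lambda>_. 0)} = carrier (bar_chains p G 1)"
    using bar_boundary_1 by auto
  then show ?thesis by (simp add: group_homology_def boundaries_def numeral_2_eq_2)
qed

section \<open>Homology classes of group elements and their pairing with homomorphisms\<close>

definition mono_chain :: "nat \<Rightarrow> 'a \<Rightarrow> int \<Rightarrow> 'a list \<Rightarrow> int" where
  "mono_chain p g k = (\<lambda>gs. if gs = [g] then k mod int p else 0)"

text \<open>The canonical map from \<open>G\<close> to its first homology, which is the
  abelianisation modulo \<open>p\<close>.\<close>

definition homology_class :: "nat \<Rightarrow> 'a \<Rightarrow> ('a list \<Rightarrow> int) set" where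
  "homology_class p g = boundaries p +>\<^bsub>bar_chains p G 1\<^esub> mono_chain p g 1"

text \<open>The pairing of a 1-chain with a homomorphism, kept as an integer and compared only
  modulo \<open>p\<close>. On 1-chains the nonzero coefficients sit on lists of length 1, so
  \<open>hd\<close> picks out the group element.\<close>

definition chain_eval :: "('a \<Rightarrow> int) \<Rightarrow> ('a list \<Rightarrow> int) \<Rightarrow> int" where
  "chain_eval \<phi> c = (\<Sum>gs | c gs \<noteq> 0. c gs * \<phi> (hd gs))"

lemma chain_eval_eq_sum:
  assumes "finite S" "{gs. c gs \<noteq> 0} \<subseteq> S"
  shows "chain_eval \<phi> c = (\<Sum>gs\<in>S. c gs * \<phi> (hd gs))"
  unfolding chain_eval_def by (rule sum.mono_neutral_left) (use assms in auto)

lemma mono_chain_closed: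
  assumes p: "prime p" and g: "g \<in> carrier G"
  shows "mono_chain p g k \<in> carrier (bar_chains p G 1)"
proof -
  have "finite {gs. mono_chain p g k gs \<noteq> 0}"
    by (rule finite_subset[of _ "{[g]}"]) (auto simp: mono_chain_def)
  moreover have "0 \<le> k mod int p \<and> k mod int p \<le> int p - 1"
    using prime_gt_0_nat[OF p] pos_mod_bound[of "int p" k] by simp
  moreover have "0 \<le> int p - 1" using prime_gt_0_nat[OF p] by simp
  ultimately show ?thesis using g
    by (auto simp: bar_chains_def mono_chain_def)
qed

text \<open>The boundary of [g|h] is [h] - [gh] + [g], on which a homomorphism takes the value 0
  modulo \<open>p\<close>.\<close>

lemma chain_eval_boundary:
  assumes p: "prime p" and \<phi>: "\<phi> \<in> mod_homs p G" and b: "b \<in> boundaries p"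
  shows "[chain_eval \<phi> b = 0] (mod int p)"
proof -
  obtain c where c: "c \<in> carrier (bar_chains p G 2)" "b = bar_boundary p G 2 c"
    using b by (auto simp: boundaries_def)
  let ?S = "{gs. c gs \<noteq> 0}"
  have S: "finite ?S" using c by (simp add: bar_chains_def)
  \<comment> \<open>One finite set containing the support of the boundary and all faces of the
    chain, so that the two sums can be exchanged without losing a face that cancels.\<close>
  define T where "T = {hs. b hs \<noteq> 0} \<union> (\<lambda>(gs, i). bar_face G i gs) ` (?S \<times> {..2})"
  have bC: "b \<in> carrier (bar_chains p G 1)" unfolding c by (rule bar_boundary_2_closed[OF p c(1)])
  have T: "finite T" using bC S by (simp add: T_def bar_chains_def)
  let ?w = "\<lambda>gs hs. \<Sum>i\<le>2. if bar_face G i gs = hs then (-1) ^ i else (0::int)"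
  have inner: "[(\<Sum>hs\<in>T. ?w gs hs * \<phi> (hd hs)) = 0] (mod int p)" if gs: "gs \<in> ?S" for gs
  proof -
    obtain g h where gh: "g \<in> carrier G" "h \<in> carrier G" "gs = [g, h]"
      using two_chainE[OF c(1)] gs by blast
    have "(\<Sum>hs\<in>T. ?w gs hs * \<phi> (hd hs)) = (\<Sum>hs\<in>T. \<Sum>i\<le>2. if bar_face G i gs = hs then (-1) ^ i * \<phi> (hd hs) else 0)"
      by (intro sum.cong refl) (auto simp: sum_distrib_right intro!: sum.cong)
    also have "\<dots> = (\<Sum>i\<le>2. \<Sum>hs\<in>T. if bar_face G i gs = hs then (-1) ^ i * \<phi> (hd hs) else 0)"
      by (rule sum.swap)
    also have "\<dots> = (\<Sum>i\<le>2. (-1) ^ i * \<phi> (hd (bar_face G i gs)))"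
    proof (intro sum.cong refl)
      fix i :: nat assume "i \<in> {..2}"
      then have "bar_face G i gs \<in> T" using gs by (force simp: T_def)
      then show "(\<Sum>hs\<in>T. if bar_face G i gs = hs then (-1) ^ i * \<phi> (hd hs) else 0) =
          (-1) ^ i * \<phi> (hd (bar_face G i gs))" using T by (simp add: sum.delta')
    qed
    also have "\<dots> = \<phi> h - \<phi> (g \<otimes> h) + \<phi> g"
      unfolding sum_upto_2 gh(3) two_chain_faces by simp
    also have "[\<dots> = 0] (mod int p)"
    proof -
      have "[\<phi> h - (\<phi> g + \<phi> h) mod int p + \<phi> g = \<phi> h - (\<phi> g + \<phi> h) + \<phi> g] (mod int p)"
        by (intro cong_add cong_diff cong_refl) (simp add: cong_def)
      then show ?thesis unfolding mod_homs_mult[OF \<phi> gh(1,2)] by simp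
    qed
    finally show ?thesis .
  qed
  have "chain_eval \<phi> b = (\<Sum>hs\<in>T. b hs * \<phi> (hd hs))"
    by (rule chain_eval_eq_sum[OF T]) (simp add: T_def)
  also have "[\<dots> = (\<Sum>hs\<in>T. (\<Sum>gs\<in>?S. c gs * ?w gs hs) * \<phi> (hd hs))] (mod int p)"
    unfolding c(2) by (intro cong_sum cong_mult cong_refl) (simp add: bar_boundary_eq_sum[OF S] cong_def)
  also have "(\<Sum>hs\<in>T. (\<Sum>gs\<in>?S. c gs * ?w gs hs) * \<phi> (hd hs)) =
      (\<Sum>gs\<in>?S. c gs * (\<Sum>hs\<in>T. ?w gs hs * \<phi> (hd hs)))"
    unfolding sum_distrib_left sum_distrib_right by (subst sum.swap) (simp add: mult_ac)
  also have "[\<dots> = (\<Sum>gs\<in>?S. c gs * 0)] (mod int p)"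
    by (intro cong_sum cong_mult cong_refl inner)
  finally show ?thesis by simp
qed

text \<open>The facts that identify Hom(G, Z/p) with the dual of the first homology:
  \<open>homology_class\<close> is a surjective homomorphism, scalar multiples of classes are
  classes of powers, and every homomorphism to Z/p factors through it. Surjectivity holds because a
  chain can be gathered into the class of a single product of group elements.\<close>

lemma homology_class_props:
  assumes p: "prime p"
  defines "V \<equiv> group_homology p G 1"
  shows "vectorspace (residue_ring (int p)) V"
    and "homology_class p ` carrier G = carrier V"
    and "\<And>g h. g \<in> carrier G \<Longrightarrow> h \<in> carrier G \<Longrightarrow>
      homology_class p (g \<otimes> h) = homology_class p g \<oplus>\<^bsub>V\<^esub> homology_class p h"
    and "\<And>g k. g \<in> carrier G \<Longrightarrow> int k < int p \<Longrightarrow>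
      int k \<odot>\<^bsub>V\<^esub> homology_class p g = homology_class p (g [^] k)"
    and "\<And>\<phi> g h. \<phi> \<in> mod_homs p G \<Longrightarrow> g \<in> carrier G \<Longrightarrow> h \<in> carrier G \<Longrightarrow>
      homology_class p g = homology_class p h \<Longrightarrow> \<phi> g = \<phi> h"
proof -
  have p1: "int p > 1" using prime_gt_1_nat[OF p] by simp
  let ?C = "bar_chains p G 1" and ?B = "boundaries p" and ?K = "residue_ring (int p)"
  note M = module_bar_chains[OF p, of G 1] and B = submodule_boundaries[OF p]
  interpret M: module ?K ?C by (rule M)
  have Vq: "V = quotient_module ?C ?B" unfolding V_def by (rule group_homology_eq)
  note q = quotient_module[OF M B, folded Vq]
  show vs: "vectorspace ?K V" using q(1) field_residue_ring[OF p] by (simp add: vectorspace_def)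
  interpret V: vectorspace ?K V by (rule vs)
  have carV: "carrier V = (\<lambda>x. ?B +>\<^bsub>?C\<^esub> x) ` carrier ?C" unfolding Vq by (rule quotient_module_carrier)
  let ?g = "homology_class p"
  have mc: "mono_chain p g k \<in> carrier ?C" if "g \<in> carrier G" for g k using mono_chain_closed[OF p that] .
  have gV: "?g g \<in> carrier V" if "g \<in> carrier G" for g
    unfolding homology_class_def carV using mc[OF that] by blast
  show hom: "?g (g \<otimes> h) = ?g g \<oplus>\<^bsub>V\<^esub> ?g h" if gh: "g \<in> carrier G" "h \<in> carrier G" for g h
  proof -
    \<comment> \<open>The boundary of the symbol [g|h] is exactly the discrepancy between [g] + [h]
      and [gh].\<close>
    let ?c = "\<lambda>gs. if gs = [g, h] then 1 else 0 :: int"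
    have c: "?c \<in> carrier (bar_chains p G 2)"
      using gh p1 by (auto simp: bar_chains_def)
    have b: "bar_boundary p G 2 ?c \<in> ?B" using c by (simp add: boundaries_def)
    have bb: "bar_boundary p G 2 ?c hs =
        ((if [h] = hs then 1 else 0) - (if [g \<otimes> h] = hs then 1 else 0) + (if [g] = hs then 1 else 0)) mod int p" for hs
    proof -
      have "bar_boundary p G 2 ?c hs =
        (\<Sum>gs\<in>{[g, h]}. ?c gs * (\<Sum>i\<le>2. if bar_face G i gs = hs then (-1) ^ i else 0)) mod int p"
        by (rule bar_boundary_eq_sum) auto
      also have "(\<Sum>gs\<in>{[g, h]}. ?c gs * (\<Sum>i\<le>2. if bar_face G i gs = hs then (-1) ^ i else 0)) =
        (\<Sum>i\<le>2. if bar_face G i [g, h] = hs then (-1) ^ i else 0)" by simp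
      also have "\<dots> = (if [h] = hs then 1 else 0) - (if [g \<otimes> h] = hs then 1 else 0) + (if [g] = hs then 1 else 0)"
        unfolding sum_upto_2 two_chain_faces by simp
      finally show ?thesis .
    qed
    have e: "mono_chain p g 1 \<oplus>\<^bsub>?C\<^esub> mono_chain p h 1 = bar_boundary p G 2 ?c \<oplus>\<^bsub>?C\<^esub> mono_chain p (g \<otimes> h) 1"
    proof
      fix hs
      have "(mono_chain p g 1 \<oplus>\<^bsub>?C\<^esub> mono_chain p h 1) hs = ((if [g] = hs then 1 else 0) + (if [h] = hs then 1 else 0)) mod int p"
        using p1 by (simp add: bar_chains_def mono_chain_def)
      moreover have "(bar_boundary p G 2 ?c \<oplus>\<^bsub>?C\<^esub> mono_chain p (g \<otimes> h) 1) hs =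
        (((if [h] = hs then 1 else 0) - (if [g \<otimes> h] = hs then 1 else 0) + (if [g] = hs then 1 else 0)) mod int p
          + (if [g \<otimes> h] = hs then 1 else 0)) mod int p"
        unfolding bar_chains_def mono_chain_def using p1 bb[of hs] by simp
      ultimately show "(mono_chain p g 1 \<oplus>\<^bsub>?C\<^esub> mono_chain p h 1) hs = (bar_boundary p G 2 ?c \<oplus>\<^bsub>?C\<^esub> mono_chain p (g \<otimes> h) 1) hs"
        by (simp only: mod_add_left_eq) (simp add: algebra_simps)
    qed
    have "?g g \<oplus>\<^bsub>V\<^esub> ?g h = ?B +>\<^bsub>?C\<^esub> (mono_chain p g 1 \<oplus>\<^bsub>?C\<^esub> mono_chain p h 1)"
      unfolding homology_class_def using mc gh by (intro q(2)) auto
    also have "\<dots> = ?B +>\<^bsub>?C\<^esub> mono_chain p (g \<otimes> h) 1"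
    proof -
      have "mono_chain p g 1 \<oplus>\<^bsub>?C\<^esub> mono_chain p h 1 \<in> carrier ?C"
        by (rule M.a_closed[OF mc[OF gh(1)] mc[OF gh(2)]])
      from q(4)[OF this mc[OF m_closed[OF gh]], of 1] e b show ?thesis by blast
    qed
    finally show ?thesis by (simp add: homology_class_def)
  qed
  have g1: "?g \<one> = \<zero>\<^bsub>V\<^esub>" using hom[of \<one> \<one>] gV[of \<one>] by simp
  have class_mono: "?B +>\<^bsub>?C\<^esub> mono_chain p g (int k) = ?g (g [^] k)" if g: "g \<in> carrier G" for g and k :: nat
  proof (induction k)
    case 0
    have z: "mono_chain p g (int 0) = \<zero>\<^bsub>?C\<^esub>" by (auto simp: mono_chain_def bar_chains_def)
    have "(?B +>\<^bsub>?C\<^esub> \<zero>\<^bsub>?C\<^esub>) \<oplus>\<^bsub>V\<^esub> (?B +>\<^bsub>?C\<^esub> \<zero>\<^bsub>?C\<^esub>) = ?B +>\<^bsub>?C\<^esub> \<zero>\<^bsub>?C\<^esub>"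
      using q(2)[OF M.zero_closed M.zero_closed] M.l_zero[OF M.zero_closed] by (simp only:)
    moreover have "?B +>\<^bsub>?C\<^esub> \<zero>\<^bsub>?C\<^esub> \<in> carrier V" unfolding carV by blast
    ultimately have "?B +>\<^bsub>?C\<^esub> \<zero>\<^bsub>?C\<^esub> = \<zero>\<^bsub>V\<^esub>" by simp
    then show ?case using g1 unfolding z by simp
  next
    case (Suc k)
    have "mono_chain p g (int (Suc k)) = mono_chain p g (int k) \<oplus>\<^bsub>?C\<^esub> mono_chain p g 1"
      by (auto simp: mono_chain_def bar_chains_def mod_simps add.commute)
    then have "?B +>\<^bsub>?C\<^esub> mono_chain p g (int (Suc k)) = (?B +>\<^bsub>?C\<^esub> mono_chain p g (int k)) \<oplus>\<^bsub>V\<^esub> ?g g"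
      using q(2)[of "mono_chain p g (int k)" "mono_chain p g 1"] mc[OF g] by (simp add: homology_class_def)
    also have "\<dots> = ?g (g [^] k) \<oplus>\<^bsub>V\<^esub> ?g g" unfolding Suc ..
    also have "\<dots> = ?g (g [^] Suc k)" using hom[of "g [^] k" g] g by simp
    finally show ?case .
  qed
  show "int k \<odot>\<^bsub>V\<^esub> ?g g = ?g (g [^] k)" if g: "g \<in> carrier G" and k: "int k < int p" for g k
  proof -
    have "int k \<odot>\<^bsub>?C\<^esub> mono_chain p g 1 = mono_chain p g (int k)"
      using p1 by (auto simp: mono_chain_def bar_chains_def)
    then show ?thesis
      using q(3)[of "int k" "mono_chain p g 1"] mc[OF g] k class_mono[OF g] by (simp add: homology_class_def)
  qed
  \<comment> \<open>Induction on a finite set containing the support: removing the symbol [g] with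
    coefficient k multiplies the representing element by the k-th power of g.\<close>
  have surj: "?B +>\<^bsub>?C\<^esub> c \<in> ?g ` carrier G" if "finite S" "c \<in> carrier ?C" "{gs. c gs \<noteq> 0} \<subseteq> S" for S c
    using that
  proof (induction arbitrary: c rule: finite_induct)
    case empty
    then have "c = \<zero>\<^bsub>?C\<^esub>" by (auto simp: bar_chains_def)
    moreover have "mono_chain p \<one> (int 0) = \<zero>\<^bsub>?C\<^esub>" by (auto simp: mono_chain_def bar_chains_def)
    ultimately have "?B +>\<^bsub>?C\<^esub> c = ?g (\<one> [^] (0::nat))" using class_mono[of \<one> 0] by simp
    then show ?case by simp
  next
    case (insert gs S)
    show ?case
    proof (cases "c gs = 0")
      case True
      then show ?thesis using insert by blast
    next
      case False
      then have "length gs = 1" "set gs \<subseteq> carrier G" using insert.prems(1) by (auto simp: bar_chains_def)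
      then obtain g where g: "gs = [g]" "g \<in> carrier G" by (cases gs) auto
      let ?d = "c(gs := 0)"
      have rng: "0 \<le> c hs \<and> c hs \<le> int p - 1" for hs using insert.prems(1) by (simp add: bar_chains_def)
      have d: "?d \<in> carrier ?C"
      proof -
        have "finite {hs. ?d hs \<noteq> 0}"
          by (rule finite_subset[of _ "{hs. c hs \<noteq> 0}"]) (use insert.prems(1) in \<open>auto simp: bar_chains_def\<close>)
        then show ?thesis using insert.prems(1) p1 by (auto simp: bar_chains_def)
      qed
      have "?B +>\<^bsub>?C\<^esub> ?d \<in> ?g ` carrier G" 
        by (rule insert.IH[OF d]) (use insert.prems(2) in auto)
      then obtain x where x: "x \<in> carrier G" "?B +>\<^bsub>?C\<^esub> ?d = ?g x" by blast
      have md: "c hs mod int p = c hs" for hs using rng[of hs] by simp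
      have "c = ?d \<oplus>\<^bsub>?C\<^esub> mono_chain p g (int (nat (c gs)))"
        using rng[of gs] md g by (auto simp: bar_chains_def mono_chain_def)
      then have "?B +>\<^bsub>?C\<^esub> c = ?g x \<oplus>\<^bsub>V\<^esub> ?g (g [^] nat (c gs))"
        using q(2)[OF d mc[OF g(2)], of "int (nat (c gs))"] x class_mono[OF g(2), of "nat (c gs)"] by simp
      also have "\<dots> = ?g (x \<otimes> g [^] nat (c gs))" using hom x g by (simp del: pow_nat)
      finally show ?thesis using x g by blast
    qed
  qed
  show "?g ` carrier G = carrier V"
  proof
    show "?g ` carrier G \<subseteq> carrier V" using gV by blast
    show "carrier V \<subseteq> ?g ` carrier G"
      unfolding carV using surj by (auto simp: bar_chains_def)
  qed
  show "\<phi> g = \<phi> h" if \<phi>: "\<phi> \<in> mod_homs p G" and gh: "g \<in> carrier G" "h \<in> carrier G" and e: "?g g = ?g h" for \<phi> g h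
  proof -
    obtain b where b: "b \<in> ?B" "mono_chain p g 1 = b \<oplus>\<^bsub>?C\<^esub> mono_chain p h 1"
      using e q(4)[OF mc[OF gh(1)] mc[OF gh(2)]] unfolding homology_class_def by blast
    have bC: "b \<in> carrier ?C" using b(1) LinearCombinations.submodule.subset[OF B] by blast
    define T where "T = insert [g] (insert [h] {hs. b hs \<noteq> 0})"
    have T: "finite T" using bC by (simp add: T_def bar_chains_def)
    have ev: "(\<Sum>hs\<in>T. mono_chain p x 1 hs * \<phi> (hd hs)) = \<phi> x" if "[x] \<in> T" for x
    proof -
      have "(\<Sum>hs\<in>T. mono_chain p x 1 hs * \<phi> (hd hs)) = (\<Sum>hs\<in>T. if hs = [x] then \<phi> x else 0)"
        using p1 by (intro sum.cong) (auto simp: mono_chain_def)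
      then show ?thesis using T that by simp
    qed
    have "\<phi> g = (\<Sum>hs\<in>T. ((b hs + mono_chain p h 1 hs) mod int p) * \<phi> (hd hs))"
      using ev[of g] fun_cong[OF b(2)] by (simp add: T_def bar_chains_def)
    also have "[\<dots> = (\<Sum>hs\<in>T. (b hs + mono_chain p h 1 hs) * \<phi> (hd hs))] (mod int p)"
      by (intro cong_sum cong_mult cong_refl) (simp add: cong_def)
    also have "(\<Sum>hs\<in>T. (b hs + mono_chain p h 1 hs) * \<phi> (hd hs)) = chain_eval \<phi> b + \<phi> h"
      using ev[of h] chain_eval_eq_sum[OF T, of b \<phi>] by (simp add: T_def distrib_right sum.distrib subset_insertI2)
    also have "[\<dots> = 0 + \<phi> h] (mod int p)" by (intro cong_add cong_refl chain_eval_boundary[OF p \<phi> b(1)])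
    finally show ?thesis using mod_homs_mod[OF \<phi> gh(1)] mod_homs_mod[OF \<phi> gh(2)] by (simp add: cong_def)
  qed
qed

end

section \<open>Homomorphisms to the integers mod \<open>p\<close> as linear functionals\<close>

context group
begin

text \<open>Finite generation makes the first homology finite dimensional, so \<open>dim\<close> is
  the size of a basis \<open>b\<close>. Evaluating a homomorphism at group elements representing the
  basis gives a bijection onto all functions from \<open>b\<close> to the residues.\<close>

lemma card_mod_homs_eq:
  assumes fg: "finitely_generated_group G" and p: "prime p"
  shows "card (mod_homs p G) = p ^ homology_dim p G"
proof -
  have p0: "0 < p" using prime_gt_0_nat[OF p] .
  define V where "V = group_homology p G 1"
  define \<gamma> where "\<gamma> = homology_class p"
  let ?K = "residue_ring (int p)"
  note props = homology_class_props[OF p, folded V_def \<gamma>_def]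
  interpret V: vectorspace ?K V by (rule props(1))
  have mV: "module ?K V" by (rule V.module_axioms)
  have \<gamma>: "\<gamma> g \<in> carrier V" if "g \<in> carrier G" for g using props(2) that by blast
  have \<gamma>1: "\<gamma> \<one> = \<zero>\<^bsub>V\<^esub>" using props(3)[of \<one> \<one>] \<gamma>[of \<one>] by simp
  have KC: "carrier ?K = {0..<int p}" by auto
  obtain S where S: "finite S" "S \<subseteq> carrier G" "generate G S = carrier G"
    using fg unfolding finitely_generated_group_def by blast
  have A: "\<gamma> ` S \<subseteq> carrier V" using S \<gamma> by blast
  have W: "LinearCombinations.submodule ?K (V.span (\<gamma> ` S)) V" by (rule V.span_is_submodule[OF A])
  have "\<gamma> x \<in> V.span (\<gamma> ` S)" if "x \<in> generate G S" for x
    using that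
  proof (induction rule: generate.induct)
    case one
    then show ?case using LinearCombinations.submodule.zero_closed[OF W] \<gamma>1 by simp
  next
    case (incl s)
    then show ?case using V.in_own_span[OF A] by blast
  next
    case (inv s)
    then have s: "s \<in> carrier G" using S by blast
    have "\<gamma> (inv s) \<oplus>\<^bsub>V\<^esub> \<gamma> s = \<zero>\<^bsub>V\<^esub>" using props(3)[of "inv s" s] s \<gamma>1 by simp
    then have "\<gamma> (inv s) = \<ominus>\<^bsub>V\<^esub> \<gamma> s" using s \<gamma> by (simp add: V.minus_equality)
    moreover have "\<gamma> s \<in> V.span (\<gamma> ` S)" using V.in_own_span[OF A] inv by blast
    ultimately show ?case using V.span_neg[OF A] by simp
  next
    case (eng x y)
    then have "x \<in> carrier G" "y \<in> carrier G" using S by auto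
    then show ?case using props(3)[of x y] LinearCombinations.submodule.m_closed[OF W eng.IH] by simp
  qed
  then have "\<gamma> ` carrier G \<subseteq> V.span (\<gamma> ` S)" unfolding S(3) by blast
  then have "carrier V \<subseteq> V.span (\<gamma> ` S)" unfolding props(2) .
  then have "V.span (\<gamma> ` S) = carrier V" using V.span_is_subset2[OF A] by blast
  then have "V.fin_dim" unfolding V.fin_dim_def using A S(1) by (intro exI[of _ "\<gamma> ` S"] conjI) auto
  from V.finite_basis_exists[OF this] obtain b where b: "finite b" "V.basis b" by blast
  have bV: "b \<subseteq> carrier V" and gen: "V.span b = carrier V" using b(2) unfolding V.basis_def by simp_all
  have dim: "homology_dim p G = card b"
    unfolding homology_dim_def V_def[symmetric] by (rule V.dim_basis[OF b])
  define rep where "rep v = (SOME g. g \<in> carrier G \<and> \<gamma> g = v)" for v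
  have rep: "rep v \<in> carrier G \<and> \<gamma> (rep v) = v" if "v \<in> carrier V" for v
    unfolding rep_def by (rule someI_ex) (use that[folded props(2)] in blast)
  have rep_eq: "\<phi> (rep (\<gamma> g)) = \<phi> g" if "\<phi> \<in> mod_homs p G" "g \<in> carrier G" for \<phi> g
    using props(5)[OF that(1), of "rep (\<gamma> g)" g] rep[OF \<gamma>[OF that(2)]] that(2) by simp
  define E where "E \<phi> = (\<lambda>v\<in>b. \<phi> (rep v))" for \<phi> :: "'a \<Rightarrow> int"
  have "bij_betw E (mod_homs p G) (b \<rightarrow>\<^sub>E {0..<int p})"
  proof (rule bij_betwI')
    fix \<phi> \<psi> assume h: "\<phi> \<in> mod_homs p G" "\<psi> \<in> mod_homs p G"
    show "E \<phi> = E \<psi> \<longleftrightarrow> \<phi> = \<psi>"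
    proof
      assume e: "E \<phi> = E \<psi>"
      \<comment> \<open>The classes on which the two homomorphisms agree form a subspace. It
        contains the basis, hence is everything.\<close>
      define N where "N = {v \<in> carrier V. \<phi> (rep v) = \<psi> (rep v)}"
      have NI: "\<gamma> g \<in> N \<longleftrightarrow> \<phi> g = \<psi> g" if "g \<in> carrier G" for g
        using rep_eq[OF h(1) that] rep_eq[OF h(2) that] \<gamma>[OF that] by (simp add: N_def)
      have NV: "\<exists>g\<in>carrier G. v = \<gamma> g \<and> \<phi> g = \<psi> g" if "v \<in> N" for v
        using that rep[of v] unfolding N_def by (intro bexI[of _ "rep v"]) auto
      have "LinearCombinations.submodule ?K N V"
      proof (rule LinearCombinations.submodule.intro)
        show "\<zero>\<^bsub>V\<^esub> \<in> N"
          using NI[OF one_closed] unfolding \<gamma>1 mod_homs_one[OF h(1) p0] mod_homs_one[OF h(2) p0] by simp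
        show "v \<oplus>\<^bsub>V\<^esub> w \<in> N" if vw: "v \<in> N" "w \<in> N" for v w
        proof -
          obtain g k where g: "g \<in> carrier G" "v = \<gamma> g" "\<phi> g = \<psi> g" and k: "k \<in> carrier G" "w = \<gamma> k" "\<phi> k = \<psi> k"
            using NV[OF vw(1)] NV[OF vw(2)] by blast
          have "\<phi> (g \<otimes> k) = \<psi> (g \<otimes> k)" using mod_homs_mult[OF h(1) g(1) k(1)] mod_homs_mult[OF h(2) g(1) k(1)] g k by simp
          then show ?thesis using NI[of "g \<otimes> k"] props(3)[OF g(1) k(1)] g k by simp
        qed
        show "c \<odot>\<^bsub>V\<^esub> v \<in> N" if c: "c \<in> carrier ?K" and v: "v \<in> N" for c v
        proof -
          obtain g where g: "g \<in> carrier G" "v = \<gamma> g" "\<phi> g = \<psi> g" using NV[OF v] by blast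
          have c': "c = int (nat c)" "int (nat c) < int p" using c by auto
          have "\<phi> (g [^] nat c) = \<psi> (g [^] nat c)"
            using mod_homs_pow[OF h(1) p0 g(1)] mod_homs_pow[OF h(2) p0 g(1)] g by (simp del: pow_nat)
          then have "\<gamma> (g [^] nat c) \<in> N" using NI g(1) by (simp del: pow_nat)
          then show ?thesis using props(4)[OF g(1) c'(2)] c'(1) g(2) by (simp del: pow_nat)
        qed
      qed (auto simp: N_def mV)
      moreover have "b \<subseteq> N"
      proof
        fix v assume v: "v \<in> b"
        then have "\<phi> (rep v) = \<psi> (rep v)" using fun_cong[OF e, of v] by (simp add: E_def)
        then show "v \<in> N" using v bV by (auto simp: N_def)
      qed
      ultimately have "carrier V \<subseteq> N" using V.span_is_subset[of b N] gen by blast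
      then have "\<phi> g = \<psi> g" if "g \<in> carrier G" for g using that \<gamma> NI by blast
      then show "\<phi> = \<psi>" by (rule mod_homs_eqI[OF h])
    qed simp
  next
    fix \<phi> assume \<phi>: "\<phi> \<in> mod_homs p G"
    show "E \<phi> \<in> b \<rightarrow>\<^sub>E {0..<int p}"
      unfolding E_def
    proof (intro PiE_I)
      fix v assume v: "v \<in> b"
      then have "rep v \<in> carrier G" using rep bV by blast
      then show "(\<lambda>v\<in>b. \<phi> (rep v)) v \<in> {0..<int p}" using mod_homs_range[OF \<phi>, of "rep v"] v by simp
    qed simp
  next
    fix f assume f: "f \<in> b \<rightarrow>\<^sub>E {0..<int p}"
    define P where "P v a \<longleftrightarrow> a \<in> b \<rightarrow>\<^sub>E carrier ?K \<and> V.lincomb a b = v" for v a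
    define co where "co v = (THE a. P v a)" for v
    have ex1: "\<exists>!a. P v a" if "v \<in> carrier V" for v
      using V.basis_criterion[OF b(1) bV] b(2) that unfolding P_def by blast
    have co: "P v (co v)" if "v \<in> carrier V" for v
      unfolding co_def by (rule theI'[OF ex1[OF that]])
    have co_eq: "co v = a" if "v \<in> carrier V" "P v a" for v a
      using ex1[OF that(1)] co[OF that(1)] that(2) by blast
    have co_add: "co (v \<oplus>\<^bsub>V\<^esub> w) = (\<lambda>u\<in>b. (co v u + co w u) mod int p)"
      if vw: "v \<in> carrier V" "w \<in> carrier V" for v w
    proof (rule co_eq)
      have v: "co v \<in> b \<rightarrow> carrier ?K" "V.lincomb (co v) b = v" using co[OF vw(1)] by (auto simp: P_def)
      have w: "co w \<in> b \<rightarrow> carrier ?K" "V.lincomb (co w) b = w" using co[OF vw(2)] by (auto simp: P_def)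
      have r: "(\<lambda>u. co v u \<oplus>\<^bsub>?K\<^esub> co w u) \<in> b \<rightarrow> carrier ?K" using v(1) w(1) p0 by auto
      have "V.lincomb (\<lambda>u\<in>b. (co v u + co w u) mod int p) b = V.lincomb (\<lambda>u. co v u \<oplus>\<^bsub>?K\<^esub> co w u) b"
        by (rule V.lincomb_cong[OF refl bV _ r]) simp
      also have "\<dots> = v \<oplus>\<^bsub>V\<^esub> w" using V.lincomb_sum[OF b(1) bV v(1) w(1)] v w by simp
      finally show "P (v \<oplus>\<^bsub>V\<^esub> w) (\<lambda>u\<in>b. (co v u + co w u) mod int p)"
        unfolding P_def using p0 by auto
    qed (use vw in simp)
    have co_basis: "co u = (\<lambda>w\<in>b. if w = u then 1 else 0)" if u: "u \<in> b" for u
    proof (rule co_eq)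
      let ?\<delta> = "\<lambda>w\<in>b. if w = u then 1 else 0 :: int"
      have d: "?\<delta> \<in> b \<rightarrow> carrier ?K" using prime_gt_1_nat[OF p] by auto
      have "V.lincomb ?\<delta> (b - {u}) = \<zero>\<^bsub>V\<^esub>"
        by (rule V.lincomb_zero) (use bV in auto)
      then have "V.lincomb ?\<delta> b = \<one>\<^bsub>?K\<^esub> \<odot>\<^bsub>V\<^esub> u \<oplus>\<^bsub>V\<^esub> \<zero>\<^bsub>V\<^esub>"
        using V.lincomb_del2[OF b(1) bV d u] u by simp
      also have "\<dots> = u" using V.smult_one[of u] u bV by auto
      finally show "P u ?\<delta>" unfolding P_def using d by (simp add: PiE_def extensional_def)
    qed (use u bV in auto)
    \<comment> \<open>The linear functional with prescribed values \<open>f\<close> on the basis,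
      composed with the class map; \<open>co\<close> gives the coordinates of a class.\<close>
    define \<phi> where "\<phi> = (\<lambda>g\<in>carrier G. (\<Sum>u\<in>b. co (\<gamma> g) u * f u) mod int p)"
    have \<phi>: "\<phi> \<in> mod_homs p G"
    proof (rule mod_homsI)
      fix g h assume gh: "g \<in> carrier G" "h \<in> carrier G"
      have "\<phi> (g \<otimes> h) = (\<Sum>u\<in>b. ((co (\<gamma> g) u + co (\<gamma> h) u) mod int p) * f u) mod int p"
        using gh by (simp add: \<phi>_def props(3) co_add \<gamma>)
      also have "\<dots> = (\<Sum>u\<in>b. (co (\<gamma> g) u + co (\<gamma> h) u) * f u) mod int p"
        unfolding cong_def[symmetric] by (intro cong_sum cong_mult cong_refl) (simp add: cong_def)
      also have "\<dots> = (\<phi> g + \<phi> h) mod int p"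
        using gh by (simp add: \<phi>_def distrib_right sum.distrib mod_simps)
      finally show "\<phi> (g \<otimes> h) = (\<phi> g + \<phi> h) mod int p" .
    qed (use p0 in \<open>auto simp: \<phi>_def\<close>)
    have "E \<phi> v = f v" for v
    proof (cases "v \<in> b")
      case True
      then have v: "rep v \<in> carrier G" "\<gamma> (rep v) = v" using rep bV by auto
      have "E \<phi> v = (\<Sum>u\<in>b. co v u * f u) mod int p" using True v by (simp add: E_def \<phi>_def)
      also have "(\<Sum>u\<in>b. co v u * f u) = (\<Sum>u\<in>b. if u = v then f u else 0)"
        unfolding co_basis[OF True] by (intro sum.cong) auto
      also have "\<dots> = f v" using b(1) True by simp
      also have "f v mod int p = f v" using PiE_mem[OF f True] by simp
      finally show ?thesis .
    next
      case False
      then show ?thesis using PiE_arb[OF f False] by (simp add: E_def)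
    qed
    then have "f = E \<phi>" by (intro ext) (rule sym)
    then show "\<exists>\<phi>\<in>mod_homs p G. f = E \<phi>" using \<phi> by blast
  qed
  then have "card (mod_homs p G) = card (b \<rightarrow>\<^sub>E {0..<int p})" by (rule bij_betw_same_card)
  also have "\<dots> = p ^ card b" unfolding card_PiE[OF b(1)] by simp
  finally show ?thesis using dim by simp
qed

end

section \<open>Commutators in finite \<open>p\<close>-groups\<close>

text \<open>Here \<open>r k x\<close> plays the part of the node at level \<open>k\<close> on the branch \<open>x\<close>.\<close>

lemma koenig_sequence:
  fixes P :: "nat \<Rightarrow> 'x \<Rightarrow> bool" and r :: "nat \<Rightarrow> 'x \<Rightarrow> 'y"
  assumes dec: "\<And>k x. P (Suc k) x \<Longrightarrow> P k x"
    and ne: "\<And>k. \<exists>x. P k x"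
    and fin: "\<And>k. finite (r k ` {x. P k x})"
  shows "\<exists>x. \<forall>k. P k (x k) \<and> r k (x (Suc k)) = r k (x k)"
proof -
  have decn: "P k x" if "P m x" "k \<le> m" for k m x
    using that(2,1) by (induction rule: dec_induct) (auto dest: dec)
  \<comment> \<open>The node of \<open>x\<close> at level \<open>k\<close> has descendants at every
    deeper level.\<close>
  define good where "good k x \<longleftrightarrow> P k x \<and> (\<forall>m\<ge>k. \<exists>y. P m y \<and> r k y = r k x)" for k x
  \<comment> \<open>Choose one candidate for each level \<open>m\<close>. Infinitely many of them
    share a node at level \<open>k\<close> by the pigeonhole principle, and that node is good. The
    constraint \<open>R\<close> carries along the agreement with the node chosen at the previous
    level.\<close>
  have pick: "\<exists>x. good k x \<and> R x"
    if h: "\<And>m. m \<ge> k \<Longrightarrow> \<exists>y. P m y \<and> R y" for k and R :: "'x \<Rightarrow> bool"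
  proof -
    define y where "y m = (SOME y. P m y \<and> R y)" for m
    have y: "P m (y m) \<and> R (y m)" if "m \<ge> k" for m
      unfolding y_def by (rule someI_ex[OF h[OF that]])
    have "(\<lambda>m. r k (y m)) ` {k..} \<subseteq> r k ` {x. P k x}"
      using y decn by blast
    then have "finite ((\<lambda>m. r k (y m)) ` {k..})" using fin finite_subset by blast
    moreover have "infinite {k..}" by (rule infinite_Ici)
    ultimately obtain m0 where m0: "m0 \<in> {k..}" "infinite {m \<in> {k..}. r k (y m) = r k (y m0)}"
      using pigeonhole_infinite[of "{k..}" "\<lambda>m. r k (y m)"] by blast
    have "\<exists>z. P m z \<and> r k z = r k (y m0)" if "m \<ge> k" for m
    proof -
      obtain m1 where "m1 > m" "m1 \<in> {m \<in> {k..}. r k (y m) = r k (y m0)}"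
        using m0(2) unfolding infinite_nat_iff_unbounded by blast
      then have "P m (y m1)" "r k (y m1) = r k (y m0)" using decn[of m1 "y m1" m] y[of m1] by auto
      then show ?thesis by blast
    qed
    moreover have "P k (y m0)" "R (y m0)" using y[of m0] decn[of m0 "y m0" k] m0(1) by auto
    ultimately show ?thesis unfolding good_def by blast
  qed
  have "\<exists>x. \<forall>k. good k (x k) \<and> r k (x (Suc k)) = r k (x k)"
  proof (rule dependent_nat_choice)
    show "\<exists>x. good 0 x" using pick[of 0 "\<lambda>_. True"] ne by blast
    fix x k assume x: "good k x"
    have "\<exists>y. P m y \<and> r k y = r k x" if "m \<ge> Suc k" for m using x that unfolding good_def by simp
    from pick[OF this] show "\<exists>y. good (Suc k) y \<and> r k y = r k x" by blast
  qed
  then show ?thesis unfolding good_def by blast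
qed

section \<open>Products of commutators with prescribed second entries\<close>

fun comm_prod :: "('a, 'b) monoid_scheme \<Rightarrow> 'a list \<Rightarrow> 'a list \<Rightarrow> 'a" where
  "comm_prod G (x # xs) (a # as) =
     (x \<otimes>\<^bsub>G\<^esub> a \<otimes>\<^bsub>G\<^esub> inv\<^bsub>G\<^esub> x \<otimes>\<^bsub>G\<^esub> inv\<^bsub>G\<^esub> a) \<otimes>\<^bsub>G\<^esub> comm_prod G xs as"
| "comm_prod G _ _ = \<one>\<^bsub>G\<^esub>"

text \<open>This is G^p[G,G]. A single \<open>p\<close>-th power suffices because modulo the derived
  subgroup a product of \<open>p\<close>-th powers is a \<open>p\<close>-th power.\<close>

definition power_derived :: "nat \<Rightarrow> ('a, 'b) monoid_scheme \<Rightarrow> 'a set" where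
  "power_derived p G = {c \<otimes>\<^bsub>G\<^esub> y [^]\<^bsub>G\<^esub> p |c y. c \<in> derived G (carrier G) \<and> y \<in> carrier G}"

context group
begin

lemma comm_prod_closed [simp]:
  "set xs \<subseteq> carrier G \<Longrightarrow> set as \<subseteq> carrier G \<Longrightarrow> comm_prod G xs as \<in> carrier G"
proof (induction xs arbitrary: as)
  case (Cons x xs)
  then show ?case by (cases as) auto
qed simp

lemma inv_cancel_assoc:
  assumes "x \<in> carrier G" "y \<in> carrier G"
  shows "inv x \<otimes> (x \<otimes> y) = y" "x \<otimes> (inv x \<otimes> y) = y"
  using assms by (simp_all add: m_assoc[symmetric])

lemma comm_prod_consistent:
  assumes H: "subgroup H G"
  shows "set xs \<subseteq> H \<Longrightarrow> set as \<subseteq> H \<Longrightarrow> comm_prod (G\<lparr>carrier := H\<rparr>) xs as = comm_prod G xs as"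
proof (induction xs arbitrary: as)
  case Nil
  then show ?case by simp
next
  case (Cons x xs)
  then show ?case by (cases as) (auto simp: m_inv_consistent[OF H])
qed

lemma comm_prod_replicate_one:
  "set as \<subseteq> carrier G \<Longrightarrow> comm_prod G (replicate (length as) \<one>) as = \<one>"
  by (induction as) auto

lemma rcos_cong_mult:
  assumes N: "N \<lhd> G" and "N #> x = N #> x'" "N #> y = N #> y'"
    and cl: "x \<in> carrier G" "x' \<in> carrier G" "y \<in> carrier G" "y' \<in> carrier G"
  shows "N #> (x \<otimes> y) = N #> (x' \<otimes> y')"
  using normal.rcos_sum[OF N cl(1,3)] normal.rcos_sum[OF N cl(2,4)] assms(2,3) by simp

lemma rcos_cong_pow:
  assumes N: "N \<lhd> G" and e: "N #> x = N #> y" and cl: "x \<in> carrier G" "y \<in> carrier G"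
  shows "N #> x [^] (n::nat) = N #> y [^] n"
proof (induction n)
  case 0
  then show ?case by simp
next
  case (Suc n)
  then show ?case using rcos_cong_mult[OF N Suc.IH e] cl by simp
qed

lemma rcos_cong_inv:
  assumes N: "N \<lhd> G" and e: "N #> x = N #> y" and cl: "x \<in> carrier G" "y \<in> carrier G"
  shows "N #> inv x = N #> inv y"
  using normal.rcos_inv[OF N cl(1)] normal.rcos_inv[OF N cl(2)] e by simp

lemma rcos_eq_normal:
  assumes N: "N \<lhd> G" and "x \<in> carrier G"
  shows "N #> x = N \<longleftrightarrow> x \<in> N"
  using assms coset_join1[OF _ _ normal_imp_subgroup[OF N]]
    coset_join2[OF _ normal_imp_subgroup[OF N]] by blast

text \<open>The preimage in \<open>G\<close> of the centre of \<open>G Mod N\<close>.\<close>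

definition center_mod :: "'a set \<Rightarrow> 'a set" where
  "center_mod N = {h \<in> carrier G. \<forall>g\<in>carrier G. N #> (h \<otimes> g) = N #> (g \<otimes> h)}"

lemma comm_mem_iff:
  assumes N: "N \<lhd> G" and cl: "x \<in> carrier G" "y \<in> carrier G"
  shows "x \<otimes> y \<otimes> inv x \<otimes> inv y \<in> N \<longleftrightarrow> N #> (x \<otimes> y) = N #> (y \<otimes> x)"
  using rcos_eq_iff[OF normal_imp_subgroup[OF N] m_closed[OF cl] m_closed[OF cl(2,1)]] cl
  by (simp add: inv_mult_group m_assoc)

lemma center_mod_normal:
  assumes N: "N \<lhd> G"
  shows "center_mod N \<lhd> G" "N \<subseteq> center_mod N"
proof -
  let ?Z = "center_mod N"
  have c: "N #> (h \<otimes> g) = N #> (g \<otimes> h)" if "h \<in> ?Z" "g \<in> carrier G" for h g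
    using that by (simp add: center_mod_def)
  have ZG: "?Z \<subseteq> carrier G" by (auto simp: center_mod_def)
  show NZ: "N \<subseteq> ?Z"
  proof
    fix n assume n: "n \<in> N"
    then have nG: "n \<in> carrier G" using normal_subset[OF N] by blast
    have "n \<otimes> g \<otimes> inv n \<otimes> inv g \<in> N" if g: "g \<in> carrier G" for g
    proof -
      have "g \<otimes> inv n \<otimes> inv g \<in> N"
        using N g subgroup.m_inv_closed[OF normal_imp_subgroup[OF N] n] unfolding normal_inv_iff by blast
      then have "n \<otimes> (g \<otimes> inv n \<otimes> inv g) \<in> N" using subgroup.m_closed[OF normal_imp_subgroup[OF N] n] by blast
      then show ?thesis using nG g by (simp add: m_assoc)
    qed
    then show "n \<in> ?Z" using comm_mem_iff[OF N nG] nG by (simp add: center_mod_def)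
  qed
  have sub: "subgroup ?Z G"
  proof (rule subgroupI)
    show "?Z \<noteq> {}" using NZ subgroup.one_closed[OF normal_imp_subgroup[OF N]] by blast
    show "inv h \<in> ?Z" if h: "h \<in> ?Z" for h
    proof -
      have hG: "h \<in> carrier G" using h ZG by blast
      have "N #> (inv h \<otimes> g) = N #> (g \<otimes> inv h)" if g: "g \<in> carrier G" for g
      proof -
        have a: "N #> (h \<otimes> (inv h \<otimes> g \<otimes> inv h)) = N #> ((inv h \<otimes> g \<otimes> inv h) \<otimes> h)"
          using c[OF h, of "inv h \<otimes> g \<otimes> inv h"] hG g by simp
        moreover have "h \<otimes> (inv h \<otimes> g \<otimes> inv h) = g \<otimes> inv h" using hG g by (simp add: m_assoc[symmetric])
        moreover have "(inv h \<otimes> g \<otimes> inv h) \<otimes> h = inv h \<otimes> g" using hG g by (simp add: m_assoc)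
        ultimately show ?thesis by simp
      qed
      then show ?thesis using hG by (simp add: center_mod_def)
    qed
    show "h \<otimes> k \<in> ?Z" if h: "h \<in> ?Z" and k: "k \<in> ?Z" for h k
    proof -
      have cl: "h \<in> carrier G" "k \<in> carrier G" using h k ZG by auto
      have "N #> (h \<otimes> k \<otimes> g) = N #> (g \<otimes> (h \<otimes> k))" if g: "g \<in> carrier G" for g
      proof -
        have "N #> (h \<otimes> k \<otimes> g) = N #> (h \<otimes> (k \<otimes> g))" using cl g by (simp add: m_assoc)
        also have "\<dots> = N #> (h \<otimes> (g \<otimes> k))" using rcos_cong_mult[OF N refl c[OF k g]] cl g by simp
        also have "\<dots> = N #> ((h \<otimes> g) \<otimes> k)" using cl g by (simp add: m_assoc)
        also have "\<dots> = N #> ((g \<otimes> h) \<otimes> k)" using rcos_cong_mult[OF N c[OF h g] refl] cl g by simp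
        finally show ?thesis using cl g by (simp add: m_assoc)
      qed
      then show ?thesis using cl by (simp add: center_mod_def)
    qed
  qed (rule ZG)
  moreover have "x \<otimes> h \<otimes> inv x \<in> ?Z" if x: "x \<in> carrier G" and h: "h \<in> ?Z" for x h
  proof -
    have hG: "h \<in> carrier G" using h ZG by blast
    have "h \<otimes> x \<otimes> inv h \<otimes> inv x \<in> N" using comm_mem_iff[OF N hG x] c[OF h x] by simp
    then have "inv (h \<otimes> x \<otimes> inv h \<otimes> inv x) \<in> ?Z"
      using NZ subgroup.m_inv_closed[OF sub] by blast
    then have "inv (h \<otimes> x \<otimes> inv h \<otimes> inv x) \<otimes> h \<in> ?Z" using subgroup.m_closed[OF sub] h by blast
    moreover have "inv (h \<otimes> x \<otimes> inv h \<otimes> inv x) \<otimes> h = x \<otimes> h \<otimes> inv x"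
      using hG x by (simp add: inv_mult_group m_assoc)
    ultimately show ?thesis by simp
  qed
  ultimately show "?Z \<lhd> G" unfolding normal_inv_iff by blast
qed

text \<open>Changing the entry at position \<open>i\<close> multiplies one commutator by
  \<open>c\<close> modulo \<open>N\<close>. Since \<open>c\<close> is central modulo
  \<open>N\<close>, it can be moved past the earlier factors to the front.\<close>

lemma comm_prod_update:
  assumes N: "N \<lhd> G" and c: "c \<in> center_mod N" and v: "v \<in> carrier G"
  shows "i < length as \<Longrightarrow> length xs = length as \<Longrightarrow> set xs \<subseteq> carrier G \<Longrightarrow> set as \<subseteq> carrier G \<Longrightarrow>
    N #> (xs ! i \<otimes> v \<otimes> as ! i \<otimes> inv (xs ! i \<otimes> v) \<otimes> inv (as ! i)) =
      N #> (c \<otimes> (xs ! i \<otimes> as ! i \<otimes> inv (xs ! i) \<otimes> inv (as ! i))) \<Longrightarrow>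
    N #> comm_prod G (xs[i := xs ! i \<otimes> v]) as = N #> (c \<otimes> comm_prod G xs as)"
proof (induction xs arbitrary: as i)
  case Nil
  then show ?case by simp
next
  case (Cons x xs)
  then obtain a as' where as: "as = a # as'" by (cases as) auto
  have cG: "c \<in> carrier G" using c by (simp add: center_mod_def)
  have cl: "x \<in> carrier G" "a \<in> carrier G" "comm_prod G xs as' \<in> carrier G"
    using Cons.prems as by auto
  let ?C = "x \<otimes> a \<otimes> inv x \<otimes> inv a" and ?P = "comm_prod G xs as'"
  show ?case
  proof (cases i)
    case 0
    have "N #> (x \<otimes> v \<otimes> a \<otimes> inv (x \<otimes> v) \<otimes> inv a \<otimes> ?P) = N #> (c \<otimes> ?C \<otimes> ?P)"
      by (rule rcos_cong_mult[OF N _ refl]) (use Cons.prems(5) 0 as cl cG v in auto)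
    then show ?thesis using 0 as cl cG by (simp add: m_assoc)
  next
    case (Suc j)
    have set: "set (xs[j := xs ! j \<otimes> v]) \<subseteq> carrier G"
      using Cons.prems v Suc as nth_mem[of j xs] by (intro set_update_subsetI m_closed) auto
    have IH: "N #> comm_prod G (xs[j := xs ! j \<otimes> v]) as' = N #> (c \<otimes> ?P)"
      by (rule Cons.IH) (use Cons.prems Suc as in auto)
    have "N #> (?C \<otimes> comm_prod G (xs[j := xs ! j \<otimes> v]) as') = N #> (?C \<otimes> (c \<otimes> ?P))"
      by (rule rcos_cong_mult[OF N refl IH]) (use cl cG set Cons.prems(4) as in auto)
    also have "\<dots> = N #> ((?C \<otimes> c) \<otimes> ?P)" using cl cG by (simp add: m_assoc)
    also have "\<dots> = N #> ((c \<otimes> ?C) \<otimes> ?P)"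
      by (rule rcos_cong_mult[OF N _ refl]) (use c cl in \<open>auto simp: center_mod_def\<close>)
    finally show ?thesis using Suc as cl cG by (simp add: m_assoc)
  qed
qed

text \<open>
  In a finite \<open>p\<close>-group generated by \<open>a\<^sub>1, \<dots>, a\<^sub>d\<close> every element of the derived subgroup is a
  product \<open>[x\<^sub>1, a\<^sub>1] \<cdots> [x\<^sub>d, a\<^sub>d]\<close>. Induction on the order: some \<open>u\<close> in the second centre has a
  central commutator \<open>w = [u, a\<^sub>i]\<close> of order \<open>p\<close>, and the powers of \<open>w\<close> lost in the quotient by
  \<open>\<langle>w\<rangle>\<close> are recovered from \<open>[x u\<^sup>j, a\<^sub>i] = w\<^sup>j [x, a\<^sub>i]\<close>.
\<close>

lemma derived_comm_prod_approx:
  assumes p: "prime p" and as: "set as \<subseteq> carrier G" "generate G (set as) = carrier G"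
  shows "N \<lhd> G \<Longrightarrow> rel_index G (carrier G) N = p ^ k \<Longrightarrow> f \<in> derived G (carrier G) \<Longrightarrow>
    \<exists>xs. length xs = length as \<and> set xs \<subseteq> carrier G \<and> N #> f = N #> comm_prod G xs as"
proof (induction k arbitrary: N)
  case 0
  have "N = carrier G"
    using rel_index_eq_1[OF normal_imp_subgroup[OF 0(1)] subgroup_self normal_subset[OF 0(1)]] 0(2) by simp
  moreover have "f \<in> carrier G" using 0(3) derived_in_carrier[of "carrier G"] by blast
  ultimately have "N #> f = N #> comm_prod G (replicate (length as) \<one>) as"
    using rcos_eq_normal[OF 0(1)] comm_prod_replicate_one[OF as(1)] by simp
  then show ?case by (intro exI[of _ "replicate (length as) \<one>"]) auto
next
  case (Suc k)
  note N = Suc.prems(1)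
  note sN = normal_imp_subgroup[OF N]
  have fG: "f \<in> carrier G" using Suc.prems(3) derived_in_carrier[of "carrier G"] by blast
  let ?Z = "center_mod N"
  note Z = center_mod_normal[OF N]
  note sZ = normal_imp_subgroup[OF Z(1)]
  show ?case
  proof (cases "?Z = carrier G")
    case True
    \<comment> \<open>Here \<open>G\<close> is abelian modulo \<open>N\<close>, so \<open>f\<close>
      lies in \<open>N\<close> and trivial entries suffice.\<close>
    have "derived_set G (carrier G) \<subseteq> N"
    proof
      fix x assume "x \<in> derived_set G (carrier G)"
      then obtain g h where gh: "g \<in> carrier G" "h \<in> carrier G" "x = g \<otimes> h \<otimes> inv g \<otimes> inv h" by blast
      then have "g \<in> ?Z" using True by simp
      then show "x \<in> N" using comm_mem_iff[OF N gh(1,2)] gh by (simp add: center_mod_def)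
    qed
    then have "derived G (carrier G) \<subseteq> N"
      unfolding derived_def by (rule generate_subgroup_incl[OF _ sN])
    then have "N #> f = N #> comm_prod G (replicate (length as) \<one>) as"
      using Suc.prems(3) rcos_eq_normal[OF N fG] comm_prod_replicate_one[OF as(1)] normal_subset[OF N] by auto
    then show ?thesis by (intro exI[of _ "replicate (length as) \<one>"]) auto
  next
    case False
    have "rel_index G (carrier G) N = rel_index G (carrier G) ?Z * rel_index G ?Z N"
      by (rule rel_index_mult[OF sN sZ subgroup_self Z(2) normal_subset[OF Z(1)]])
    then have "rel_index G (carrier G) ?Z dvd p ^ Suc k" using Suc.prems(2) by simp
    then obtain l where l: "rel_index G (carrier G) ?Z = p ^ l" using divides_primepow_nat[OF p] by blast
    have "l \<noteq> 0" using rel_index_eq_1[OF sZ subgroup_self normal_subset[OF Z(1)]] l False by auto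
    then obtain l' where "l = Suc l'" using not0_implies_Suc by blast
    with l obtain u where u: "u \<in> carrier G" "u \<notin> ?Z" "u [^] p \<in> ?Z"
      and uc: "\<And>g. g \<in> carrier G \<Longrightarrow> u \<otimes> g \<otimes> inv u \<otimes> inv g \<in> ?Z"
      using central_step[OF p Z(1)] by blast
    \<comment> \<open>Elements commuting with \<open>u\<close> modulo \<open>N\<close> are closed
      under products and inverses. If all generators were among them, \<open>u\<close> would be
      central modulo \<open>N\<close>.\<close>
    have "\<exists>a\<in>set as. u \<otimes> a \<otimes> inv u \<otimes> inv a \<notin> N"
    proof (rule ccontr)
      assume n: "\<not> ?thesis"
      have "N #> (u \<otimes> g) = N #> (g \<otimes> u)" if "g \<in> generate G (set as)" for g
        using that
      proof (induction rule: generate.induct)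
        case one
        then show ?case using u by simp
      next
        case (incl a)
        then show ?case using n comm_mem_iff[OF N u(1), of a] as(1) by auto
      next
        case (inv a)
        then have a: "a \<in> carrier G" "N #> (u \<otimes> a) = N #> (a \<otimes> u)"
          using n comm_mem_iff[OF N u(1), of a] as(1) by auto
        have "N #> (inv a \<otimes> (u \<otimes> a) \<otimes> inv a) = N #> (inv a \<otimes> (a \<otimes> u) \<otimes> inv a)"
          by (intro rcos_cong_mult[OF N] a(2) refl) (use a u in auto)
        moreover have "inv a \<otimes> (u \<otimes> a) \<otimes> inv a = inv a \<otimes> u" using a u by (simp add: m_assoc)
        moreover have "inv a \<otimes> (a \<otimes> u) \<otimes> inv a = u \<otimes> inv a" using a u by (simp add: m_assoc[symmetric])
        ultimately show ?case by simp
      next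
        case (eng x y)
        then have xy: "x \<in> carrier G" "y \<in> carrier G" using as(2) by auto
        have "N #> (u \<otimes> (x \<otimes> y)) = N #> ((u \<otimes> x) \<otimes> y)" using xy u by (simp add: m_assoc)
        also have "\<dots> = N #> ((x \<otimes> u) \<otimes> y)" using rcos_cong_mult[OF N eng.IH(1) refl] xy u by simp
        also have "\<dots> = N #> (x \<otimes> (u \<otimes> y))" using xy u by (simp add: m_assoc)
        also have "\<dots> = N #> (x \<otimes> (y \<otimes> u))" using rcos_cong_mult[OF N refl eng.IH(2)] xy u by simp
        finally show ?case using xy u by (simp add: m_assoc)
      qed
      then have "u \<in> ?Z" using as(2) u by (simp add: center_mod_def)
      then show False using u by simp
    qed
    then obtain i where i: "i < length as" "u \<otimes> as ! i \<otimes> inv u \<otimes> inv (as ! i) \<notin> N"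
      by (auto simp: in_set_conv_nth)
    define a where "a = as ! i"
    define w where "w = u \<otimes> a \<otimes> inv u \<otimes> inv a"
    have aG: "a \<in> carrier G" using as(1) i by (auto simp: a_def)
    have wZ: "w \<in> ?Z" using uc aG by (simp add: w_def)
    have wG: "w \<in> carrier G" using u aG by (simp add: w_def)
    have wN: "w \<notin> N" using i by (simp add: w_def a_def)
    have wcom: "N #> (w \<otimes> g) = N #> (g \<otimes> w)" if "g \<in> carrier G" for g
      using wZ that by (simp add: center_mod_def)
    have wpZ: "w [^] (j::nat) \<in> ?Z" for j using subgroup_nat_pow_closed[OF sZ wZ] .
    have wpcom: "N #> (w [^] (j::nat) \<otimes> g) = N #> (g \<otimes> w [^] j)" if "g \<in> carrier G" for g j
      using wpZ[of j] that by (simp add: center_mod_def)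
    \<comment> \<open>Since \<open>w\<close> is central modulo \<open>N\<close>, the commutator with
      \<open>a\<close> is multiplicative on the powers of \<open>u\<close>.\<close>
    have upow: "N #> (u [^] (j::nat) \<otimes> a \<otimes> inv (u [^] j) \<otimes> inv a) = N #> w [^] j" for j
    proof (induction j)
      case 0
      then show ?case using aG by simp
    next
      case (Suc j)
      let ?v = "u [^] j"
      have vG: "?v \<in> carrier G" using u by simp
      have "u [^] Suc j \<otimes> a \<otimes> inv (u [^] Suc j) \<otimes> inv a
          = ?v \<otimes> w \<otimes> (a \<otimes> inv ?v \<otimes> inv a)"
        using u aG by (simp add: w_def inv_mult_group m_assoc inv_cancel_assoc)
      moreover have "N #> (?v \<otimes> w \<otimes> (a \<otimes> inv ?v \<otimes> inv a)) = N #> (w \<otimes> ?v \<otimes> (a \<otimes> inv ?v \<otimes> inv a))"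
        by (rule rcos_cong_mult[OF N wcom[OF vG, symmetric] refl]) (use vG wG aG in auto)
      moreover have "w \<otimes> ?v \<otimes> (a \<otimes> inv ?v \<otimes> inv a) = w \<otimes> (?v \<otimes> a \<otimes> inv ?v \<otimes> inv a)"
        using vG wG aG by (simp add: m_assoc)
      moreover have "N #> (w \<otimes> (?v \<otimes> a \<otimes> inv ?v \<otimes> inv a)) = N #> (w \<otimes> w [^] j)"
        by (rule rcos_cong_mult[OF N refl Suc]) (use vG wG aG in auto)
      moreover have "w \<otimes> w [^] j = w [^] Suc j" using nat_pow_Suc2[OF wG] by simp
      ultimately show ?case by simp
    qed
    \<comment> \<open>By \<open>upow\<close> this power is the commutator of \<open>u [^] p\<close>
      with \<open>a\<close>, and \<open>u [^] p\<close> is central modulo \<open>N\<close>.\<close>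
    have wp: "w [^] p \<in> N"
    proof -
      have "u [^] p \<otimes> a \<otimes> inv (u [^] p) \<otimes> inv a \<in> N"
        using u aG comm_mem_iff[OF N, of "u [^] p" a] by (simp add: center_mod_def)
      then have "N #> w [^] p = N"
        using upow[of p] rcos_eq_normal[OF N, of "u [^] p \<otimes> a \<otimes> inv (u [^] p) \<otimes> inv a"] u aG by simp
      then show ?thesis using rcos_eq_normal[OF N, of "w [^] p"] wG by simp
    qed
    have wc: "w \<otimes> g \<otimes> inv w \<otimes> inv g \<in> N" if "g \<in> carrier G" for g
      using comm_mem_iff[OF N wG that] wcom[OF that] by simp
    define N' where "N' = {h \<otimes> w [^] (i::nat) |h i. h \<in> N}"
    note N' = cyclic_extension[OF sN wG wp wN p wc, folded N'_def]
    have N'n: "N' \<lhd> G" by (rule N'(6)[OF _ N])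
    have "rel_index G (carrier G) N = rel_index G (carrier G) N' * rel_index G N' N"
      by (rule rel_index_mult[OF sN N'(1) subgroup_self N'(2) normal_subset[OF N'n]])
    then have "rel_index G (carrier G) N' = p ^ k" using Suc.prems(2) N'(5) prime_gt_0_nat[OF p] by simp
    then obtain xs where xs: "length xs = length as" "set xs \<subseteq> carrier G" "N' #> f = N' #> comm_prod G xs as"
      using Suc.IH[OF N'n _ Suc.prems(3)] by blast
    have PG: "comm_prod G xs as \<in> carrier G" using xs as by simp
    have "f \<otimes> inv (comm_prod G xs as) \<in> N'" using rcos_eq_iff[OF N'(1) fG PG] xs(3) by simp
    then obtain n j where n: "n \<in> N" "f \<otimes> inv (comm_prod G xs as) = n \<otimes> w [^] (j::nat)"
      unfolding N'_def by blast
    have nG: "n \<in> carrier G" using n(1) normal_subset[OF N] by blast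
    have "f = f \<otimes> inv (comm_prod G xs as) \<otimes> comm_prod G xs as" using fG PG by (simp add: m_assoc)
    then have "f = n \<otimes> (w [^] j \<otimes> comm_prod G xs as)" unfolding n(2) using nG wG PG by (simp add: m_assoc)
    then have f: "N #> f = N #> (w [^] j \<otimes> comm_prod G xs as)"
      using rcos_mult_left[OF sN n(1), of "w [^] j \<otimes> comm_prod G xs as"] wG PG by simp
    define x where "x = xs ! i"
    have xG: "x \<in> carrier G" using xs i by (auto simp: x_def)
    define v where "v = u [^] j"
    have vG: "v \<in> carrier G" using u by (simp add: v_def)
    have "x \<otimes> v \<otimes> a \<otimes> inv (x \<otimes> v) \<otimes> inv a = x \<otimes> (v \<otimes> a \<otimes> inv v \<otimes> inv a) \<otimes> (a \<otimes> inv x \<otimes> inv a)"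
      using xG vG aG by (simp add: inv_mult_group m_assoc inv_cancel_assoc)
    moreover have "N #> (x \<otimes> (v \<otimes> a \<otimes> inv v \<otimes> inv a) \<otimes> (a \<otimes> inv x \<otimes> inv a)) =
        N #> (x \<otimes> w [^] j \<otimes> (a \<otimes> inv x \<otimes> inv a))"
      using upow[of j] by (intro rcos_cong_mult[OF N] refl) (use xG vG aG wG in \<open>auto simp: v_def\<close>)
    moreover have "N #> (x \<otimes> w [^] j \<otimes> (a \<otimes> inv x \<otimes> inv a)) = N #> (w [^] j \<otimes> x \<otimes> (a \<otimes> inv x \<otimes> inv a))"
      by (rule rcos_cong_mult[OF N wpcom[OF xG, symmetric] refl]) (use xG aG wG in auto)
    moreover have "w [^] j \<otimes> x \<otimes> (a \<otimes> inv x \<otimes> inv a) = w [^] j \<otimes> (x \<otimes> a \<otimes> inv x \<otimes> inv a)"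
      using xG aG wG by (simp add: m_assoc)
    ultimately have e: "N #> (x \<otimes> v \<otimes> a \<otimes> inv (x \<otimes> v) \<otimes> inv a) = N #> (w [^] j \<otimes> (x \<otimes> a \<otimes> inv x \<otimes> inv a))"
      by simp
    have "N #> comm_prod G (xs[i := x \<otimes> v]) as = N #> (w [^] j \<otimes> comm_prod G xs as)"
      unfolding x_def by (rule comm_prod_update[OF N wpZ vG i(1) xs(1,2) as(1)]) (use e in \<open>simp add: x_def a_def\<close>)
    then have "N #> f = N #> comm_prod G (xs[i := x \<otimes> v]) as" using f by simp
    moreover have "set (xs[i := x \<otimes> v]) \<subseteq> carrier G" using xs(2) xG vG by (intro set_update_subsetI) auto
    ultimately show ?thesis using xs(1) by (intro exI[of _ "xs[i := x \<otimes> v]"]) auto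
  qed
qed

section \<open>The subgroup of commutators and \<open>p\<close>-th powers\<close>

lemma derived_normal: "derived G (carrier G) \<lhd> G"
  by (rule derived_is_normal[OF normal_self])

lemma comm_in_derived: "x \<in> carrier G \<Longrightarrow> y \<in> carrier G \<Longrightarrow> x \<otimes> y \<otimes> inv x \<otimes> inv y \<in> derived G (carrier G)"
  unfolding derived_def by (rule generate.incl) blast

lemma power_derived_alt:
  "x \<in> power_derived p G \<longleftrightarrow> x \<in> carrier G \<and>
    (\<exists>y\<in>carrier G. derived G (carrier G) #> x = derived G (carrier G) #> y [^] p)"
proof
  let ?D = "derived G (carrier G)"
  note D = derived_normal
  note sD = normal_imp_subgroup[OF D]
  {
    assume "x \<in> power_derived p G"
    then obtain c y where c: "c \<in> ?D" "y \<in> carrier G" "x = c \<otimes> y [^] p" by (auto simp: power_derived_def)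
    have cG: "c \<in> carrier G" using c(1) normal_subset[OF D] by blast
    have "?D #> x = ?D #> y [^] p" unfolding c(3) by (rule rcos_mult_left[OF sD c(1)]) (use c in simp)
    then show "x \<in> carrier G \<and> (\<exists>y\<in>carrier G. ?D #> x = ?D #> y [^] p)" using c cG by auto
  next
    assume "x \<in> carrier G \<and> (\<exists>y\<in>carrier G. ?D #> x = ?D #> y [^] p)"
    then obtain y where y: "x \<in> carrier G" "y \<in> carrier G" "?D #> x = ?D #> y [^] p" by blast
    then have "x \<otimes> inv (y [^] p) \<in> ?D" using rcos_eq_iff[OF sD, of x "y [^] p"] by simp
    moreover have "x = x \<otimes> inv (y [^] p) \<otimes> y [^] p" using y by (simp add: m_assoc)
    ultimately show "x \<in> power_derived p G" using y(2) unfolding power_derived_def by blast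
  }
qed

text \<open>Everything is computed modulo the derived subgroup, where multiplication commutes and
  taking \<open>n\<close>-th powers is therefore multiplicative.\<close>

lemma power_derived_subgroup:
  shows "subgroup (power_derived p G) G" "derived G (carrier G) \<subseteq> power_derived p G"
    "\<And>x. x \<in> carrier G \<Longrightarrow> x [^] p \<in> power_derived p G"
proof -
  let ?D = "derived G (carrier G)" and ?E = "power_derived p G"
  note D = derived_normal
  have com: "?D #> (x \<otimes> y) = ?D #> (y \<otimes> x)" if "x \<in> carrier G" "y \<in> carrier G" for x y
    using comm_mem_iff[OF D that] comm_in_derived[OF that] by simp
  have mult_pow: "?D #> (x \<otimes> y) [^] n = ?D #> (x [^] n \<otimes> y [^] n)"
    if xy: "x \<in> carrier G" "y \<in> carrier G" for x y and n :: nat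
  proof (induction n)
    case 0
    then show ?case by simp
  next
    case (Suc n)
    have "?D #> (x \<otimes> y) [^] Suc n = ?D #> ((x [^] n \<otimes> y [^] n) \<otimes> (x \<otimes> y))"
      using rcos_cong_mult[OF D Suc refl, of "x \<otimes> y"] xy by simp
    also have "\<dots> = ?D #> (x [^] n \<otimes> (y [^] n \<otimes> x) \<otimes> y)" using xy by (simp add: m_assoc)
    also have "\<dots> = ?D #> (x [^] n \<otimes> (x \<otimes> y [^] n) \<otimes> y)"
      by (intro rcos_cong_mult[OF D] com refl) (use xy in auto)
    also have "\<dots> = ?D #> (x [^] Suc n \<otimes> y [^] Suc n)" using xy by (simp add: m_assoc)
    finally show ?case .
  qed
  show DE: "?D \<subseteq> ?E"
  proof
    fix c assume c: "c \<in> ?D"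
    then have cG: "c \<in> carrier G" using normal_subset[OF D] by blast
    have "?D #> c = ?D" using rcos_eq_normal[OF D cG] c by simp
    moreover have "?D #> (\<one> [^] p) = ?D" using normal_subset[OF D] by simp
    ultimately show "c \<in> ?E" using power_derived_alt[of c p] cG by blast
  qed
  show "x [^] p \<in> ?E" if "x \<in> carrier G" for x
    using that power_derived_alt[of "x [^] p" p] by blast
  show "subgroup ?E G"
  proof (rule subgroupI)
    show "?E \<subseteq> carrier G" using power_derived_alt by blast
    show "?E \<noteq> {}" using DE subgroup.one_closed[OF normal_imp_subgroup[OF D]] by blast
    show "inv x \<in> ?E" if xE: "x \<in> ?E" for x
    proof -
      obtain y where y: "x \<in> carrier G" "y \<in> carrier G" "?D #> x = ?D #> y [^] p"
        using xE unfolding power_derived_alt by blast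
      have "?D #> inv x = ?D #> (inv y) [^] p"
        using rcos_cong_inv[OF D y(3)] y by (simp add: nat_pow_inv)
      then show ?thesis using y unfolding power_derived_alt by blast
    qed
    show "x \<otimes> x' \<in> ?E" if xE: "x \<in> ?E" "x' \<in> ?E" for x x'
    proof -
      obtain y y' where y: "x \<in> carrier G" "y \<in> carrier G" "?D #> x = ?D #> y [^] p"
        and y': "x' \<in> carrier G" "y' \<in> carrier G" "?D #> x' = ?D #> y' [^] p"
        using xE unfolding power_derived_alt by blast
      have "?D #> (x \<otimes> x') = ?D #> (y [^] p \<otimes> y' [^] p)"
        by (rule rcos_cong_mult[OF D y(3) y'(3)]) (use y y' in auto)
      then have "?D #> (x \<otimes> x') = ?D #> (y \<otimes> y') [^] p" using mult_pow y y' by simp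
      then show ?thesis using y y' unfolding power_derived_alt by blast
    qed
  qed
qed

text \<open>The generators are adjoined to \<open>power_derived\<close> one after another. A new
  generator has its \<open>p\<close>-th power and all its commutators in the subgroup already built,
  so each proper step multiplies the index by \<open>p\<close>.\<close>

lemma power_derived_p_power_normal:
  assumes fg: "finitely_generated_group G" and p: "prime p"
  shows "power_derived p G \<in> p_power_normal_subgroups p G"
proof -
  let ?E = "power_derived p G"
  note E = power_derived_subgroup[where p = p]
  obtain S where S: "finite S" "S \<subseteq> carrier G" "generate G S = carrier G"
    using fg unfolding finitely_generated_group_def by blast
  have "\<exists>M. subgroup M G \<and> ?E \<union> T \<subseteq> M \<and> (\<exists>k. rel_index G M ?E = p ^ k)" if "finite T" "T \<subseteq> carrier G" for T
    using that
  proof (induction rule: finite_induct)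
    case empty
    then show ?case using E(1) rel_index_self[OF E(1)] by (intro exI[of _ ?E]) (auto intro: exI[of _ 0])
  next
    case (insert a T)
    then obtain M k where M: "subgroup M G" "?E \<union> T \<subseteq> M" "rel_index G M ?E = p ^ k" by blast
    have a: "a \<in> carrier G" using insert by simp
    show ?case
    proof (cases "a \<in> M")
      case True
      then show ?thesis using M by blast
    next
      case False
      have "a [^] p \<in> M" using E(3)[OF a] M by blast
      moreover have "a \<otimes> g \<otimes> inv a \<otimes> inv g \<in> M" if "g \<in> carrier G" for g
        using comm_in_derived[OF a that] E(2) M by blast
      moreover define M' where "M' = {h \<otimes> a [^] (i::nat) |h i. h \<in> M}"
      note ext = cyclic_extension[OF M(1) a _ False p, folded M'_def]
      ultimately have ext: "subgroup M' G" "M \<subseteq> M'" "a \<in> M'" "rel_index G M' M = p"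
        using ext(1,2,3,5) by simp_all
      have "rel_index G M' ?E = p ^ Suc k"
        using rel_index_mult[OF E(1) M(1) ext(1) _ ext(2)] M ext(4) by simp
      moreover have "?E \<union> insert a T \<subseteq> M'" using ext M(2) by blast
      ultimately show ?thesis using ext(1) by blast
    qed
  qed
  from this[OF S(1,2)] obtain M k where M: "subgroup M G" "?E \<union> S \<subseteq> M" "rel_index G M ?E = p ^ k" by blast
  have "generate G S \<subseteq> M" by (rule generate_subgroup_incl) (use M in auto)
  then have "M = carrier G" using S(3) subgroup.subset[OF M(1)] by simp
  moreover have "?E \<lhd> G"
    unfolding normal_inv_iff
  proof (intro conjI ballI E(1))
    fix g x assume g: "g \<in> carrier G" and x: "x \<in> ?E"
    have xG: "x \<in> carrier G" by (rule subgroup.mem_carrier[OF E(1) x])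
    have "g \<otimes> x \<otimes> inv g = (g \<otimes> x \<otimes> inv g \<otimes> inv x) \<otimes> x" using g xG by (simp add: m_assoc)
    moreover have "g \<otimes> x \<otimes> inv g \<otimes> inv x \<in> ?E" using comm_in_derived[OF g xG] E(2) by blast
    ultimately show "g \<otimes> x \<otimes> inv g \<in> ?E" using subgroup.m_closed[OF E(1) _ x] by metis
  qed
  ultimately show ?thesis using M(3) by (auto simp: p_power_normal_subgroups_iff)
qed

end

section \<open>Finite index subgroups of the pro-\<open>p\<close> completion\<close>

context group
begin

text \<open>The action on the cosets of \<open>L\<close> has a kernel of finite index inside \<open>L\<close>.\<close>

lemma finite_index_normal_core:
  assumes L: "subgroup L G" and fin: "rel_index G (carrier G) L > 0"
  shows "\<exists>C. C \<lhd> G \<and> C \<subseteq> L \<and> rel_index G (carrier G) C > 0"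
proof -
  define C where "C = {x \<in> carrier G. \<forall>g\<in>carrier G. L #> (g \<otimes> x) = L #> g}"
  have memC: "L #> (g \<otimes> x) = L #> g" if "x \<in> C" "g \<in> carrier G" for g x
    using that by (simp add: C_def)
  have CG: "C \<subseteq> carrier G" by (auto simp: C_def)
  have CL: "C \<subseteq> L"
  proof
    fix x assume x: "x \<in> C"
    then have xG: "x \<in> carrier G" using CG by blast
    have "L #> x = L #> \<one>" using memC[OF x one_closed] xG by simp
    then show "x \<in> L" using rcos_eq_iff[OF L xG one_closed] xG by simp
  qed
  have sub: "subgroup C G"
  proof (rule subgroupI)
    have "\<one> \<in> C" by (simp add: C_def)
    then show "C \<noteq> {}" by blast
    show "inv x \<in> C" if x: "x \<in> C" for x
    proof -
      have xG: "x \<in> carrier G" using x CG by blast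
      have "L #> (g \<otimes> inv x) = L #> g" if "g \<in> carrier G" for g
        using memC[OF x, of "g \<otimes> inv x"] that xG by (simp add: m_assoc)
      then show ?thesis using xG by (simp add: C_def)
    qed
    show "x \<otimes> y \<in> C" if xy: "x \<in> C" "y \<in> C" for x y
    proof -
      have cl: "x \<in> carrier G" "y \<in> carrier G" using xy CG by auto
      have "L #> (g \<otimes> (x \<otimes> y)) = L #> g" if "g \<in> carrier G" for g
        using memC[OF xy(2), of "g \<otimes> x"] memC[OF xy(1), of g] that cl by (simp add: m_assoc)
      then show ?thesis using cl by (simp add: C_def)
    qed
  qed (rule CG)
  have "C \<lhd> G"
    unfolding normal_inv_iff
  proof (intro conjI ballI sub)
    fix h x assume h: "h \<in> carrier G" and x: "x \<in> C"
    have xG: "x \<in> carrier G" using x CG by blast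
    have "L #> (g \<otimes> (h \<otimes> x \<otimes> inv h)) = L #> g" if g: "g \<in> carrier G" for g
    proof -
      have "L #> (g \<otimes> (h \<otimes> x \<otimes> inv h)) = (L #> (g \<otimes> h \<otimes> x)) #> inv h"
        using g h xG subgroup.subset[OF L] by (simp add: m_assoc coset_mult_assoc)
      also have "\<dots> = (L #> (g \<otimes> h)) #> inv h" using memC[OF x, of "g \<otimes> h"] g h by simp
      also have "\<dots> = L #> g" using g h subgroup.subset[OF L] by (simp add: m_assoc coset_mult_assoc)
      finally show ?thesis .
    qed
    then show "h \<otimes> x \<otimes> inv h \<in> C" using h xG by (simp add: C_def)
  qed
  moreover have "rel_index G (carrier G) C > 0"
  proof -
    let ?A = "(\<lambda>h. L #> h) ` carrier G"
    have finA: "finite ?A" using fin by (simp add: rel_index_def card_gt_0_iff)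
    define F where "F x = (\<lambda>K\<in>?A. K #> x)" for x
    have "C #> x = C #> y" if xy: "x \<in> carrier G" "y \<in> carrier G" and e: "F x = F y" for x y
    proof -
      have "L #> (g \<otimes> (x \<otimes> inv y)) = L #> g" if g: "g \<in> carrier G" for g
      proof -
        have "(L #> g) #> x = (L #> g) #> y" using fun_cong[OF e, of "L #> g"] g by (simp add: F_def)
        then have "L #> (g \<otimes> x) #> inv y = L #> (g \<otimes> y) #> inv y"
          using g xy subgroup.subset[OF L] by (simp add: coset_mult_assoc)
        then show ?thesis using g xy subgroup.subset[OF L] by (simp add: coset_mult_assoc m_assoc)
      qed
      then have "x \<otimes> inv y \<in> C" using xy by (simp add: C_def)
      then show ?thesis using rcos_eq_iff[OF sub xy] by simp
    qed
    then have "finite ((\<lambda>x. C #> x) ` carrier G)"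
    proof -
      assume *: "\<And>x y. x \<in> carrier G \<Longrightarrow> y \<in> carrier G \<Longrightarrow> F x = F y \<Longrightarrow> C #> x = C #> y"
      have "F ` carrier G \<subseteq> ?A \<rightarrow>\<^sub>E ?A"
      proof (intro image_subsetI)
        fix x assume x: "x \<in> carrier G"
        show "F x \<in> ?A \<rightarrow>\<^sub>E ?A"
          unfolding F_def
        proof (intro PiE_I)
          fix K assume K: "K \<in> ?A"
          then obtain g where g: "g \<in> carrier G" "K = L #> g" by blast
          have "K #> x = L #> (g \<otimes> x)" using g x subgroup.subset[OF L] by (simp add: coset_mult_assoc)
          then show "(\<lambda>K\<in>?A. K #> x) K \<in> ?A" using K g x by auto
        qed simp
      qed
      then have "finite (F ` carrier G)" using finA by (meson finite_PiE finite_subset)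
      moreover have "(\<lambda>x. C #> x) ` carrier G \<subseteq> (\<lambda>c. C #> (SOME y. y \<in> carrier G \<and> F y = c)) ` F ` carrier G"
      proof clarify
        fix x assume x: "x \<in> carrier G"
        have "(SOME y. y \<in> carrier G \<and> F y = F x) \<in> carrier G \<and> F (SOME y. y \<in> carrier G \<and> F y = F x) = F x"
          by (rule someI_ex) (use x in blast)
        then have "C #> x = C #> (SOME y. y \<in> carrier G \<and> F y = F x)" using * x by metis
        then show "C #> x \<in> (\<lambda>c. C #> (SOME y. y \<in> carrier G \<and> F y = c)) ` F ` carrier G" using x by blast
      qed
      ultimately show ?thesis by (meson finite_imageI finite_subset)
    qed
    then show ?thesis by (auto simp: rel_index_def card_gt_0_iff)
  qed
  ultimately show ?thesis using CL by blast
qed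

lemma normal_pow_index:
  assumes N: "N \<lhd> G" and x: "x \<in> carrier G" and m: "m = rel_index G (carrier G) N" "m > 0"
  shows "x [^] m \<in> N"
proof -
  interpret N: normal N G by (rule N)
  interpret Q: group "G Mod N" by (rule N.factorgroup_is_group)
  have "order (G Mod N) = m" using m by (simp add: order_def carrier_FactGroup rel_index_def)
  then have "(N #> x) [^]\<^bsub>G Mod N\<^esub> m = N"
    using Q.pow_order_eq_1[of "N #> x"] x by (simp add: carrier_FactGroup)
  then have "N #> x [^] m = N" using N.FactGroup_pow[OF x] by simp
  then show ?thesis using rcos_eq_normal[OF N] x by simp
qed

text \<open>By Sylow, another prime divisor q of the order would give a subgroup of order q. Its
  elements have order dividing both q and a power of \<open>p\<close>, hence are trivial.\<close>

lemma order_p_power_of_exponent: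
  assumes p: "prime p" and fin: "finite (carrier G)"
    and ex: "\<And>x. x \<in> carrier G \<Longrightarrow> x [^] (p ^ r) = \<one>"
  shows "\<exists>k. order G = p ^ k"
proof -
  have o0: "order G > 0" using fin order_gt_0_iff_finite by blast
  obtain n k where nk: "\<not> p dvd n" "order G = n * p ^ k"
    using prime_power_canonical[OF p, of "order G"] o0 by blast
  have "n = 1"
  proof (rule ccontr)
    assume "n \<noteq> 1"
    then obtain q where q: "prime q" "q dvd n" using prime_factor_nat by blast
    then obtain n' where n': "n = q * n'" by blast
    have "order G = q ^ 1 * (n' * p ^ k)" unfolding nk(2) n' by simp
    from sylow_thm[OF q(1) is_group this fin] obtain H where H: "subgroup H G" "card H = q" by auto
    interpret H: group "G\<lparr>carrier := H\<rparr>" by (rule subgroup_imp_group[OF H(1)])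
    have "q \<noteq> p" using q nk by blast
    then have cop: "coprime q (p ^ r)" using p q(1) by (simp add: primes_coprime)
    have "x = \<one>" if x: "x \<in> H" for x
    proof -
      have xG: "x \<in> carrier G" by (rule subgroup.mem_carrier[OF H(1) x])
      have "x [^]\<^bsub>G\<lparr>carrier := H\<rparr>\<^esub> q = \<one>" using H.pow_order_eq_1[of x] x H(2) by (simp add: order_def)
      then have "x [^] q = \<one>" using nat_pow_consistent by metis
      then have "ord x dvd q" using pow_eq_id[OF xG] by blast
      moreover have "ord x dvd p ^ r" using pow_eq_id[OF xG] ex[OF xG] by blast
      ultimately have "ord x = 1" using cop by (meson coprime_common_divisor_nat)
      then show ?thesis using ord_eq_1[OF xG] by simp
    qed
    then have "H \<subseteq> {\<one>}" by blast
    then have "card H \<le> 1" using card_mono[of "{\<one>}" H] by simp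
    then show False using H(2) prime_gt_1_nat[OF q(1)] by simp
  qed
  then show ?thesis using nk by auto
qed

end

text \<open>\<open>\<Gamma>\<close> is the inverse limit of the quotients of \<open>G\<close> along
  a descending sequence \<open>N k\<close> cofinal among the open subgroups. The coordinates
  \<open>\<pi> k\<close> are cosets, \<open>\<iota>\<close> is the canonical map,
  \<open>\<pi>_inj\<close> says that coordinates separate points, and \<open>complete\<close> that
  every compatible sequence of cosets is attained. Using a sequence in place of all normal subgroups
  makes limits available by induction on the level.\<close>

locale pro_p_limit = G: group G + \<Gamma>: group \<Gamma>
  for G :: "('a, 'b) monoid_scheme" and \<Gamma> :: "('c, 'd) monoid_scheme" +
  fixes p :: nat and N :: "nat \<Rightarrow> 'a set" and \<pi> :: "nat \<Rightarrow> 'c \<Rightarrow> 'a set" and \<iota> :: "'a \<Rightarrow> 'c"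
  assumes p: "prime p" and fg: "finitely_generated_group G"
    and N: "\<And>k. N k \<in> p_power_normal_subgroups p G"
    and N_dec: "\<And>k. N (Suc k) \<subseteq> N k"
    and N_cofinal: "\<And>H. H \<in> popen p G \<Longrightarrow> \<exists>k. N k \<subseteq> H"
    and \<pi>_coset: "\<And>k F. F \<in> carrier \<Gamma> \<Longrightarrow> \<exists>g\<in>carrier G. \<pi> k F = N k #>\<^bsub>G\<^esub> g"
    and \<pi>_mult: "\<And>k F F'. F \<in> carrier \<Gamma> \<Longrightarrow> F' \<in> carrier \<Gamma> \<Longrightarrow>
      \<pi> k (F \<otimes>\<^bsub>\<Gamma>\<^esub> F') = \<pi> k F <#>\<^bsub>G\<^esub> \<pi> k F'"
    and \<pi>_step: "\<And>k F g. F \<in> carrier \<Gamma> \<Longrightarrow> g \<in> carrier G \<Longrightarrow> \<pi> (Suc k) F = N (Suc k) #>\<^bsub>G\<^esub> g \<Longrightarrow>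
      \<pi> k F = N k #>\<^bsub>G\<^esub> g"
    and \<iota>_hom: "\<iota> \<in> hom G \<Gamma>"
    and \<pi>_\<iota>: "\<And>k g. g \<in> carrier G \<Longrightarrow> \<pi> k (\<iota> g) = N k #>\<^bsub>G\<^esub> g"
    and \<pi>_inj: "\<And>F F'. F \<in> carrier \<Gamma> \<Longrightarrow> F' \<in> carrier \<Gamma> \<Longrightarrow> (\<And>k. \<pi> k F = \<pi> k F') \<Longrightarrow> F = F'"
    and complete: "\<And>g. (\<And>k. g k \<in> carrier G) \<Longrightarrow>
      (\<And>k. N k #>\<^bsub>G\<^esub> g (Suc k) = N k #>\<^bsub>G\<^esub> g k) \<Longrightarrow>
      \<exists>F\<in>carrier \<Gamma>. \<forall>k. \<pi> k F = N k #>\<^bsub>G\<^esub> g k"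
begin

text \<open>A representative in \<open>G\<close> of the \<open>k\<close>-th coordinate. Calculations
  in \<open>\<Gamma>\<close> are done on such representatives.\<close>

definition approx :: "nat \<Rightarrow> 'c \<Rightarrow> 'a \<Rightarrow> bool" where
  "approx k F g \<longleftrightarrow> F \<in> carrier \<Gamma> \<and> g \<in> carrier G \<and> \<pi> k F = N k #>\<^bsub>G\<^esub> g"

text \<open>The topological closure of the image of \<open>H\<close> in the limit, expressed by
  coordinates.\<close>

definition clos :: "'a set \<Rightarrow> 'c set" where
  "clos H = {F \<in> carrier \<Gamma>. \<forall>k. \<exists>h\<in>H. \<pi> k F = N k #>\<^bsub>G\<^esub> h}"

section \<open>Coordinates and closures in the limit\<close>

lemma nN: "N k \<lhd> G" using N by (simp add: G.p_power_normal_subgroups_iff)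

lemma sN: "subgroup (N k) G" using normal_imp_subgroup[OF nN] .

lemma NG: "N k \<subseteq> carrier G" using G.normal_subset[OF nN] .

lemma N_antimono: "j \<le> k \<Longrightarrow> N k \<subseteq> N j"
  by (induction rule: dec_induct) (use N_dec in blast)+

lemma approx_ex: "F \<in> carrier \<Gamma> \<Longrightarrow> \<exists>g. approx k F g"
  using \<pi>_coset[of F k] by (auto simp: approx_def)

lemma approx_carrier: "approx k F g \<Longrightarrow> F \<in> carrier \<Gamma> \<and> g \<in> carrier G"
  by (simp add: approx_def)

lemma approx_\<iota>: "g \<in> carrier G \<Longrightarrow> approx k (\<iota> g) g"
  using \<pi>_\<iota> \<iota>_hom by (auto simp: approx_def hom_def)

lemma approx_mult: "approx k F g \<Longrightarrow> approx k F' g' \<Longrightarrow> approx k (F \<otimes>\<^bsub>\<Gamma>\<^esub> F') (g \<otimes>\<^bsub>G\<^esub> g')"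
  using \<pi>_mult normal.rcos_sum[OF nN] by (simp add: approx_def)

lemma approx_cong: "approx k F g \<Longrightarrow> approx k F g' \<longleftrightarrow> g' \<in> carrier G \<and> N k #>\<^bsub>G\<^esub> g = N k #>\<^bsub>G\<^esub> g'"
  by (auto simp: approx_def)

lemma \<iota>_closed: "g \<in> carrier G \<Longrightarrow> \<iota> g \<in> carrier \<Gamma>"
  using \<iota>_hom by (auto simp: hom_def)

lemma \<iota>_one: "\<iota> \<one>\<^bsub>G\<^esub> = \<one>\<^bsub>\<Gamma>\<^esub>"
  using hom_one[OF \<iota>_hom G.is_group \<Gamma>.is_group] .

lemma approx_one: "approx k \<one>\<^bsub>\<Gamma>\<^esub> \<one>\<^bsub>G\<^esub>"
  using approx_\<iota>[OF G.one_closed, of k] by (simp add: \<iota>_one)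

lemma approx_inv: assumes "approx k F g" shows "approx k (inv\<^bsub>\<Gamma>\<^esub> F) (inv\<^bsub>G\<^esub> g)"
proof -
  have cl: "F \<in> carrier \<Gamma>" "g \<in> carrier G" using assms by (auto simp: approx_def)
  obtain h where h: "approx k (inv\<^bsub>\<Gamma>\<^esub> F) h" using approx_ex cl by blast
  then have hG: "h \<in> carrier G" by (simp add: approx_def)
  have "approx k \<one>\<^bsub>\<Gamma>\<^esub> (h \<otimes>\<^bsub>G\<^esub> g)" using approx_mult[OF h assms] cl by simp
  then have "N k #>\<^bsub>G\<^esub> (h \<otimes>\<^bsub>G\<^esub> g) = N k #>\<^bsub>G\<^esub> \<one>\<^bsub>G\<^esub>" using approx_cong[OF approx_one] by simp
  then have "h \<otimes>\<^bsub>G\<^esub> g \<in> N k" using G.rcos_eq_iff[OF sN, of "h \<otimes>\<^bsub>G\<^esub> g" "\<one>\<^bsub>G\<^esub>"] hG cl by simp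
  then have "N k #>\<^bsub>G\<^esub> h = N k #>\<^bsub>G\<^esub> inv\<^bsub>G\<^esub> g" using G.rcos_eq_iff[OF sN, of h "inv\<^bsub>G\<^esub> g"] hG cl by simp
  then show ?thesis using approx_cong[OF h] cl by simp
qed

lemma approx_pow: "approx k F g \<Longrightarrow> approx k (F [^]\<^bsub>\<Gamma>\<^esub> (n::nat)) (g [^]\<^bsub>G\<^esub> n)"
  by (induction n) (simp_all add: approx_one approx_mult)

lemma approx_mono: assumes "approx k F g" "j \<le> k" shows "approx j F g"
  using assms(2,1)
proof (induction rule: dec_induct)
  case (step i)
  have "approx i F g"
    using step.prems \<pi>_step[of F g i] unfolding approx_def by blast
  then show ?case by (rule step.IH)
qed

lemma approx_comm_prod:
  "list_all2 (approx k) Xs xs \<Longrightarrow> set as \<subseteq> carrier G \<Longrightarrow>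
    approx k (comm_prod \<Gamma> Xs (map \<iota> as)) (comm_prod G xs as)"
proof (induction arbitrary: as rule: list_all2_induct)
  case Nil
  then show ?case by (simp add: approx_one)
next
  case (Cons X Xs x xs)
  show ?case
  proof (cases as)
    case Nil
    then show ?thesis by (simp add: approx_one)
  next
    case (Cons a as')
    then show ?thesis using Cons.IH[of as'] Cons.hyps Cons.prems
      by (auto intro!: approx_mult approx_inv approx_\<iota>)
  qed
qed

text \<open>Once \<open>N k\<close> lies in \<open>H\<close>, membership in the closure is decided
  by any representative of the \<open>k\<close>-th coordinate: deeper coordinates differ from it by
  elements of \<open>N k\<close>.\<close>

lemma clos_approx:
  assumes H: "subgroup H G" and k: "N k \<subseteq> H" and a: "approx k F g"
  shows "F \<in> clos H \<longleftrightarrow> g \<in> H"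
proof -
  have cl: "F \<in> carrier \<Gamma>" "g \<in> carrier G" using a by (auto simp: approx_def)
  have key: "g \<in> H" if "h \<in> H" "N j #>\<^bsub>G\<^esub> g = N j #>\<^bsub>G\<^esub> h" "N j \<subseteq> H" "g \<in> carrier G" for g h j
  proof -
    have hG: "h \<in> carrier G" by (rule subgroup.mem_carrier[OF H that(1)])
    have "g \<otimes>\<^bsub>G\<^esub> inv\<^bsub>G\<^esub> h \<in> H" using G.rcos_eq_iff[OF sN that(4) hG] that by blast
    then have "g \<otimes>\<^bsub>G\<^esub> inv\<^bsub>G\<^esub> h \<otimes>\<^bsub>G\<^esub> h \<in> H" using subgroup.m_closed[OF H] that(1) by blast
    then show ?thesis using hG that(4) by (simp add: G.m_assoc)
  qed
  show ?thesis
  proof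
    assume "F \<in> clos H"
    then obtain h where h: "h \<in> H" "\<pi> k F = N k #>\<^bsub>G\<^esub> h" unfolding clos_def by blast
    then show "g \<in> H" using key[OF h(1) _ k cl(2)] a by (simp add: approx_def)
  next
    assume g: "g \<in> H"
    have "\<exists>h\<in>H. \<pi> j F = N j #>\<^bsub>G\<^esub> h" for j
    proof (cases "j \<le> k")
      case True
      then show ?thesis using approx_mono[OF a] g by (auto simp: approx_def)
    next
      case False
      then have jk: "k \<le> j" by simp
      obtain g' where g': "approx j F g'" using approx_ex cl by blast
      then have "approx k F g'" using approx_mono jk by blast
      then have "N k #>\<^bsub>G\<^esub> g' = N k #>\<^bsub>G\<^esub> g" "g' \<in> carrier G" using approx_cong[OF a] by auto
      then have "g' \<in> H" using key[OF g _ k] by blast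
      then show ?thesis using g' by (auto simp: approx_def)
    qed
    then show "F \<in> clos H" using cl by (simp add: clos_def)
  qed
qed

lemma clos_\<iota>:
  assumes "H \<in> popen p G" "g \<in> carrier G"
  shows "\<iota> g \<in> clos H \<longleftrightarrow> g \<in> H"
  using N_cofinal[OF assms(1)] clos_approx[OF G.popen_subgroup[OF assms(1)] _ approx_\<iota>[OF assms(2)]] by blast

lemma clos_subgroup:
  assumes H: "subgroup H G" shows "subgroup (clos H) \<Gamma>"
proof (rule \<Gamma>.subgroupI)
  have HG: "h \<in> carrier G" if "h \<in> H" for h by (rule subgroup.mem_carrier[OF H that])
  show "clos H \<subseteq> carrier \<Gamma>" by (auto simp: clos_def)
  have "\<one>\<^bsub>\<Gamma>\<^esub> \<in> clos H"
    using approx_one subgroup.one_closed[OF H] by (auto simp: clos_def approx_def)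
  then show "clos H \<noteq> {}" by blast
  show "inv\<^bsub>\<Gamma>\<^esub> F \<in> clos H" if F: "F \<in> clos H" for F
  proof -
    have "\<exists>h\<in>H. \<pi> k (inv\<^bsub>\<Gamma>\<^esub> F) = N k #>\<^bsub>G\<^esub> h" for k
    proof -
      have "\<exists>h\<in>H. \<pi> k F = N k #>\<^bsub>G\<^esub> h" "F \<in> carrier \<Gamma>" using F by (simp_all add: clos_def)
      then obtain h where h: "h \<in> H" "approx k F h" using HG unfolding approx_def by blast
      then show ?thesis using approx_inv[OF h(2)] subgroup.m_inv_closed[OF H h(1)] by (auto simp: approx_def)
    qed
    then show ?thesis using F by (simp add: clos_def)
  qed
  show "F \<otimes>\<^bsub>\<Gamma>\<^esub> F' \<in> clos H" if F: "F \<in> clos H" "F' \<in> clos H" for F F'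
  proof -
    have "\<exists>h\<in>H. \<pi> k (F \<otimes>\<^bsub>\<Gamma>\<^esub> F') = N k #>\<^bsub>G\<^esub> h" for k
    proof -
      obtain h h' where h: "h \<in> H" "approx k F h" "h' \<in> H" "approx k F' h'"
      proof -
        have "\<exists>h\<in>H. \<pi> k F = N k #>\<^bsub>G\<^esub> h" "F \<in> carrier \<Gamma>"
          "\<exists>h\<in>H. \<pi> k F' = N k #>\<^bsub>G\<^esub> h" "F' \<in> carrier \<Gamma>" using F by (simp_all add: clos_def)
        then show ?thesis using HG that unfolding approx_def by blast
      qed
      then show ?thesis using approx_mult[OF h(2,4)] subgroup.m_closed[OF H h(1,3)] by (auto simp: approx_def)
    qed
    then show ?thesis using F by (simp add: clos_def)
  qed
qed

lemma clos_carrier: "clos (carrier G) = carrier \<Gamma>"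
  using \<pi>_coset by (auto simp: clos_def)

lemma clos_inj:
  assumes "H \<in> popen p G" "K \<in> popen p G" "clos H = clos K"
  shows "H = K"
proof -
  have "g \<in> H \<longleftrightarrow> g \<in> K" if "g \<in> carrier G" for g
    using clos_\<iota>[OF assms(1) that] clos_\<iota>[OF assms(2) that] assms(3) by simp
  then show ?thesis
    using subgroup.subset[OF G.popen_subgroup[OF assms(1)]] subgroup.subset[OF G.popen_subgroup[OF assms(2)]] by blast
qed

text \<open>At a level with \<open>N k\<close> inside \<open>H\<close>, equality of cosets of the
  closure is equality of \<open>H\<close>-cosets of representatives. Each coset of the closure
  contains an element of the image of \<open>\<iota>\<close>, so the coset counts agree.\<close>

lemma clos_index:
  assumes H: "H \<in> popen p G"
  shows "rel_index \<Gamma> (carrier \<Gamma>) (clos H) = rel_index G (carrier G) H"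
proof -
  obtain k where k: "N k \<subseteq> H" using N_cofinal[OF H] by blast
  note sH = G.popen_subgroup[OF H]
  note sC = clos_subgroup[OF sH]
  have eq: "clos H #>\<^bsub>\<Gamma>\<^esub> F = clos H #>\<^bsub>\<Gamma>\<^esub> F' \<longleftrightarrow> H #>\<^bsub>G\<^esub> g = H #>\<^bsub>G\<^esub> g'"
    if "approx k F g" "approx k F' g'" for F F' g g'
  proof -
    have "clos H #>\<^bsub>\<Gamma>\<^esub> F = clos H #>\<^bsub>\<Gamma>\<^esub> F' \<longleftrightarrow> F \<otimes>\<^bsub>\<Gamma>\<^esub> inv\<^bsub>\<Gamma>\<^esub> F' \<in> clos H"
      using \<Gamma>.rcos_eq_iff[OF sC] that approx_carrier by simp
    also have "\<dots> \<longleftrightarrow> g \<otimes>\<^bsub>G\<^esub> inv\<^bsub>G\<^esub> g' \<in> H"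
      using clos_approx[OF sH k approx_mult[OF that(1) approx_inv[OF that(2)]]] .
    also have "\<dots> \<longleftrightarrow> H #>\<^bsub>G\<^esub> g = H #>\<^bsub>G\<^esub> g'"
      using G.rcos_eq_iff[OF sH] that approx_carrier by simp
    finally show ?thesis .
  qed
  have "(\<lambda>F. clos H #>\<^bsub>\<Gamma>\<^esub> F) ` carrier \<Gamma> = (\<lambda>g. clos H #>\<^bsub>\<Gamma>\<^esub> \<iota> g) ` carrier G"
  proof
    show "(\<lambda>F. clos H #>\<^bsub>\<Gamma>\<^esub> F) ` carrier \<Gamma> \<subseteq> (\<lambda>g. clos H #>\<^bsub>\<Gamma>\<^esub> \<iota> g) ` carrier G"
    proof clarify
      fix F assume "F \<in> carrier \<Gamma>"
      then obtain g where g: "approx k F g" using approx_ex by blast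
      then have gG: "g \<in> carrier G" using approx_carrier by blast
      have "clos H #>\<^bsub>\<Gamma>\<^esub> F = clos H #>\<^bsub>\<Gamma>\<^esub> \<iota> g" using eq[OF g approx_\<iota>[OF gG]] by simp
      then show "clos H #>\<^bsub>\<Gamma>\<^esub> F \<in> (\<lambda>g. clos H #>\<^bsub>\<Gamma>\<^esub> \<iota> g) ` carrier G" using gG by blast
    qed
    show "(\<lambda>g. clos H #>\<^bsub>\<Gamma>\<^esub> \<iota> g) ` carrier G \<subseteq> (\<lambda>F. clos H #>\<^bsub>\<Gamma>\<^esub> F) ` carrier \<Gamma>"
      using \<iota>_closed by blast
  qed
  moreover have "card ((\<lambda>g. clos H #>\<^bsub>\<Gamma>\<^esub> \<iota> g) ` carrier G) = card ((\<lambda>g. H #>\<^bsub>G\<^esub> g) ` carrier G)"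
    by (rule card_image_eqI) (rule eq[OF approx_\<iota> approx_\<iota>])
  ultimately show ?thesis by (simp add: rel_index_def)
qed

text \<open>\<open>Y\<close> is \<open>F\<close> raised to the \<open>p\<close>-adic integer \<open>1/m\<close>.\<close>

lemma coprime_root:
  assumes F: "F \<in> carrier \<Gamma>" and m: "coprime m p"
  shows "\<exists>Y\<in>carrier \<Gamma>. Y [^]\<^bsub>\<Gamma>\<^esub> m = F"
proof -
  obtain n where n: "rel_index G (carrier G) (N k) = p ^ n k" for k
    using N unfolding G.p_power_normal_subgroups_iff by metis
  obtain g where g: "approx k F (g k)" for k using approx_ex[OF F] by metis
  have gG: "g k \<in> carrier G" for k using g approx_carrier by blast
  have "\<exists>e. [m * e = 1] (mod p ^ n k)" for k
    using m cong_solve_coprime_nat[of m "p ^ n k"] by simp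
  \<comment> \<open>At level \<open>k\<close> exponents matter only modulo \<open>p ^ n k\<close>,
    and there \<open>e k\<close> is an inverse of \<open>m\<close>.\<close>
  then obtain e where e: "[m * e k = 1] (mod p ^ n k)" for k by metis
  have pw: "g j [^]\<^bsub>G\<^esub> (p ^ n k) \<in> N k" for j k
    using G.normal_pow_index[OF nN gG n[symmetric]] prime_gt_0_nat[OF p] by simp
  have red: "N k #>\<^bsub>G\<^esub> g j [^]\<^bsub>G\<^esub> (a::nat) = N k #>\<^bsub>G\<^esub> g j [^]\<^bsub>G\<^esub> b" if "[a = b] (mod p ^ n k)" for j k a b
    using G.pow_coset_mod[OF sN gG pw[of j k], of a] G.pow_coset_mod[OF sN gG pw[of j k], of b] that
    by (simp add: cong_def)
  \<comment> \<open>Modulo \<open>p ^ n k\<close> the inverse of \<open>m\<close> is unique, so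
    \<open>e (Suc k)\<close> reduces to \<open>e k\<close> there. This makes the powers a compatible
    sequence.\<close>
  have n_mono: "p ^ n k dvd p ^ n (Suc k)" for k
    using G.rel_index_mult[OF sN sN G.subgroup_self N_dec NG] n by (metis dvd_triv_left)
  have step: "N k #>\<^bsub>G\<^esub> g (Suc k) [^]\<^bsub>G\<^esub> e (Suc k) = N k #>\<^bsub>G\<^esub> g k [^]\<^bsub>G\<^esub> e k" for k
  proof -
    have "[m * e (Suc k) = 1] (mod p ^ n k)" using e[of "Suc k"] n_mono cong_dvd_modulus_nat by blast
    then have "[m * e (Suc k) = m * e k] (mod p ^ n k)" using e[of k] by (meson cong_sym cong_trans)
    then have "[e (Suc k) = e k] (mod p ^ n k)"
      using m by (subst (asm) cong_mult_lcancel_nat) simp_all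
    then have "N k #>\<^bsub>G\<^esub> g (Suc k) [^]\<^bsub>G\<^esub> e (Suc k) = N k #>\<^bsub>G\<^esub> g (Suc k) [^]\<^bsub>G\<^esub> e k" by (rule red)
    also have "approx k F (g (Suc k))" using approx_mono[OF g] by simp
    then have "N k #>\<^bsub>G\<^esub> g (Suc k) [^]\<^bsub>G\<^esub> e k = N k #>\<^bsub>G\<^esub> g k [^]\<^bsub>G\<^esub> e k"
      using approx_cong[OF g] gG by (intro G.rcos_cong_pow[OF nN]) auto
    finally show ?thesis .
  qed
  obtain Y where Y: "Y \<in> carrier \<Gamma>" "\<And>k. \<pi> k Y = N k #>\<^bsub>G\<^esub> g k [^]\<^bsub>G\<^esub> e k"
    using complete[of "\<lambda>k. g k [^]\<^bsub>G\<^esub> e k"] step gG by auto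
  have "Y [^]\<^bsub>\<Gamma>\<^esub> m = F"
  proof (rule \<pi>_inj)
    fix k
    have "approx k Y (g k [^]\<^bsub>G\<^esub> e k)" using Y gG by (simp add: approx_def)
    from approx_pow[OF this, of m] have "\<pi> k (Y [^]\<^bsub>\<Gamma>\<^esub> m) = N k #>\<^bsub>G\<^esub> g k [^]\<^bsub>G\<^esub> (m * e k)"
      using gG by (simp add: approx_def G.nat_pow_pow mult.commute)
    also have "\<dots> = N k #>\<^bsub>G\<^esub> g k [^]\<^bsub>G\<^esub> (1::nat)" by (rule red[OF e])
    also have "\<dots> = \<pi> k F" using g[of k] gG by (simp add: approx_def)
    finally show "\<pi> k (Y [^]\<^bsub>\<Gamma>\<^esub> m) = \<pi> k F" .
  qed (use Y F in auto)
  then show ?thesis using Y by blast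
qed

text \<open>Write the index as \<open>n * p ^ r\<close> with \<open>n\<close> prime to
  \<open>p\<close>. Any \<open>F\<close> is an \<open>n\<close>-th power of some \<open>Y\<close>,
  so its power with exponent \<open>p ^ r\<close> is the power of \<open>Y\<close> whose exponent is
  the index, which lies in \<open>C\<close>. Thus the quotient has exponent dividing
  \<open>p ^ r\<close>.\<close>

lemma normal_finite_index_p_power:
  assumes C: "C \<lhd> \<Gamma>" and fin: "rel_index \<Gamma> (carrier \<Gamma>) C > 0"
  shows "\<exists>k. rel_index \<Gamma> (carrier \<Gamma>) C = p ^ k"
proof -
  interpret C: normal C \<Gamma> by (rule C)
  interpret Q: group "\<Gamma> Mod C" by (rule C.factorgroup_is_group)
  let ?m = "rel_index \<Gamma> (carrier \<Gamma>) C"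
  have ord: "order (\<Gamma> Mod C) = ?m" by (simp add: order_def carrier_FactGroup rel_index_def)
  obtain n r where nr: "\<not> p dvd n" "?m = n * p ^ r"
    using prime_power_canonical[OF p, of ?m] fin by blast
  have cop: "coprime n p" using nr(1) p by (metis coprime_commute prime_imp_coprime)
  have "\<exists>k. order (\<Gamma> Mod C) = p ^ k"
  proof (rule Q.order_p_power_of_exponent[OF p])
    show "finite (carrier (\<Gamma> Mod C))" using fin ord Q.order_gt_0_iff_finite by simp
    fix X assume "X \<in> carrier (\<Gamma> Mod C)"
    then obtain F where F: "F \<in> carrier \<Gamma>" "X = C #>\<^bsub>\<Gamma>\<^esub> F" by (auto simp: carrier_FactGroup)
    obtain Y where Y: "Y \<in> carrier \<Gamma>" "Y [^]\<^bsub>\<Gamma>\<^esub> n = F" using coprime_root[OF F(1) cop] by blast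
    have "F [^]\<^bsub>\<Gamma>\<^esub> (p ^ r) = Y [^]\<^bsub>\<Gamma>\<^esub> ?m" using Y nr(2) by (simp add: \<Gamma>.nat_pow_pow[symmetric])
    also have "\<dots> \<in> C" by (rule \<Gamma>.normal_pow_index[OF C Y(1) refl fin])
    finally have "C #>\<^bsub>\<Gamma>\<^esub> (F [^]\<^bsub>\<Gamma>\<^esub> (p ^ r)) = C" using \<Gamma>.rcos_eq_normal[OF C] F(1) by simp
    then show "X [^]\<^bsub>\<Gamma> Mod C\<^esub> (p ^ r) = \<one>\<^bsub>\<Gamma> Mod C\<^esub>" using C.FactGroup_pow[OF F(1)] F(2) by simp
  qed
  then show ?thesis using ord by simp
qed

text \<open>
  Serre's argument: by compactness, elements of the closure of \<open>H\<^sup>p[H, H]\<close> are of the form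
  \<open>[X\<^sub>1, a\<^sub>1] \<cdots> [X\<^sub>d, a\<^sub>d] Y\<^sup>p\<close> with \<open>X\<^sub>i, Y\<close> in the closure of \<open>H\<close>.
\<close>

lemma clos_power_derived:
  assumes H: "H \<in> popen p G" and as: "set as \<subseteq> H" "generate G (set as) = H"
    and F: "F \<in> clos (power_derived p (G\<lparr>carrier := H\<rparr>))"
  shows "\<exists>Xs Y. length Xs = length as \<and> set Xs \<subseteq> clos H \<and> Y \<in> clos H \<and>
    F = comm_prod \<Gamma> Xs (map \<iota> as) \<otimes>\<^bsub>\<Gamma>\<^esub> Y [^]\<^bsub>\<Gamma>\<^esub> p"
proof -
  note sH = G.popen_subgroup[OF H]
  have HG: "H \<subseteq> carrier G" by (rule subgroup.subset[OF sH])
  have asG: "set as \<subseteq> carrier G" using as HG by blast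
  interpret H: group "G\<lparr>carrier := H\<rparr>" by (rule G.subgroup_imp_group[OF sH])
  let ?E = "power_derived p (G\<lparr>carrier := H\<rparr>)"
  have gen: "generate (G\<lparr>carrier := H\<rparr>) (set as) = H"
    using G.generate_consistent[OF as(1) sH] as(2) by simp
  have F\<Gamma>: "F \<in> carrier \<Gamma>" using F by (simp add: clos_def)
  obtain k0 where k0: "N k0 \<subseteq> H" using N_cofinal[OF H] by blast
  \<comment> \<open>All unknowns are packed into one list: the head is the base of the
    \<open>p\<close>-th power and the tail holds the commutator entries. Koenig's lemma then applies
    to them simultaneously.\<close>
  define W where "W zs = comm_prod G (tl zs) as \<otimes>\<^bsub>G\<^esub> hd zs [^]\<^bsub>G\<^esub> p" for zs
  define P where "P k zs \<longleftrightarrow> length zs = Suc (length as) \<and> set zs \<subseteq> H \<and> approx k F (W zs)" for k zs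
  have "\<exists>zs. \<forall>k. P k (zs k) \<and> map (\<lambda>z. N k #>\<^bsub>G\<^esub> z) (zs (Suc k)) = map (\<lambda>z. N k #>\<^bsub>G\<^esub> z) (zs k)"
  proof (rule koenig_sequence)
    show "P k zs" if "P (Suc k) zs" for k zs
      using that approx_mono[of "Suc k" F "W zs" k] by (simp add: P_def)
    show "\<exists>zs. P k zs" for k
    proof -
      \<comment> \<open>The commutator lemma is applied inside \<open>H\<close> and requires
        \<open>N k'\<close> to lie in \<open>H\<close>. The level is raised to at least
        \<open>k0\<close>, and the resulting approximation is read again at level
        \<open>k\<close>.\<close>
      define k' where "k' = max k k0"
      have Nk': "N k' \<subseteq> H" using N_antimono[of k0 k'] k0 by (auto simp: k'_def)
      obtain h where h: "h \<in> ?E" "\<pi> k' F = N k' #>\<^bsub>G\<^esub> h" using F by (auto simp: clos_def)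
      then obtain c y where c: "c \<in> derived (G\<lparr>carrier := H\<rparr>) H" and y: "y \<in> H"
        and hcy: "h = c \<otimes>\<^bsub>G\<^esub> y [^]\<^bsub>G\<^esub> p"
        unfolding power_derived_def using G.nat_pow_consistent[of _ p H] by auto
      have nNH: "N k' \<lhd> G\<lparr>carrier := H\<rparr>" by (rule G.normal_restrict_supergroup[OF sH nN Nk'])
      obtain n where "rel_index G (carrier G) (N k') = p ^ n"
        using N unfolding G.p_power_normal_subgroups_iff by blast
      then have "p ^ n = rel_index G (carrier G) H * rel_index G H (N k')"
        using G.rel_index_mult[OF sN sH G.subgroup_self Nk' HG] by simp
      then have "rel_index G H (N k') dvd p ^ n" by simp
      then obtain l where l: "rel_index G H (N k') = p ^ l" using divides_primepow_nat[OF p] by blast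
      obtain xs where xs: "length xs = length as" "set xs \<subseteq> H"
        "N k' #>\<^bsub>G\<^esub> c = N k' #>\<^bsub>G\<^esub> comm_prod (G\<lparr>carrier := H\<rparr>) xs as"
        using H.derived_comm_prod_approx[OF p _ _ nNH, of as l c] as(1) gen l c
        by (auto simp: rel_index_carrier)
      have cG: "c \<in> carrier G" using H.derived_in_carrier[of H] c HG by auto
      have yG: "y \<in> carrier G" using y HG by blast
      have xsG: "set xs \<subseteq> carrier G" using xs(2) HG by blast
      have PG: "comm_prod G xs as \<in> carrier G" using G.comm_prod_closed[OF xsG asG] .
      have "N k' #>\<^bsub>G\<^esub> h = N k' #>\<^bsub>G\<^esub> (comm_prod G xs as \<otimes>\<^bsub>G\<^esub> y [^]\<^bsub>G\<^esub> p)"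
        unfolding hcy using xs(3) G.comm_prod_consistent[OF sH xs(2) as(1)] cG PG yG
        by (intro G.rcos_cong_mult[OF nN] refl) auto
      then have "approx k' F (W (y # xs))"
        using h(2) F\<Gamma> PG yG by (simp add: approx_def W_def)
      then have "approx k F (W (y # xs))" by (rule approx_mono) (simp add: k'_def)
      then show ?thesis using xs y by (intro exI[of _ "y # xs"]) (simp add: P_def)
    qed
    show "finite (map (\<lambda>z. N k #>\<^bsub>G\<^esub> z) ` {zs. P k zs})" for k
    proof -
      let ?A = "(\<lambda>z. N k #>\<^bsub>G\<^esub> z) ` carrier G"
      have "rel_index G (carrier G) (N k) > 0"
        by (rule G.popen_index_pos[OF p G.p_power_normal_popen[OF N]])
      then have "finite ?A" by (simp add: rel_index_def card_gt_0_iff)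
      then have "finite {xs. set xs \<subseteq> ?A \<and> length xs = Suc (length as)}" by (rule finite_lists_length_eq)
      moreover have "map (\<lambda>z. N k #>\<^bsub>G\<^esub> z) ` {zs. P k zs} \<subseteq> {xs. set xs \<subseteq> ?A \<and> length xs = Suc (length as)}"
        by (auto simp: P_def intro!: imageI subsetD[OF HG])
      ultimately show ?thesis using finite_subset by blast
    qed
  qed
  then obtain zs where zs: "\<And>k. P k (zs k)"
    and comp: "\<And>k. map (\<lambda>z. N k #>\<^bsub>G\<^esub> z) (zs (Suc k)) = map (\<lambda>z. N k #>\<^bsub>G\<^esub> z) (zs k)" by blast
  let ?d = "Suc (length as)"
  have len: "length (zs k) = ?d" for k using zs[of k] by (simp add: P_def)
  have zH: "zs k ! i \<in> H" if "i < ?d" for k i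
    using zs[of k] nth_mem[of i "zs k"] that by (auto simp: P_def)
  have "\<exists>X\<in>carrier \<Gamma>. \<forall>k. \<pi> k X = N k #>\<^bsub>G\<^esub> zs k ! i" if i: "i < ?d" for i
  proof (rule complete)
    show "zs k ! i \<in> carrier G" for k using zH[OF i] HG by blast
    show "N k #>\<^bsub>G\<^esub> zs (Suc k) ! i = N k #>\<^bsub>G\<^esub> zs k ! i" for k
      using arg_cong[OF comp[of k], of "\<lambda>l. l ! i"] len i by simp
  qed
  then obtain X where X: "\<And>i. i < ?d \<Longrightarrow> X i \<in> carrier \<Gamma> \<and> (\<forall>k. \<pi> k (X i) = N k #>\<^bsub>G\<^esub> zs k ! i)" by metis
  have approxX: "approx k (X i) (zs k ! i)" if "i < ?d" for k i
    using X[OF that] zH[OF that] HG by (auto simp: approx_def)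
  have XH: "X i \<in> clos H" if "i < ?d" for i
    using X[OF that] zH[OF that] by (auto simp: clos_def)
  \<comment> \<open>Position 0 is reserved for the base of the \<open>p\<close>-th power, so the
    commutator entries start at 1.\<close>
  define Xs where "Xs = map X [1..<?d]"
  have XsH: "set Xs \<subseteq> clos H" using XH by (auto simp: Xs_def)
  have la: "list_all2 (approx k) Xs (tl (zs k))" for k
    unfolding list_all2_conv_all_nth using approxX len by (auto simp: Xs_def nth_tl simp del: upt_Suc)
  have "F = comm_prod \<Gamma> Xs (map \<iota> as) \<otimes>\<^bsub>\<Gamma>\<^esub> X 0 [^]\<^bsub>\<Gamma>\<^esub> p"
  proof (rule \<pi>_inj[OF F\<Gamma>])
    have "approx k (comm_prod \<Gamma> Xs (map \<iota> as) \<otimes>\<^bsub>\<Gamma>\<^esub> X 0 [^]\<^bsub>\<Gamma>\<^esub> p) (W (zs k))" for k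
    proof -
      have "hd (zs k) = zs k ! 0" using len[of k] by (cases "zs k") auto
      then show ?thesis unfolding W_def using approxX[of 0 k]
        by (intro approx_mult approx_pow approx_comm_prod[OF la asG]) simp
    qed
    moreover have "approx k F (W (zs k))" for k using zs[of k] by (simp add: P_def)
    ultimately show "comm_prod \<Gamma> Xs (map \<iota> as) \<otimes>\<^bsub>\<Gamma>\<^esub> X 0 [^]\<^bsub>\<Gamma>\<^esub> p \<in> carrier \<Gamma>"
      "\<pi> k F = \<pi> k (comm_prod \<Gamma> Xs (map \<iota> as) \<otimes>\<^bsub>\<Gamma>\<^esub> X 0 [^]\<^bsub>\<Gamma>\<^esub> p)" for k
      by (auto simp: approx_def)
  qed
  then show ?thesis using XsH XH[of 0] by (intro exI[of _ Xs] exI[of _ "X 0"]) (simp add: Xs_def del: upt_Suc)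
qed

text \<open>\<open>L\<close> is the kernel of an abstract homomorphism from the closure of
  \<open>H\<close> to Z/p. It contains the closure of \<open>power_derived\<close> of
  \<open>H\<close>, which is determined by one coordinate. Therefore membership in \<open>L\<close>
  also depends on one coordinate only, and \<open>L\<close> is the closure of its preimage
  \<open>K\<close> in \<open>H\<close>.\<close>

lemma normal_index_p_closed:
  assumes H: "H \<in> popen p G" and L: "L \<lhd> \<Gamma>\<lparr>carrier := clos H\<rparr>" and ind: "rel_index \<Gamma> (clos H) L = p"
  shows "\<exists>K\<in>popen p G. L = clos K"
proof -
  note sH = G.popen_subgroup[OF H]
  note sC = clos_subgroup[OF sH]
  have p0: "0 < p" by (rule prime_gt_0_nat[OF p])
  have HG: "H \<subseteq> carrier G" by (rule subgroup.subset[OF sH])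
  interpret C: group "\<Gamma>\<lparr>carrier := clos H\<rparr>" by (rule \<Gamma>.subgroup_imp_group[OF sC])
  interpret H: group "G\<lparr>carrier := H\<rparr>" by (rule G.subgroup_imp_group[OF sH])
  obtain \<tau> where \<tau>: "\<tau> \<in> mod_homs p (\<Gamma>\<lparr>carrier := clos H\<rparr>)" "L = hom_kernel (\<Gamma>\<lparr>carrier := clos H\<rparr>) \<tau>"
    using C.index_prime_hom[OF L _ p] ind by (auto simp: rel_index_carrier)
  have fgH: "finitely_generated_group (G\<lparr>carrier := H\<rparr>)" by (rule G.popen_finitely_generated[OF fg p H])
  then obtain S where S: "finite S" "S \<subseteq> H" "generate (G\<lparr>carrier := H\<rparr>) S = H"
    unfolding finitely_generated_group_def by auto
  obtain as where as: "set as = S" using finite_list[OF S(1)] by blast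
  have asH: "set as \<subseteq> H" using as S by simp
  have gen: "generate G (set as) = H" using G.generate_consistent[OF asH sH] S(3) as by simp
  let ?E = "power_derived p (G\<lparr>carrier := H\<rparr>)"
  have E: "?E \<in> popen p G"
    by (rule G.popen_trans[OF fg p H H.p_power_normal_popen[OF H.power_derived_p_power_normal[OF fgH p]]])
  have EH: "?E \<subseteq> H" using subgroup.subset[OF H.power_derived_subgroup(1)] by simp
  have sL: "subgroup L \<Gamma>" using \<Gamma>.subgroup_restrict_trans(1)[OF sC L] .
  have LC: "L \<subseteq> clos H" using \<Gamma>.subgroup_restrict_trans(2)[OF sC L] .
  have comm: "comm_prod (\<Gamma>\<lparr>carrier := clos H\<rparr>) Xs As \<in> L" if "set Xs \<subseteq> clos H" "set As \<subseteq> clos H" for Xs As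
    using that
  proof (induction Xs arbitrary: As)
    case Nil
    then show ?case using C.mod_homs_one[OF \<tau>(1) p0] C.one_closed unfolding \<tau>(2) hom_kernel_def by simp
  next
    case (Cons X Xs)
    show ?case
    proof (cases As)
      case Nil
      then show ?thesis using C.mod_homs_one[OF \<tau>(1) p0] C.one_closed unfolding \<tau>(2) hom_kernel_def by simp
    next
      case (Cons A As')
      let ?c = "X \<otimes>\<^bsub>\<Gamma>\<lparr>carrier := clos H\<rparr>\<^esub> A \<otimes>\<^bsub>\<Gamma>\<lparr>carrier := clos H\<rparr>\<^esub> inv\<^bsub>\<Gamma>\<lparr>carrier := clos H\<rparr>\<^esub> X
        \<otimes>\<^bsub>\<Gamma>\<lparr>carrier := clos H\<rparr>\<^esub> inv\<^bsub>\<Gamma>\<lparr>carrier := clos H\<rparr>\<^esub> A"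
      have XA: "X \<in> carrier (\<Gamma>\<lparr>carrier := clos H\<rparr>)" "A \<in> carrier (\<Gamma>\<lparr>carrier := clos H\<rparr>)"
        using Cons.prems \<open>As = A # As'\<close> by auto
      have "\<tau> ?c = 0" by (rule C.mod_homs_comm[OF \<tau>(1) p0 XA])
      moreover have "?c \<in> carrier (\<Gamma>\<lparr>carrier := clos H\<rparr>)"
        by (intro C.m_closed C.inv_closed XA)
      ultimately have "?c \<in> L" unfolding \<tau>(2) hom_kernel_def by blast
      moreover have "comm_prod (\<Gamma>\<lparr>carrier := clos H\<rparr>) Xs As' \<in> L"
        using Cons.IH[of As'] Cons.prems \<open>As = A # As'\<close> by simp
      ultimately show ?thesis
        using subgroup.m_closed[OF sL] \<open>As = A # As'\<close> by simp
    qed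
  qed
  \<comment> \<open>The elements are finite products of commutators and a \<open>p\<close>-th power
    rather than mere limits of such products, so \<tau> kills them whether or not it is
    continuous.\<close>
  have EL: "clos ?E \<subseteq> L"
  proof
    fix F assume "F \<in> clos ?E"
    from clos_power_derived[OF H asH gen this] obtain Xs Y where
      XY: "set Xs \<subseteq> clos H" "Y \<in> clos H" "F = comm_prod \<Gamma> Xs (map \<iota> as) \<otimes>\<^bsub>\<Gamma>\<^esub> Y [^]\<^bsub>\<Gamma>\<^esub> p" by blast
    have ia: "set (map \<iota> as) \<subseteq> clos H"
    proof
      fix A assume "A \<in> set (map \<iota> as)"
      then obtain a where a: "a \<in> set as" "A = \<iota> a" by auto
      then have "a \<in> H" "a \<in> carrier G" using asH HG by auto
      then show "A \<in> clos H" using clos_\<iota>[OF H, of a] a by simp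
    qed
    have "comm_prod \<Gamma> Xs (map \<iota> as) \<in> L"
      using comm[OF XY(1) ia] \<Gamma>.comm_prod_consistent[OF sC XY(1) ia] by simp
    moreover have "Y [^]\<^bsub>\<Gamma>\<^esub> p \<in> L"
    proof -
      have "\<tau> (Y [^]\<^bsub>\<Gamma>\<lparr>carrier := clos H\<rparr>\<^esub> p) = 0" using C.mod_homs_pow[OF \<tau>(1) p0, of Y p] XY(2) by simp
      moreover have "Y [^]\<^bsub>\<Gamma>\<lparr>carrier := clos H\<rparr>\<^esub> p \<in> carrier (\<Gamma>\<lparr>carrier := clos H\<rparr>)"
        by (rule C.nat_pow_closed) (use XY(2) in simp)
      ultimately have "Y [^]\<^bsub>\<Gamma>\<lparr>carrier := clos H\<rparr>\<^esub> p \<in> L" unfolding \<tau>(2) hom_kernel_def by blast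
      then show ?thesis using \<Gamma>.nat_pow_consistent[of Y p "clos H"] by simp
    qed
    ultimately show "F \<in> L" using subgroup.m_closed[OF sL] XY(3) by simp
  qed
  define K where "K = {h \<in> H. \<iota> h \<in> L}"
  have \<iota>m: "\<iota> (x \<otimes>\<^bsub>G\<^esub> y) = \<iota> x \<otimes>\<^bsub>\<Gamma>\<^esub> \<iota> y" if "x \<in> carrier G" "y \<in> carrier G" for x y
    using \<iota>_hom that by (simp add: hom_def)
  interpret \<iota>: group_hom G \<Gamma> \<iota> using \<iota>_hom by unfold_locales
  have sK: "subgroup K G"
  proof (rule G.subgroupI)
    show "K \<subseteq> carrier G" using HG by (auto simp: K_def)
    have "\<one>\<^bsub>G\<^esub> \<in> K" using subgroup.one_closed[OF sH] subgroup.one_closed[OF sL] by (simp add: K_def \<iota>_one)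
    then show "K \<noteq> {}" by blast
    show "inv\<^bsub>G\<^esub> x \<in> K" if "x \<in> K" for x
    proof -
      have x: "x \<in> H" "\<iota> x \<in> L" "x \<in> carrier G" using that HG by (auto simp: K_def)
      then show ?thesis using subgroup.m_inv_closed[OF sH x(1)] subgroup.m_inv_closed[OF sL x(2)] by (simp add: K_def)
    qed
    show "x \<otimes>\<^bsub>G\<^esub> y \<in> K" if "x \<in> K" "y \<in> K" for x y
    proof -
      have x: "x \<in> H" "\<iota> x \<in> L" "x \<in> carrier G" using that(1) HG by (auto simp: K_def)
      have y: "y \<in> H" "\<iota> y \<in> L" "y \<in> carrier G" using that(2) HG by (auto simp: K_def)
      show ?thesis using subgroup.m_closed[OF sH x(1) y(1)] subgroup.m_closed[OF sL x(2) y(2)] \<iota>m[OF x(3) y(3)]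
        by (simp add: K_def)
    qed
  qed
  have EK: "?E \<subseteq> K"
  proof
    fix x assume x: "x \<in> ?E"
    then have "x \<in> H" "x \<in> carrier G" using EH HG by auto
    moreover from this have "\<iota> x \<in> L" using clos_\<iota>[OF E, of x] x EL by auto
    ultimately show "x \<in> K" by (simp add: K_def)
  qed
  have K: "K \<in> popen p G" by (rule G.popen_superset[OF E sK EK])
  obtain k where k: "N k \<subseteq> ?E" using N_cofinal[OF E] by blast
  have kH: "N k \<subseteq> H" and kK: "N k \<subseteq> K" using k EH EK by auto
  have FL: "F \<in> L \<longleftrightarrow> F \<in> clos K" if F: "F \<in> clos H" for F
  proof -
    have F\<Gamma>: "F \<in> carrier \<Gamma>" using F by (simp add: clos_def)
    obtain h where h: "approx k F h" using approx_ex[OF F\<Gamma>] by blast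
    then have hG: "h \<in> carrier G" using approx_carrier by blast
    have hH: "h \<in> H" using clos_approx[OF sH kH h] F by simp
    \<comment> \<open>\<open>F\<close> and the image of \<open>h\<close> agree at level
      \<open>k\<close>; their quotient lies in the closure of \<open>?E\<close>, hence in
      \<open>L\<close>. So \<open>F\<close> and the image of \<open>h\<close> lie in
      \<open>L\<close> together or not at all.\<close>
    have "approx k (F \<otimes>\<^bsub>\<Gamma>\<^esub> inv\<^bsub>\<Gamma>\<^esub> \<iota> h) (h \<otimes>\<^bsub>G\<^esub> inv\<^bsub>G\<^esub> h)" by (rule approx_mult[OF h approx_inv[OF approx_\<iota>[OF hG]]])
    then have "F \<otimes>\<^bsub>\<Gamma>\<^esub> inv\<^bsub>\<Gamma>\<^esub> \<iota> h \<in> clos ?E"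
      using clos_approx[OF G.popen_subgroup[OF E] k] hG subgroup.one_closed[OF G.popen_subgroup[OF E]] by simp
    then have d: "F \<otimes>\<^bsub>\<Gamma>\<^esub> inv\<^bsub>\<Gamma>\<^esub> \<iota> h \<in> L" using EL by blast
    have "F \<in> L \<longleftrightarrow> \<iota> h \<in> L"
    proof -
      have "L #>\<^bsub>\<Gamma>\<^esub> F = L #>\<^bsub>\<Gamma>\<^esub> \<iota> h" using \<Gamma>.rcos_eq_iff[OF sL F\<Gamma> \<iota>_closed[OF hG]] d by simp
      moreover have "X \<in> L \<longleftrightarrow> L #>\<^bsub>\<Gamma>\<^esub> X = L" if "X \<in> carrier \<Gamma>" for X
        using \<Gamma>.coset_join1[OF _ that sL] \<Gamma>.coset_join2[OF that sL] by blast
      ultimately show ?thesis using F\<Gamma> \<iota>_closed[OF hG] by simp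
    qed
    also have "\<dots> \<longleftrightarrow> h \<in> K" using hH by (simp add: K_def)
    also have "\<dots> \<longleftrightarrow> F \<in> clos K" using clos_approx[OF sK kK h] by simp
    finally show ?thesis .
  qed
  moreover have "clos K \<subseteq> clos H"
  proof
    fix F assume "F \<in> clos K"
    then show "F \<in> clos H" unfolding clos_def K_def by blast
  qed
  ultimately have "L = clos K" using LC by blast
  then show ?thesis using K by blast
qed

text \<open>The normal core inside \<open>L\<close> has finite and hence \<open>p\<close>-power
  index, so \<open>L\<close> is reached from \<open>\<Gamma>\<close> by steps of index
  \<open>p\<close>, each of which preserves being the closure of an open subgroup.\<close>

lemma finite_index_subgroup_closed:
  assumes L: "subgroup L \<Gamma>" and fin: "rel_index \<Gamma> (carrier \<Gamma>) L > 0"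
  shows "\<exists>H\<in>popen p G. L = clos H"
proof -
  obtain C where C: "C \<lhd> \<Gamma>" "C \<subseteq> L" "rel_index \<Gamma> (carrier \<Gamma>) C > 0"
    using \<Gamma>.finite_index_normal_core[OF L fin] by blast
  obtain k where k: "rel_index \<Gamma> (carrier \<Gamma>) C = p ^ k"
    using normal_finite_index_p_power[OF C(1,3)] by blast
  show ?thesis
  proof (rule \<Gamma>.p_chain_induct[OF p C(1) k L C(2), of "\<lambda>L. \<exists>H\<in>popen p G. L = clos H"])
    show "\<exists>H\<in>popen p G. carrier \<Gamma> = clos H" using clos_carrier G.popen_carrier by blast
    fix M L assume "L \<lhd> \<Gamma>\<lparr>carrier := M\<rparr>" "rel_index \<Gamma> M L = p" "\<exists>H\<in>popen p G. M = clos H"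
    then show "\<exists>H\<in>popen p G. L = clos H" using normal_index_p_closed by blast
  qed
qed

end

section \<open>Counting subgroups\<close>

text \<open>The iterated \<open>phi_subgroup\<close>: a concrete descending sequence that serves as
  the \<open>N k\<close> of \<open>pro_p_limit\<close>.\<close>

primrec frattini_series :: "nat \<Rightarrow> ('a, 'b) monoid_scheme \<Rightarrow> nat \<Rightarrow> 'a set" where
  "frattini_series p G 0 = carrier G"
| "frattini_series p G (Suc k) = phi_subgroup p (G\<lparr>carrier := frattini_series p G k\<rparr>)"

definition completion_map :: "nat \<Rightarrow> ('a, 'b) monoid_scheme \<Rightarrow> 'a \<Rightarrow> 'a set \<Rightarrow> 'a set" where
  "completion_map p G g = (\<lambda>N\<in>p_power_normal_subgroups p G. N #>\<^bsub>G\<^esub> g)"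

section \<open>The pro-\<open>p\<close> completion as a limit along the Frattini series\<close>

context group
begin

lemma frattini_series_p_power_normal:
  assumes "finitely_generated_group G" "prime p"
  shows "frattini_series p G k \<in> p_power_normal_subgroups p G"
proof (induction k)
  case 0
  then show ?case using normal_self rel_index_self[OF subgroup_self]
    by (auto simp: p_power_normal_subgroups_iff intro: exI[of _ 0])
next
  case (Suc k)
  then show ?case using phi_subgroup_p_power_normal(1)[OF assms] by simp
qed

lemma frattini_series_decreasing:
  "frattini_series p G (Suc k) \<subseteq> frattini_series p G k"
  by (auto simp: phi_subgroup_def)

text \<open>Descend to \<open>H\<close> in steps of index \<open>p\<close>. If a term of the series
  lies in \<open>M\<close>, the next term is killed by the homomorphism on \<open>M\<close> whose
  kernel is the next subgroup of the chain.\<close>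

lemma frattini_series_cofinal:
  assumes fg: "finitely_generated_group G" and p: "prime p" and H: "H \<in> popen p G"
  shows "\<exists>k. frattini_series p G k \<subseteq> H"
  using p H
proof (induction rule: popen_induct)
  case top
  then show ?case by (intro exI[of _ 0]) simp
next
  case (step M H)
  interpret M: group "G\<lparr>carrier := M\<rparr>" by (rule subgroup_imp_group[OF popen_subgroup[OF step(1)]])
  obtain k where k: "frattini_series p G k \<subseteq> M" using step by blast
  let ?N = "frattini_series p G k"
  have sN: "subgroup ?N G"
    using frattini_series_p_power_normal[OF fg p] by (simp add: p_power_normal_subgroups_iff normal_imp_subgroup)
  obtain \<tau> where \<tau>: "\<tau> \<in> mod_homs p (G\<lparr>carrier := M\<rparr>)" "H = hom_kernel (G\<lparr>carrier := M\<rparr>) \<tau>"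
    using M.index_prime_hom[OF step(4) _ p] step(5) by (auto simp: rel_index_carrier)
  have r: "restrict \<tau> ?N \<in> mod_homs p (G\<lparr>carrier := ?N\<rparr>)"
    by (rule mod_homs_restrict[OF \<tau>(1) k]) (rule subgroup.m_closed[OF sN])
  have "frattini_series p G (Suc k) \<subseteq> H"
  proof
    fix x assume "x \<in> frattini_series p G (Suc k)"
    then have "x \<in> ?N" "restrict \<tau> ?N x = 0" using r by (auto simp: phi_subgroup_def)
    then show "x \<in> H" using k \<tau>(2) by (auto simp: hom_kernel_def)
  qed
  then show ?case by blast
qed

lemma set_mult_rcos_absorb:
  assumes "subgroup M G" "subgroup N G" "M \<subseteq> N" "g \<in> carrier G"
  shows "N <#> (M #> g) = N #> g"
proof -
  have "N <#> M = N"
    by (rule set_mult_subgroup_idem[OF assms(2) subgroup_incl[OF assms(1,2,3)]])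
  then show ?thesis
    using setmult_rcos_assoc[OF subgroup.subset[OF assms(2)] subgroup.subset[OF assms(1)] assms(4)] by simp
qed

lemma
  fixes p :: nat
  defines "I \<equiv> p_power_normal_subgroups p G"
  shows pro_p_completion_carrier: "F \<in> carrier (pro_p_completion p G) \<longleftrightarrow>
      F \<in> (\<Pi>\<^sub>E N\<in>I. carrier (G Mod N)) \<and> (\<forall>M\<in>I. \<forall>N\<in>I. M \<subseteq> N \<longrightarrow> F N = N <#> F M)"
    and pro_p_completion_mult: "N \<in> I \<Longrightarrow> (F \<otimes>\<^bsub>pro_p_completion p G\<^esub> F') N = F N <#> F' N"
    and group_pro_p_completion: "group (pro_p_completion p G)"
proof -
  let ?P = "product_group I (\<lambda>N. G Mod N)"
  define C where "C = {F \<in> carrier ?P. \<forall>M\<in>I. \<forall>N\<in>I. M \<subseteq> N \<longrightarrow> F N = N <#> F M}"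
  have eq: "pro_p_completion p G = ?P\<lparr>carrier := C\<rparr>"
    by (simp add: pro_p_completion_def I_def C_def Let_def)
  show "F \<in> carrier (pro_p_completion p G) \<longleftrightarrow>
      F \<in> (\<Pi>\<^sub>E N\<in>I. carrier (G Mod N)) \<and> (\<forall>M\<in>I. \<forall>N\<in>I. M \<subseteq> N \<longrightarrow> F N = N <#> F M)"
    by (simp add: eq C_def)
  show "N \<in> I \<Longrightarrow> (F \<otimes>\<^bsub>pro_p_completion p G\<^esub> F') N = F N <#> F' N"
    by (simp add: eq)
  have n: "N \<lhd> G" if "N \<in> I" for N using that by (simp add: I_def p_power_normal_subgroups_iff)
  have s: "subgroup N G" if "N \<in> I" for N using normal_imp_subgroup[OF n[OF that]] .
  have grp: "group (G Mod N)" if "N \<in> I" for N by (rule normal.factorgroup_is_group[OF n[OF that]])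
  interpret P: group ?P by (rule product_group) (rule grp)
  have compat: "F N = N #> g" if "F \<in> C" "M \<in> I" "N \<in> I" "M \<subseteq> N" "g \<in> carrier G" "F M = M #> g" for F M N g
  proof -
    have "F N = N <#> F M" using that(1-4) unfolding C_def by blast
    also have "\<dots> = N #> g"
      unfolding that(6) by (rule set_mult_rcos_absorb[OF s[OF that(2)] s[OF that(3)] that(4,5)])
    finally show ?thesis .
  qed
  have coset: "\<exists>g\<in>carrier G. F N = N #> g" if "F \<in> carrier ?P" "N \<in> I" for F N
    using that by (auto simp: carrier_FactGroup PiE_def Pi_def)
  have "subgroup C ?P"
  proof (rule P.subgroupI)
    show "C \<subseteq> carrier ?P" by (auto simp: C_def)
    have "\<one>\<^bsub>?P\<^esub> \<in> C"
    proof -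
      have "\<one>\<^bsub>?P\<^esub> N = N <#> \<one>\<^bsub>?P\<^esub> M" if "M \<in> I" "N \<in> I" "M \<subseteq> N" for M N
        using set_mult_subgroup_idem[OF s[OF that(2)] subgroup_incl[OF s[OF that(1)] s[OF that(2)] that(3)]] that
        by simp
      then show ?thesis using P.one_closed unfolding C_def by blast
    qed
    then show "C \<noteq> {}" by blast
    fix F assume F: "F \<in> C"
    then have FP: "F \<in> carrier ?P" by (simp add: C_def)
    show "inv\<^bsub>?P\<^esub> F \<in> C"
    proof -
      have i: "(inv\<^bsub>?P\<^esub> F) N = inv\<^bsub>G Mod N\<^esub> (F N)" if "N \<in> I" for N
        using inv_product_group[OF FP[unfolded carrier_product_group] grp] that by simp
      have "(inv\<^bsub>?P\<^esub> F) N = N <#> (inv\<^bsub>?P\<^esub> F) M" if MN: "M \<in> I" "N \<in> I" "M \<subseteq> N" for M N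
      proof -
        obtain g where g: "g \<in> carrier G" "F M = M #> g" using coset[OF FP MN(1)] by blast
        have FN: "F N = N #> g"
          by (rule compat[OF F MN g])
        have inv: "inv\<^bsub>G Mod K\<^esub> (K #> g) = K #> inv g" if "K \<in> I" for K
          using normal.inv_FactGroup[OF n[OF that], of "K #> g"] normal.rcos_inv[OF n[OF that] g(1)] g(1)
          by (simp add: carrier_FactGroup)
        show ?thesis
          using i[OF MN(1)] i[OF MN(2)] g FN inv[OF MN(1)] inv[OF MN(2)]
            set_mult_rcos_absorb[OF s[OF MN(1)] s[OF MN(2)] MN(3), of "inv g"] by simp
      qed
      then show ?thesis using P.inv_closed[OF FP] unfolding C_def by blast
    qed
    fix F' assume F': "F' \<in> C"
    then have FP': "F' \<in> carrier ?P" by (simp add: C_def)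
    show "F \<otimes>\<^bsub>?P\<^esub> F' \<in> C"
    proof -
      have "(F \<otimes>\<^bsub>?P\<^esub> F') N = N <#> (F \<otimes>\<^bsub>?P\<^esub> F') M" if MN: "M \<in> I" "N \<in> I" "M \<subseteq> N" for M N
      proof -
        obtain g where g: "g \<in> carrier G" "F M = M #> g" using coset[OF FP MN(1)] by blast
        obtain g' where g': "g' \<in> carrier G" "F' M = M #> g'" using coset[OF FP' MN(1)] by blast
        have FN: "F N = N #> g" "F' N = N #> g'"
          by (rule compat[OF F MN g], rule compat[OF F' MN g'])
        show ?thesis
          using MN g g' FN normal.rcos_sum[OF n[OF MN(1)] g(1) g'(1)] normal.rcos_sum[OF n[OF MN(2)] g(1) g'(1)]
            set_mult_rcos_absorb[OF s[OF MN(1)] s[OF MN(2)] MN(3), of "g \<otimes> g'"] by simp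
      qed
      then show ?thesis using P.m_closed[OF FP FP'] unfolding C_def by blast
    qed
  qed
  then show "group (pro_p_completion p G)" unfolding eq by (rule P.subgroup_imp_group)
qed

text \<open>By cofinality, a coordinate at an arbitrary \<open>N\<close> is determined by a
  coordinate along the series, which gives injectivity. The same remark rebuilds all coordinates
  from a compatible sequence of cosets, which gives completeness.\<close>

lemma pro_p_limit_completion:
  assumes fg: "finitely_generated_group G" and p: "prime p"
  shows "pro_p_limit G (pro_p_completion p G) p (frattini_series p G)
    (\<lambda>k F. F (frattini_series p G k)) (completion_map p G)"
proof -
  let ?I = "p_power_normal_subgroups p G" and ?\<Gamma> = "pro_p_completion p G" and ?N = "frattini_series p G"
  interpret \<Gamma>: group ?\<Gamma> by (rule group_pro_p_completion)
  have NI: "?N k \<in> ?I" for k by (rule frattini_series_p_power_normal[OF fg p])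
  have n: "N \<lhd> G" if "N \<in> ?I" for N using that by (simp add: p_power_normal_subgroups_iff)
  have s: "subgroup N G" if "N \<in> ?I" for N using normal_imp_subgroup[OF n[OF that]] .
  have Nanti: "?N k \<subseteq> ?N j" if "j \<le> k" for j k
    using that by (induction rule: dec_induct) (use frattini_series_decreasing in blast)+
  have cof: "\<exists>k. ?N k \<subseteq> N" if "N \<in> ?I" for N
    by (rule frattini_series_cofinal[OF fg p p_power_normal_popen[OF that]])
  have PiE: "F \<in> (\<Pi>\<^sub>E N\<in>?I. carrier (G Mod N))" if "F \<in> carrier ?\<Gamma>" for F
    using that unfolding pro_p_completion_carrier by blast
  have coset: "\<exists>g\<in>carrier G. F N = N #> g" if "F \<in> carrier ?\<Gamma>" "N \<in> ?I" for F N
    using PiE_mem[OF PiE[OF that(1)] that(2)] by (auto simp: carrier_FactGroup)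
  have compat: "F N = N <#> F M" if "F \<in> carrier ?\<Gamma>" "M \<in> ?I" "N \<in> ?I" "M \<subseteq> N" for F M N
    using that unfolding pro_p_completion_carrier by blast
  have ext: "F = F'" if "F \<in> carrier ?\<Gamma>" "F' \<in> carrier ?\<Gamma>" "\<And>N. N \<in> ?I \<Longrightarrow> F N = F' N" for F F'
    by (rule PiE_ext[OF PiE[OF that(1)] PiE[OF that(2)] that(3)])
  have map_mem: "completion_map p G g \<in> carrier ?\<Gamma>" if g: "g \<in> carrier G" for g
    unfolding pro_p_completion_carrier completion_map_def
    using g set_mult_rcos_absorb[OF s s] by (auto simp: carrier_FactGroup)
  show ?thesis
  proof (rule pro_p_limit.intro)
    show "group G" by (rule is_group)
    show "group ?\<Gamma>" by (rule \<Gamma>.is_group)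
    show "pro_p_limit_axioms G ?\<Gamma> p ?N (\<lambda>k F. F (?N k)) (completion_map p G)"
    proof (rule pro_p_limit_axioms.intro)
      show "?N (Suc k) \<subseteq> ?N k" for k by (rule frattini_series_decreasing)
      show "\<exists>k. ?N k \<subseteq> H" if "H \<in> popen p G" for H by (rule frattini_series_cofinal[OF fg p that])
      show "\<exists>g\<in>carrier G. F (?N k) = ?N k #> g" if "F \<in> carrier ?\<Gamma>" for k F using coset[OF that NI] .
      show "(F \<otimes>\<^bsub>?\<Gamma>\<^esub> F') (?N k) = F (?N k) <#> F' (?N k)" for k F F'
        by (rule pro_p_completion_mult[OF NI])
      show "F (?N k) = ?N k #> g" if "F \<in> carrier ?\<Gamma>" "g \<in> carrier G" "F (?N (Suc k)) = ?N (Suc k) #> g" for k F g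
        using compat[OF that(1) NI NI frattini_series_decreasing[where p = p and k = k]]
          set_mult_rcos_absorb[OF s[OF NI] s[OF NI] frattini_series_decreasing[where p = p and k = k] that(2)] that(3)
        by simp
      show "completion_map p G \<in> hom G ?\<Gamma>"
      proof (rule homI)
        fix g h assume gh: "g \<in> carrier G" "h \<in> carrier G"
        show "completion_map p G (g \<otimes> h) = completion_map p G g \<otimes>\<^bsub>?\<Gamma>\<^esub> completion_map p G h"
        proof (rule ext)
          fix N assume N: "N \<in> ?I"
          then show "completion_map p G (g \<otimes> h) N = (completion_map p G g \<otimes>\<^bsub>?\<Gamma>\<^esub> completion_map p G h) N"
            unfolding pro_p_completion_mult[OF N] using normal.rcos_sum[OF n[OF N] gh]
            by (simp add: completion_map_def)
        qed (use map_mem gh in auto)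
      qed (rule map_mem)
      show "completion_map p G g (?N k) = ?N k #> g" for k g using NI by (simp add: completion_map_def)
      show "F = F'" if F: "F \<in> carrier ?\<Gamma>" "F' \<in> carrier ?\<Gamma>" and e: "\<And>k. F (?N k) = F' (?N k)" for F F'
      proof (rule ext[OF F])
        fix N assume N: "N \<in> ?I"
        obtain k where k: "?N k \<subseteq> N" using cof[OF N] by blast
        have "F N = N <#> F (?N k)" by (rule compat[OF F(1) NI N k])
        also have "\<dots> = N <#> F' (?N k)" using e by simp
        also have "\<dots> = F' N" by (rule compat[OF F(2) NI N k, symmetric])
        finally show "F N = F' N" .
      qed
      show "\<exists>F\<in>carrier ?\<Gamma>. \<forall>k. F (?N k) = ?N k #> g k"
        if g: "\<And>k. g k \<in> carrier G" and st: "\<And>k. ?N k #> g (Suc k) = ?N k #> g k" for g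
      proof -
        have st_le: "N #> g k = N #> g j" if N: "N \<in> ?I" "?N j \<subseteq> N" and jk: "j \<le> k" for N j k
          using jk
        proof (induction rule: dec_induct)
          case base
          then show ?case by simp
        next
          case (step i)
          have iN: "?N i \<subseteq> N" using Nanti[OF step(1)] N(2) by blast
          have "N #> g (Suc i) = N <#> (?N i #> g (Suc i))"
            by (rule set_mult_rcos_absorb[OF s[OF NI] s[OF N(1)] iN g, symmetric])
          also have "\<dots> = N <#> (?N i #> g i)" using st by simp
          also have "\<dots> = N #> g i" by (rule set_mult_rcos_absorb[OF s[OF NI] s[OF N(1)] iN g])
          finally show ?case using step by simp
        qed
        \<comment> \<open>The least term of the series contained in \<open>N\<close>; it fixes the
          coordinate at \<open>N\<close>. By \<open>st_le\<close>, any later term would give the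
          same coset.\<close>
        define lv where "lv N = (LEAST k. ?N k \<subseteq> N)" for N
        have lv: "?N (lv N) \<subseteq> N" if "N \<in> ?I" for N
          unfolding lv_def by (rule LeastI_ex[OF cof[OF that]])
        have lv_le: "lv N \<le> k" if "?N k \<subseteq> N" for N k unfolding lv_def by (rule Least_le[of "\<lambda>k. ?N k \<subseteq> N" k, OF that])
        define F where "F = (\<lambda>N\<in>?I. N #> g (lv N))"
        have F: "F N = N #> g k" if "N \<in> ?I" "?N k \<subseteq> N" for N k
          using st_le[OF that(1) lv[OF that(1)] lv_le[OF that(2)]] that(1) by (simp add: F_def)
        have "F \<in> carrier ?\<Gamma>"
          unfolding pro_p_completion_carrier
        proof (intro conjI ballI impI)
          show "F \<in> (\<Pi>\<^sub>E N\<in>?I. carrier (G Mod N))"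
            unfolding F_def using g by (auto simp: carrier_FactGroup)
          fix M N assume MN: "M \<in> ?I" "N \<in> ?I" "M \<subseteq> N"
          obtain k where k: "?N k \<subseteq> M" using cof[OF MN(1)] by blast
          then show "F N = N <#> F M"
            using F[OF MN(1) k] F[OF MN(2), of k] MN set_mult_rcos_absorb[OF s[OF MN(1)] s[OF MN(2)] MN(3) g] by auto
        qed
        moreover have "F (?N k) = ?N k #> g k" for k by (rule F[OF NI order_refl])
        ultimately show ?thesis by blast
      qed
    qed (use p fg NI in auto)
  qed
qed

end

section \<open>Counting open subgroups by index\<close>

locale pro_p_growth = group G for G (structure) +
  fixes p :: nat
  assumes fg: "finitely_generated_group G" and p: "prime p"
begin

abbreviation "idx \<equiv> rel_index G (carrier G)"
abbreviation "dimh H \<equiv> homology_dim p (G\<lparr>carrier := H\<rparr>)"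

definition level :: "nat \<Rightarrow> 'a set set" where "level k = {H \<in> popen p G. idx H = p ^ k}"
definition index_upto :: "nat \<Rightarrow> 'a set set" where "index_upto n = {H \<in> popen p G. idx H \<le> n}"

lemma p1: "1 < p" by (rule prime_gt_1_nat[OF p])

lemma p0: "0 < p" by (rule prime_gt_0_nat[OF p])

lemma finite_level: "finite (level k)"
  unfolding level_def by (rule finite_index_levels[OF fg p])

lemma finite_upto: "finite (index_upto n)"
proof -
  have "index_upto n \<subseteq> (\<Union>k\<le>n. level k)"
  proof
    fix H assume H: "H \<in> index_upto n"
    then obtain k where k: "idx H = p ^ k" using popen_index[OF p] by (auto simp: index_upto_def)
    have "k < p ^ k" using power_gt_expt[of p k] p1 by simp
    then have "k \<le> n" using H k by (simp add: index_upto_def)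
    then show "H \<in> (\<Union>k\<le>n. level k)" using H k by (auto simp: index_upto_def level_def)
  qed
  moreover have "finite (\<Union>k\<le>n. level k)" using finite_level by simp
  ultimately show ?thesis by (rule finite_subset)
qed

lemma card_mod_homs_popen:
  assumes H: "H \<in> popen p G"
  shows "card (mod_homs p (G\<lparr>carrier := H\<rparr>)) = p ^ dimh H"
  by (rule group.card_mod_homs_eq[OF subgroup_imp_group[OF popen_subgroup[OF H]] popen_finitely_generated[OF fg p H] p])

text \<open>Taking closures is an index preserving bijection from open subgroups of \<open>G\<close>
  to finite index subgroups of the completion, so subgroup growth becomes a question about
  \<open>index_upto\<close>.\<close>

lemma log_count: "log_subgroup_count (pro_p_completion p G) n = ereal (ln (real (card (index_upto n))))"
proof -
  interpret pro_p_limit G "pro_p_completion p G" p "frattini_series p G"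
    "\<lambda>k F. F (frattini_series p G k)" "completion_map p G"
    by (rule pro_p_limit_completion[OF fg p])
  let ?\<Gamma> = "pro_p_completion p G"
  have pos: "finite (rcosets\<^bsub>?\<Gamma>\<^esub> L) \<longleftrightarrow> rel_index ?\<Gamma> (carrier ?\<Gamma>) L > 0" for L
    using \<Gamma>.one_closed by (auto simp: rel_index_def rcosets_eq_image card_gt_0_iff)
  have "subgroups_of_index_le ?\<Gamma> n = clos ` index_upto n"
  proof
    show "subgroups_of_index_le ?\<Gamma> n \<subseteq> clos ` index_upto n"
    proof
      fix L assume "L \<in> subgroups_of_index_le ?\<Gamma> n"
      then have L: "subgroup L ?\<Gamma>" "rel_index ?\<Gamma> (carrier ?\<Gamma>) L > 0" "rel_index ?\<Gamma> (carrier ?\<Gamma>) L \<le> n"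
        by (auto simp: subgroups_of_index_le_def pos subgroup_index_eq)
      obtain H where H: "H \<in> popen p G" "L = clos H" using finite_index_subgroup_closed[OF L(1,2)] by blast
      then show "L \<in> clos ` index_upto n" using L(3) clos_index[OF H(1)] by (auto simp: index_upto_def)
    qed
    show "clos ` index_upto n \<subseteq> subgroups_of_index_le ?\<Gamma> n"
    proof
      fix L assume "L \<in> clos ` index_upto n"
      then obtain H where H: "H \<in> popen p G" "idx H \<le> n" "L = clos H" by (auto simp: index_upto_def)
      then show "L \<in> subgroups_of_index_le ?\<Gamma> n"
        using clos_subgroup[OF popen_subgroup[OF H(1)]] clos_index[OF H(1)] popen_index_pos[OF p H(1)]
        by (simp add: subgroups_of_index_le_def pos subgroup_index_eq)
    qed
  qed
  moreover have "inj_on clos (index_upto n)"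
    by (rule inj_onI) (use clos_inj in \<open>auto simp: index_upto_def\<close>)
  ultimately show ?thesis using finite_upto by (simp add: log_subgroup_count_def card_image)
qed

lemma card_upto_pos: "0 < n \<Longrightarrow> card (index_upto n) \<ge> 1"
proof -
  assume "0 < n"
  then have "carrier G \<in> index_upto n"
    using popen_carrier rel_index_self[OF subgroup_self] by (simp add: index_upto_def)
  then show ?thesis using finite_upto by (metis One_nat_def Suc_leI card_gt_0_iff empty_iff)
qed

text \<open>Kernels of homomorphisms on \<open>H\<close> are open of index at most \<open>p\<close>
  times that of \<open>H\<close>, and at most \<open>p\<close> homomorphisms share a kernel. The
  summand \<open>ln p\<close> on the right is this last factor after taking logarithms.\<close>

lemma card_upto_lower:
  assumes H: "H \<in> popen p G"
  shows "real (dimh H) * ln p \<le> ln (card (index_upto (p * idx H))) + ln p"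
proof -
  interpret H: group "G\<lparr>carrier := H\<rparr>" by (rule subgroup_imp_group[OF popen_subgroup[OF H]])
  let ?A = "mod_homs p (G\<lparr>carrier := H\<rparr>)" and ?n = "p * idx H"
  have fin: "finite ?A" by (rule popen_finite_mod_homs[OF fg p H])
  have "hom_kernel (G\<lparr>carrier := H\<rparr>) ` ?A \<subseteq> index_upto ?n"
  proof clarify
    fix \<phi> assume \<phi>: "\<phi> \<in> ?A"
    let ?K = "hom_kernel (G\<lparr>carrier := H\<rparr>) \<phi>"
    have K: "?K \<in> popen p G" by (rule popen_hom_kernel[OF fg p H \<phi>])
    have KH: "?K \<subseteq> H" by (auto simp: hom_kernel_def)
    have "?K = H \<or> rel_index G H ?K = p" using H.hom_kernel_index[OF \<phi> p] by (simp add: rel_index_carrier)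
    then have "rel_index G H ?K \<le> p" using rel_index_self[OF popen_subgroup[OF H]] p1 by auto
    then have "idx ?K \<le> ?n"
      using rel_index_mult[OF popen_subgroup[OF K] popen_subgroup[OF H] subgroup_self KH subgroup.subset[OF popen_subgroup[OF H]]]
      by simp
    then show "?K \<in> index_upto ?n" using K by (simp add: index_upto_def)
  qed
  then have "card (hom_kernel (G\<lparr>carrier := H\<rparr>) ` ?A) \<le> card (index_upto ?n)" by (rule card_mono[OF finite_upto])
  then have "p ^ dimh H \<le> card (index_upto ?n) * p"
    using H.card_mod_homs_le_kernels[OF p fin] card_mod_homs_popen[OF H] by (metis le_trans mult_le_mono1)
  then have "real p ^ dimh H \<le> real (card (index_upto ?n)) * real p" by (metis of_nat_le_iff of_nat_mult of_nat_power)
  then have "ln (real p ^ dimh H) \<le> ln (real (card (index_upto ?n)) * real p)"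
    using p0 by (intro ln_mono) auto
  moreover have "card (index_upto ?n) \<ge> 1" using card_upto_pos popen_index_pos[OF p H] p0 by simp
  ultimately show ?thesis using p0 by (simp add: ln_realpow ln_mult)
qed

lemma dimh_index_p:
  assumes M: "M \<in> popen p G" and H: "H \<in> popen p G" "H \<lhd> G\<lparr>carrier := M\<rparr>" "rel_index G M H = p"
  shows "dimh H \<le> p * dimh M"
proof -
  interpret M: group "G\<lparr>carrier := M\<rparr>" by (rule subgroup_imp_group[OF popen_subgroup[OF M]])
  have "card (mod_homs p (G\<lparr>carrier := H\<rparr>)) \<le> card (mod_homs p (G\<lparr>carrier := M\<rparr>)) ^ p"
    using M.card_mod_homs_index_p[OF p H(2)] H(3) popen_finite_mod_homs[OF fg p M] popen_finite_mod_homs[OF fg p H(1)]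
    by (simp add: rel_index_carrier)
  then have "p ^ dimh H \<le> p ^ (p * dimh M)"
    using card_mod_homs_popen[OF M] card_mod_homs_popen[OF H(1)] by (simp add: power_mult[symmetric] mult.commute)
  then show ?thesis using p1 by simp
qed

lemma level_parent:
  assumes H: "H \<in> level (Suc k)"
  shows "\<exists>M\<in>level k. H \<subseteq> M \<and> H \<lhd> G\<lparr>carrier := M\<rparr> \<and> rel_index G M H = p"
proof -
  have Hp: "H \<in> popen p G" "idx H = p ^ Suc k" using H by (auto simp: level_def)
  have "1 < p ^ Suc k" using p1 by (rule one_less_power) simp
  then have "H \<noteq> carrier G" using Hp(2) rel_index_self[OF subgroup_self] by auto
  then obtain M where M: "M \<in> popen p G" "H \<subseteq> M" "H \<lhd> G\<lparr>carrier := M\<rparr>" "rel_index G M H = p"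
    using popen_parent[OF p Hp(1)] by blast
  have "idx M = p ^ k"
    using rel_index_mult[OF popen_subgroup[OF Hp(1)] popen_subgroup[OF M(1)] subgroup_self M(2) subgroup.subset[OF popen_subgroup[OF M(1)]]]
      M(4) Hp(2) p0 by simp
  then show ?thesis using M by (auto simp: level_def)
qed

text \<open>Every subgroup at the next level is a kernel on some member \<open>M\<close> of
  \<open>level k\<close>, and \<open>M\<close> has at most \<open>p ^ dimh M\<close> kernels. The
  bound \<open>b\<close> is real because it will be \<open>c * p ^ k\<close>.\<close>

lemma card_level_Suc:
  fixes b :: real
  assumes "\<And>M. M \<in> level k \<Longrightarrow> real (dimh M) \<le> b"
  shows "real (card (level (Suc k))) \<le> real (card (level k)) * p powr b"
proof -
  let ?A = "\<lambda>M. mod_homs p (G\<lparr>carrier := M\<rparr>)" and ?k = "\<lambda>M. hom_kernel (G\<lparr>carrier := M\<rparr>)"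
  have fA: "finite (?A M)" if "M \<in> level k" for M
    using that by (intro popen_finite_mod_homs[OF fg p]) (simp add: level_def)
  have "level (Suc k) \<subseteq> (\<Union>M\<in>level k. ?k M ` ?A M)"
  proof
    fix H assume "H \<in> level (Suc k)"
    then obtain M where M: "M \<in> level k" "H \<lhd> G\<lparr>carrier := M\<rparr>" "rel_index G M H = p"
      using level_parent by blast
    interpret M: group "G\<lparr>carrier := M\<rparr>"
      using M(1) by (intro subgroup_imp_group popen_subgroup[where p = p]) (simp add: level_def)
    obtain \<tau> where "\<tau> \<in> ?A M" "H = ?k M \<tau>"
      using M.index_prime_hom[OF M(2) _ p] M(3) by (auto simp: rel_index_carrier)
    then show "H \<in> (\<Union>M\<in>level k. ?k M ` ?A M)" using M(1) by blast
  qed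
  then have "card (level (Suc k)) \<le> card (\<Union>M\<in>level k. ?k M ` ?A M)"
    by (rule card_mono[rotated]) (use finite_level fA in auto)
  also have "\<dots> \<le> (\<Sum>M\<in>level k. card (?k M ` ?A M))" by (rule card_UN_le[OF finite_level])
  also have "\<dots> \<le> (\<Sum>M\<in>level k. p ^ dimh M)"
  proof (rule sum_mono)
    fix M assume M: "M \<in> level k"
    then have "card (?A M) = p ^ dimh M" by (intro card_mod_homs_popen) (simp add: level_def)
    then show "card (?k M ` ?A M) \<le> p ^ dimh M" using card_image_le[OF fA[OF M], of "?k M"] by simp
  qed
  finally have "real (card (level (Suc k))) \<le> real (\<Sum>M\<in>level k. p ^ dimh M)"
    by (simp only: of_nat_le_iff)
  also have "\<dots> = (\<Sum>M\<in>level k. real p ^ dimh M)" by simp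
  also have "\<dots> \<le> (\<Sum>M\<in>level k. p powr b)"
  proof (rule sum_mono)
    fix M assume "M \<in> level k"
    then show "real p ^ dimh M \<le> p powr b"
      using assms p1 by (subst powr_realpow[symmetric]) (auto intro: powr_mono)
  qed
  finally show ?thesis by simp
qed

lemma upto_Suc: "card (index_upto (p ^ Suc k)) \<le> card (index_upto (p ^ k)) + card (level (Suc k))"
proof -
  have "index_upto (p ^ Suc k) \<subseteq> index_upto (p ^ k) \<union> level (Suc k)"
  proof
    fix H assume H: "H \<in> index_upto (p ^ Suc k)"
    then obtain j where j: "idx H = p ^ j" using popen_index[OF p] by (auto simp: index_upto_def)
    have "j \<le> Suc k" using H j p1 by (simp add: index_upto_def del: power_Suc)
    then consider "j = Suc k" | "j \<le> k" by linarith
    then show "H \<in> index_upto (p ^ k) \<union> level (Suc k)"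
      using H j p1 by cases (auto simp: index_upto_def level_def)
  qed
  then have "card (index_upto (p ^ Suc k)) \<le> card (index_upto (p ^ k) \<union> level (Suc k))"
    by (rule card_mono[rotated]) (use finite_upto finite_level in auto)
  also have "\<dots> \<le> card (index_upto (p ^ k)) + card (level (Suc k))" by (rule card_Un_le)
  finally show ?thesis .
qed

text \<open>Passing to the next level multiplies \<open>dimh\<close> by at most \<open>p\<close>,
  exactly the growth of the index. A bound on the ratio at one level thus persists at all deeper
  levels.\<close>

lemma dimh_bound_propagates:
  fixes c :: real
  assumes b: "\<And>H. H \<in> level k \<Longrightarrow> real (dimh H) \<le> c * p ^ k" and "k \<le> j" and "H \<in> level j"
  shows "real (dimh H) \<le> c * p ^ j"
  using assms(2,3)
proof (induction arbitrary: H rule: dec_induct)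
  case base
  then show ?case using b by simp
next
  case (step i)
  obtain M where M: "M \<in> level i" "H \<lhd> G\<lparr>carrier := M\<rparr>" "rel_index G M H = p"
    using level_parent[OF step.prems] by blast
  have "dimh H \<le> p * dimh M"
    by (rule dimh_index_p) (use M step.prems in \<open>auto simp: level_def\<close>)
  then have "real (dimh H) \<le> real p * real (dimh M)" by (metis of_nat_le_iff of_nat_mult)
  also have "\<dots> \<le> real p * (c * p ^ i)" using step.IH[OF M(1)] by (intro mult_left_mono) auto
  finally show ?case by (simp add: algebra_simps)
qed

text \<open>From \<open>p ^ i\<close> to \<open>p ^ Suc i\<close> the count grows at most by a
  factor 1 + q with q = p^(c p^i), and 1 + q is at most p q. The extra factors p accumulate to the
  \<open>j\<close> in the exponent, and the geometric sum of the terms c p^i stays below c p^j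
  because \<open>p\<close> is at least 2.\<close>

lemma card_upto_bound:
  fixes c :: real
  assumes c: "0 < c" and b: "\<And>H. H \<in> level k \<Longrightarrow> real (dimh H) \<le> c * p ^ k" and "k \<le> j"
  shows "real (card (index_upto (p ^ j))) \<le> real (card (index_upto (p ^ k))) * p powr (j + c * p ^ j)"
  using assms(3)
proof (induction rule: dec_induct)
  case base
  have "p powr (real k + c * p ^ k) \<ge> 1" using p1 c by (intro ge_one_powr_ge_zero) auto
  then show ?case using mult_left_mono[of 1 "p powr (real k + c * p ^ k)" "real (card (index_upto (p ^ k)))"] by simp
next
  case (step i)
  let ?S = "real (card (index_upto (p ^ i)))" and ?q = "p powr (c * p ^ i)"
  have q1: "?q \<ge> 1" using p1 c by (intro ge_one_powr_ge_zero) auto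
  have "real (card (level (Suc i))) \<le> real (card (level i)) * ?q"
    by (rule card_level_Suc) (rule dimh_bound_propagates[OF b step(1)])
  also have "\<dots> \<le> ?S * ?q"
  proof -
    have "level i \<subseteq> index_upto (p ^ i)" by (auto simp: level_def index_upto_def)
    then have "card (level i) \<le> card (index_upto (p ^ i))" by (rule card_mono[OF finite_upto])
    then show ?thesis by (intro mult_right_mono) auto
  qed
  finally have "real (card (index_upto (p ^ Suc i))) \<le> ?S + ?S * ?q" using upto_Suc[of i] by linarith
  also have "\<dots> \<le> ?S * (real p * ?q)"
  proof -
    have "1 + ?q \<le> 2 * ?q" using q1 by simp
    also have "\<dots> \<le> real p * ?q" using p1 q1 by (intro mult_right_mono) auto
    finally have "?S * (1 + ?q) \<le> ?S * (real p * ?q)" by (intro mult_left_mono) auto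
    then show ?thesis by (simp add: algebra_simps)
  qed
  also have "\<dots> \<le> (real (card (index_upto (p ^ k))) * p powr (i + c * p ^ i)) * (real p * ?q)"
    using step.IH by (intro mult_right_mono) auto
  also have "\<dots> = real (card (index_upto (p ^ k))) * p powr (i + c * p ^ i + 1 + c * p ^ i)"
  proof -
    have "p powr (i + c * p ^ i + 1 + c * p ^ i) = p powr (i + c * p ^ i) * p powr 1 * ?q"
      by (simp only: powr_add)
    then show ?thesis using p1 by simp
  qed
  also have "\<dots> \<le> real (card (index_upto (p ^ k))) * p powr (Suc i + c * p ^ Suc i)"
  proof -
    \<comment> \<open>The exponent carried over from level \<open>i\<close> and the one contributed
      by the step are equal, so their sum is absorbed by the next power of \<open>p\<close>.\<close>
    have "2 * (c * real p ^ i) \<le> real p * (c * real p ^ i)" using p1 c by (intro mult_right_mono) auto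
    then have "real i + c * p ^ i + 1 + c * p ^ i \<le> real (Suc i) + c * p ^ Suc i" by (simp add: algebra_simps)
    then show ?thesis using p1 by (intro mult_left_mono powr_mono) auto
  qed
  finally show ?case by simp
qed

text \<open>Rounds \<open>n\<close> down to the largest power \<open>p ^ j\<close> not exceeding it.
  The \<open>j\<close> factors \<open>p\<close> of \<open>card_upto_bound\<close> contribute at most
  \<open>ln n\<close>.\<close>

lemma ln_card_upto_le:
  fixes c :: real
  assumes c: "0 < c" and b: "\<And>H. H \<in> level k \<Longrightarrow> real (dimh H) \<le> c * p ^ k" and n: "p ^ k \<le> n"
  shows "ln (card (index_upto n)) \<le> ln (card (index_upto (p ^ k))) + ln n + c * n * ln p"
proof -
  have n0: "n > 0" using n p0 by (metis gr0I le_zero_eq power_not_zero less_numeral_extra(3))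
  obtain j where j: "p ^ j \<le> n" "n < p ^ Suc j" using ex_power_ivl1[of p n] p1 n0 by auto
  have "p ^ k < p ^ Suc j" using n j by linarith
  then have kj: "k \<le> j" using p1 by (simp add: power_strict_increasing_iff del: power_Suc)
  \<comment> \<open>All indices are powers of \<open>p\<close>, so none lies strictly between
    \<open>p ^ j\<close> and \<open>n\<close>.\<close>
  have eq: "index_upto n = index_upto (p ^ j)"
  proof
    show "index_upto (p ^ j) \<subseteq> index_upto n" using j by (auto simp: index_upto_def)
    show "index_upto n \<subseteq> index_upto (p ^ j)"
    proof
      fix H assume H: "H \<in> index_upto n"
      then obtain i where i: "idx H = p ^ i" using popen_index[OF p] by (auto simp: index_upto_def)
      have "p ^ i < p ^ Suc j" using H i j by (simp add: index_upto_def del: power_Suc)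
      then have "i \<le> j" using p1 by (simp add: power_strict_increasing_iff del: power_Suc)
      then show "H \<in> index_upto (p ^ j)" using H i p1 by (simp add: index_upto_def)
    qed
  qed
  have pos: "card (index_upto n) \<ge> 1" "card (index_upto (p ^ k)) \<ge> 1" using card_upto_pos n0 p0 by simp_all
  have "real (card (index_upto n)) \<le> real (card (index_upto (p ^ k))) * p powr (j + c * p ^ j)"
    unfolding eq by (rule card_upto_bound[OF c b kj])
  then have "ln (real (card (index_upto n))) \<le> ln (real (card (index_upto (p ^ k))) * p powr (j + c * p ^ j))"
    using pos by (intro ln_mono) auto
  also have "\<dots> = ln (real (card (index_upto (p ^ k)))) + (j + c * p ^ j) * ln p"
    using pos p0 by (simp add: ln_mult ln_powr)
  also have "\<dots> = ln (real (card (index_upto (p ^ k)))) + real j * ln p + c * p ^ j * ln p"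
    by (simp add: algebra_simps)
  also have "real j * ln p \<le> ln n"
  proof -
    have "ln (real (p ^ j)) \<le> ln (real n)" using j p0 by (intro ln_mono) auto
    then show ?thesis using p0 by (simp add: ln_realpow)
  qed
  also have "c * p ^ j * ln p \<le> c * n * ln p"
  proof -
    have "real (p ^ j) \<le> real n" using j by (simp only: of_nat_le_iff)
    then show ?thesis using c p1 by (intro mult_right_mono mult_left_mono) auto
  qed
  finally show ?thesis by simp
qed

text \<open>After division by \<open>n\<close>, the constant and \<open>ln n\<close> tend to 0 and
  are eventually below \<open>c\<close>. This is the 1 in the factor \<open>1 + ln p\<close>; the
  other summand is the linear term.\<close>

lemma limsup_count_le:
  fixes c :: real
  assumes c: "0 < c" and b: "\<And>H. H \<in> level k \<Longrightarrow> real (dimh H) \<le> c * p ^ k"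
  shows "limsup (\<lambda>n. log_subgroup_count (pro_p_completion p G) n / ereal (real n)) \<le> ereal (c * (1 + ln p))"
proof (rule Limsup_bounded)
  let ?C = "ln (real (card (index_upto (p ^ k))))"
  have "(\<lambda>n. ?C / real n + ln (real n) / real n) \<longlonglongrightarrow> 0 + 0"
    by (intro tendsto_add lim_const_over_n filterlim_compose[OF ln_x_over_x_tendsto_0 filterlim_real_sequentially])
  then have "eventually (\<lambda>n. ?C / real n + ln (real n) / real n < c) sequentially"
    by (rule order_tendstoD(2)) (use c in simp)
  moreover have "eventually (\<lambda>n. n \<ge> Suc (p ^ k)) sequentially" by (rule eventually_ge_at_top)
  ultimately show "eventually (\<lambda>n. log_subgroup_count (pro_p_completion p G) n / ereal (real n)
      \<le> ereal (c * (1 + ln p))) sequentially"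
  proof eventually_elim
    case (elim n)
    then have n: "n > 0" "p ^ k \<le> n" by auto
    have "ln (card (index_upto n)) / n \<le> (?C + ln n + c * n * ln p) / n"
      using ln_card_upto_le[OF c b n(2)] by (intro divide_right_mono) auto
    also have "\<dots> = ?C / n + ln n / n + c * ln p" using n by (simp add: add_divide_distrib)
    also have "\<dots> \<le> c * (1 + ln p)" using elim by (simp add: algebra_simps)
    finally show ?case using n by (simp add: log_count)
  qed
qed

text \<open>The index \<open>p\<close> overgroup of a subgroup with ratio at least \<open>c\<close>
  again has ratio at least \<open>c\<close>. Chains of every finite length therefore exist, and they
  form a tree with finitely many nodes at each level.\<close>

lemma nested_sequence:
  fixes c :: real
  assumes lv: "\<And>k. \<exists>H\<in>level k. c * p ^ k \<le> real (dimh H)"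
  shows "\<exists>K. \<forall>k. K k \<in> level k \<and> c * p ^ k \<le> real (dimh (K k)) \<and> K (Suc k) \<subseteq> K k"
proof -
  \<comment> \<open>A chain of length \<open>k + 1\<close> is a function on all naturals of which
    only the values at \<open>0..k\<close> are constrained.\<close>
  define P where "P k x \<longleftrightarrow> (\<forall>i\<le>k. x i \<in> level i \<and> c * p ^ i \<le> real (dimh (x i))) \<and> (\<forall>i<k. x (Suc i) \<subseteq> x i)"
    for k and x :: "nat \<Rightarrow> 'a set"
  have build: "\<exists>x. P k x \<and> x k = H" if "H \<in> level k" "c * p ^ k \<le> real (dimh H)" for k H
    using that
  proof (induction k arbitrary: H)
    case 0
    then show ?case by (intro exI[of _ "\<lambda>_. H"]) (simp add: P_def)
  next
    case (Suc k)
    obtain M where M: "M \<in> level k" "H \<subseteq> M" "H \<lhd> G\<lparr>carrier := M\<rparr>" "rel_index G M H = p"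
      using level_parent[OF Suc.prems(1)] by blast
    have "dimh H \<le> p * dimh M"
      by (rule dimh_index_p) (use M Suc.prems in \<open>auto simp: level_def\<close>)
    then have "real (dimh H) \<le> real p * real (dimh M)" by (metis of_nat_le_iff of_nat_mult)
    then have "real p * (c * p ^ k) \<le> real p * real (dimh M)" using Suc.prems(2) by (simp add: algebra_simps)
    then have "c * p ^ k \<le> real (dimh M)" using p0 by simp
    then obtain x where x: "P k x" "x k = M" using Suc.IH[OF M(1)] by blast
    have "P (Suc k) (x(Suc k := H))"
      using x M(2) Suc.prems by (auto simp: P_def le_Suc_eq less_Suc_eq)
    moreover have "(x(Suc k := H)) (Suc k) = H" by simp
    ultimately show ?case by blast
  qed
  \<comment> \<open>A node at level \<open>k\<close> is the list of the first \<open>k + 1\<close>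
    values, which makes the levels finite. Successive chains agree on these entries, so the diagonal
    \<open>y k k\<close> is the desired descending sequence.\<close>
  have "\<exists>y. \<forall>k. P k (y k) \<and> map (y (Suc k)) [0..<Suc k] = map (y k) [0..<Suc k]"
  proof (rule koenig_sequence)
    show "P k x" if "P (Suc k) x" for k x using that by (simp add: P_def)
    show "\<exists>x. P k x" for k
    proof -
      obtain H where "H \<in> level k" "c * p ^ k \<le> real (dimh H)" using lv by blast
      from build[OF this] show ?thesis by blast
    qed
    show "finite ((\<lambda>x. map x [0..<Suc k]) ` {x. P k x})" for k
    proof -
      let ?A = "\<Union>i\<le>k. level i"
      have "finite {xs. set xs \<subseteq> ?A \<and> length xs = Suc k}"
        by (rule finite_lists_length_eq) (use finite_level in auto)
      moreover have "(\<lambda>x. map x [0..<Suc k]) ` {x. P k x} \<subseteq> {xs. set xs \<subseteq> ?A \<and> length xs = Suc k}"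
        unfolding P_def by (intro image_subsetI) (auto simp: less_Suc_eq_le simp del: upt_Suc)
      ultimately show ?thesis by (rule finite_subset[rotated])
    qed
  qed
  then obtain y where yy: "\<forall>k. P k (y k) \<and> map (y (Suc k)) [0..<Suc k] = map (y k) [0..<Suc k]" ..
  have y: "P k (y k)" and e: "map (y (Suc k)) [0..<Suc k] = map (y k) [0..<Suc k]" for k
    using yy[rule_format, of k] by (rule conjunct1, rule conjunct2)
  have yk: "y (Suc k) k = y k k" for k
    using e[of k] by (auto simp del: upt_Suc)
  have "y (Suc k) (Suc k) \<subseteq> y k k" for k using y[of "Suc k"] yk[of k] by (auto simp: P_def)
  then show ?thesis using y by (intro exI[of _ "\<lambda>k. y k k"]) (simp add: P_def)
qed

end

theorem theorem1p7:
  fixes G :: "('a, 'b) monoid_scheme" and p :: nat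
  assumes "finitely_generated_group G" and "prime p"
  shows "(\<exists>K :: nat \<Rightarrow> 'a set.
            (\<forall>i. K (Suc i) \<subseteq> K i) \<and> infinite (range K) \<and>
            (\<forall>i. subgroup (K i) G \<and> subnormal (K i) G \<and> (\<exists>k. subgroup_index G (K i) = p ^ k)) \<and>
            linear_growth_of_homology p G (range K))
         \<longleftrightarrow> exponential_subgroup_growth (pro_p_completion p G)"
proof -
  have "group G" using assms(1) by (simp add: finitely_generated_group_def)
  then interpret group G .
  interpret pro_p_growth G p using assms by unfold_locales
  let ?f = "\<lambda>n. log_subgroup_count (pro_p_completion p G) n / ereal (real n)"
  have lnp: "ln (real p) > 0" using p1 by simp
  show ?thesis
  proof
    assume "\<exists>K :: nat \<Rightarrow> 'a set.
            (\<forall>i. K (Suc i) \<subseteq> K i) \<and> infinite (range K) \<and>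
            (\<forall>i. subgroup (K i) G \<and> subnormal (K i) G \<and> (\<exists>k. subgroup_index G (K i) = p ^ k)) \<and>
            linear_growth_of_homology p G (range K)"
    then obtain K :: "nat \<Rightarrow> 'a set" where inf: "infinite (range K)"
      and K: "\<And>i. subnormal (K i) G \<and> (\<exists>k. idx (K i) = p ^ k)"
      and growth: "linear_growth_of_homology p G (range K)"
      unfolding subgroup_index_eq by blast
    have Kp: "K i \<in> popen p G" for i using subnormal_popen[OF fg p] K by blast
    define c where "c = (INF H\<in>range K. real (dimh H) / real (idx H))"
    have c0: "c > 0" using growth by (simp add: linear_growth_of_homology_def c_def subgroup_index_eq)
    have cK: "c * idx (K i) \<le> real (dimh (K i))" for i
    proof -
      have "c \<le> real (dimh (K i)) / real (idx (K i))"
        unfolding c_def by (rule cINF_lower) (auto intro: bdd_belowI[of _ 0])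
      then show ?thesis using popen_index_pos[OF p Kp] by (simp add: field_simps)
    qed
    \<comment> \<open>The 1/p pays for passing from index q to kernels of index up to p q. The 1/2
      absorbs the subtraction of 1 in \<open>dimh (K i) - 1\<close>, as soon as c q is at least
      2.\<close>
    define \<delta> where "\<delta> = c * ln p / (2 * p)"
    have \<delta>0: "\<delta> > 0" using c0 lnp p0 by (simp add: \<delta>_def)
    have big: "\<exists>n\<ge>n0. ?f n \<ge> ereal \<delta>" for n0
    proof -
      \<comment> \<open>Index beyond \<open>n0\<close> yields arbitrarily large \<open>n\<close>,
        and index beyond \<open>2 / c\<close> makes the subtraction of 1 harmless.\<close>
      define B where "B = nat \<lceil>max (real n0) (2 / c)\<rceil>"
      \<comment> \<open>There are finitely many open subgroups of bounded index, while the sequence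
        has infinitely many distinct terms.\<close>
      have "\<exists>i. idx (K i) > B"
      proof (rule ccontr)
        assume "\<not> ?thesis"
        then have "range K \<subseteq> index_upto B" using Kp by (auto simp: index_upto_def not_less)
        then show False using inf finite_upto finite_subset by blast
      qed
      then obtain i where i: "idx (K i) > B" by blast
      let ?q = "idx (K i)"
      have q: "real ?q \<ge> max (real n0) (2 / c)" using i unfolding B_def by linarith
      then have q2: "c * ?q \<ge> 2" using c0 by (simp add: field_simps)
      have q0: "?q > 0" using i by simp
      let ?n = "p * ?q"
      have "real ?n * \<delta> = (c * ?q / 2) * ln p" using p0 by (simp add: \<delta>_def field_simps)
      also have "\<dots> \<le> (c * ?q - 1) * ln p" using q2 lnp by (intro mult_right_mono) auto
      also have "\<dots> \<le> (real (dimh (K i)) - 1) * ln p" using cK[of i] lnp by (intro mult_right_mono) auto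
      also have "\<dots> \<le> ln (card (index_upto ?n))" using card_upto_lower[OF Kp[of i]] by (simp add: algebra_simps)
      finally have "\<delta> \<le> ln (card (index_upto ?n)) / ?n" using p0 q0 by (simp add: field_simps)
      then have "?f ?n \<ge> ereal \<delta>" using p0 q0 by (simp add: log_count)
      moreover have "n0 \<le> ?n"
      proof -
        have "n0 \<le> ?q" using q by simp
        also have "\<dots> \<le> p * ?q" using p0 by simp
        finally show ?thesis .
      qed
      ultimately show ?thesis by blast
    qed
    have "limsup ?f \<ge> ereal \<delta>"
    proof (rule ccontr)
      assume "\<not> ?thesis"
      then have "limsup ?f < ereal \<delta>" by simp
      then have "eventually (\<lambda>n. ?f n < ereal \<delta>) sequentially" by (rule Limsup_lessD)
      then obtain n0 where n0: "\<And>n. n \<ge> n0 \<Longrightarrow> ?f n < ereal \<delta>"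
        unfolding eventually_sequentially by blast
      obtain n where "n \<ge> n0" "?f n \<ge> ereal \<delta>" using big by blast
      then show False using n0[of n] by (simp only: not_le[symmetric])
    qed
    moreover have "ereal 0 < ereal \<delta>" using \<delta>0 by simp
    ultimately show "exponential_subgroup_growth (pro_p_completion p G)"
      unfolding exponential_subgroup_growth_def zero_ereal_def by (rule less_le_trans[rotated])
  next
    assume "exponential_subgroup_growth (pro_p_completion p G)"
    then have pos: "limsup ?f > 0" by (simp add: exponential_subgroup_growth_def)
    have "\<exists>c>(0::real). \<forall>k. \<exists>H\<in>level k. c * p ^ k \<le> real (dimh H)"
    proof (rule ccontr)
      assume no: "\<not> ?thesis"
      obtain e where e: "0 < ereal e" "ereal e < limsup ?f" using ereal_dense2[OF pos] by blast
      \<comment> \<open>Chosen so that the bound \<open>c * (1 + ln p)\<close> of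
        \<open>limsup_count_le\<close> equals \<open>e\<close>, which lies strictly below the limit
        superior.\<close>
      define c where "c = e / (1 + ln p)"
      have c0: "c > 0" using e lnp by (simp add: c_def)
      have ce: "c * (1 + ln p) = e" using lnp by (simp add: c_def)
      obtain k where "\<And>H. H \<in> level k \<Longrightarrow> real (dimh H) \<le> c * p ^ k"
        using no c0 by (meson linear)
      then have "limsup ?f \<le> ereal e" using limsup_count_le[OF c0, of k] ce by simp
      then show False using e(2) by simp
    qed
    then obtain c :: real where c0: "c > 0" and lv: "\<And>k. \<exists>H\<in>level k. c * p ^ k \<le> real (dimh H)" by blast
    obtain K where K: "\<And>k. K k \<in> level k" "\<And>k. c * p ^ k \<le> real (dimh (K k))" "\<And>k. K (Suc k) \<subseteq> K k"
      using nested_sequence[OF lv] by blast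
    have Kp: "K k \<in> popen p G" and Ki: "idx (K k) = p ^ k" for k using K(1)[of k] by (auto simp: level_def)
    have "inj K"
    proof (rule injI)
      fix i j assume "K i = K j"
      then have "p ^ i = p ^ j" using Ki[of i] Ki[of j] by simp
      then show "i = j" using p1 by simp
    qed
    then have "infinite (range K)" by (rule range_inj_infinite)
    moreover have "linear_growth_of_homology p G (range K)"
    proof -
      have "c \<le> (INF H\<in>range K. real (dimh H) / real (idx H))"
      proof (rule cINF_greatest)
        fix H assume "H \<in> range K"
        then obtain k where "H = K k" by blast
        then show "c \<le> real (dimh H) / real (idx H)" using K(2)[of k] Ki[of k] p0 by (simp add: field_simps)
      qed simp
      then show ?thesis using c0 by (simp add: linear_growth_of_homology_def subgroup_index_eq)
    qed
    ultimately show "\<exists>K :: nat \<Rightarrow> 'a set.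
            (\<forall>i. K (Suc i) \<subseteq> K i) \<and> infinite (range K) \<and>
            (\<forall>i. subgroup (K i) G \<and> subnormal (K i) G \<and> (\<exists>k. subgroup_index G (K i) = p ^ k)) \<and>
            linear_growth_of_homology p G (range K)"
      using K(3) popen_subgroup[OF Kp] popen_subnormal[OF p Kp] Ki
      by (intro exI[of _ K]) (auto simp: subgroup_index_eq)
  qed
qed

end
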